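(* Let $n>3$ and consider the complex Poisson algebras with basis $e_1,\dots,e_n$: $\mathcal{P}_0^n$ with only nonzero products $e_i\cdot e_j=e_{i+j}$ for $2\le i+j\le n$ and zero bracket; and, with $e_i\cdot e_j=e_{i+j}$ for $2\le i+j\le n-1$ plus the listed further nonzero products (up to commutativity/anticommutativity): $\mathcal{P}_{1,1}^n$: none; $\mathcal{P}_{1,2}^n$: $\{e_1,e_n\}=e_n$; $\mathcal{P}_{1,3}^n$: $\{e_1,e_n\}=e_{n-1}$; $\mathcal{P}_{1,4}^n$: $e_n\cdot e_n=e_{n-1}$; $\mathcal{P}_{1,5}^n$: $e_n\cdot e_n=e_{n-1}$, $\{e_1,e_n\}=e_{n-1}$. Their orbits in $\mathbf{P}_n$ have dimension $n^2-n$ for $\mathcal{P}_0^n,\mathcal{P}_{1,2}^n,\mathcal{P}_{1,5}^n$, $n^2-n-1$ for $\mathcal{P}_{1,3}^n,\mathcal{P}_{1,4}^n$, and $n^2-n-2$ for $\mathcal{P}_{1,1}^n$. The primary degenerations among these six algebras are exactly $\mathcal{P}_{1,2}^n\to\mathcal{P}_{1,3}^n$, $\mathcal{P}_{1,5}^n\to\mathcal{P}_{1,3}^n$, $\mathcal{P}_{1,5}^n\to\mathcal{P}_{1,4}^n$, $\mathcal{P}_0^n\to\mathcal{P}_{1,4}^n$, $\mathcal{P}_{1,3}^n\to\mathcal{P}_{1,1}^n$, $\mathcal{P}_{1,4}^n\to\mathcal{P}_{1,1}^n$; moreover $\mathcal{P}_0^n\not\to\mathcal{P}_{1,3}^n$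 and $\mathcal{P}_{1,2}^n\not\to\mathcal{P}_{1,4}^n$, and for two distinct algebras $\mathcal{A},\mathcal{B}$ among these six, $\mathcal{A}\to\mathcal{B}$ if and only if there is a chain of the listed primary degenerations from $\mathcal{A}$ to $\mathcal{B}$.
   Context: Fix an $n$-dimensional complex vector space $V$; pairs $(\mu,\mu')$ of bilinear maps on $V$ are identified with their structure constants in $\mathbb{C}^{2n^3}$, and $\mathbf{P}_n$ is the variety of pairs defining Poisson algebras ($\mu$ commutative associative, $\mu'$ Lie, $\mu'(\mu(x,y),z)=\mu(\mu'(x,z),y)+\mu(x,\mu'(y,z))$). $\mathrm{GL}(V)$ acts by $(g*(\mu,\mu'))(x,y)=(g\mu(g^{-1}x,g^{-1}y),g\mu'(g^{-1}x,g^{-1}y))$. $\mathcal{P}\to\mathcal{P}'$ means a structure representing $\mathcal{P}'$ lies in the Zariski closure of the orbit of a structure representing $\mathcal{P}$; $\not\to$ denotes its negation; a degeneration is primary if it is proper ($\mathcal{P}\not\cong\mathcal{P}'$) and does not factor as two proper degenerations through some $\mathcal{P}''$. *)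

theory Defs
  imports Complex_Main
begin

text \<open>A pair (mu, mu') is given by its structure constants: fst p i j k (resp. snd p i j k)
  is the coefficient of e_k in mu(e_i,e_j) (resp. mu'(e_i,e_j)), for i,j,k in {1..n}.
  Outside {1..n} the constants are required to be 0, so space n is a copy of C^(2n^3).\<close>

type_synonym sconst = "nat \<Rightarrow> nat \<Rightarrow> nat \<Rightarrow> complex"
type_synonym pstruct = "sconst \<times> sconst"

definition idx :: "nat \<Rightarrow> nat set" where "idx n = {1..n}"

definition space :: "nat \<Rightarrow> pstruct set" where
  "space n = {p. \<forall>i j k. \<not> (i \<in> idx n \<and> j \<in> idx n \<and> k \<in> idx n) \<longrightarrow>
                         fst p i j k = 0 \<and> snd p i j k = 0}"

definition vec :: "nat \<Rightarrow> (nat \<Rightarrow> complex) set" where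
  "vec n = {x. \<forall>i. i \<notin> idx n \<longrightarrow> x i = 0}"

definition bil :: "nat \<Rightarrow> sconst \<Rightarrow> (nat \<Rightarrow> complex) \<Rightarrow> (nat \<Rightarrow> complex) \<Rightarrow> (nat \<Rightarrow> complex)" where
  "bil n c x y = (\<lambda>k. if k \<in> idx n then (\<Sum>i\<in>idx n. \<Sum>j\<in>idx n. x i * y j * c i j k) else 0)"

definition poisson :: "nat \<Rightarrow> pstruct \<Rightarrow> bool" where
  "poisson n p \<longleftrightarrow> p \<in> space n \<and>
    (\<forall>x\<in>vec n. \<forall>y\<in>vec n. \<forall>z\<in>vec n.
       bil n (fst p) x y = bil n (fst p) y x \<and>
       bil n (fst p) (bil n (fst p) x y) z = bil n (fst p) x (bil n (fst p) y z) \<and>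
       bil n (snd p) x x = (\<lambda>k. 0) \<and>
       (\<forall>k. bil n (snd p) (bil n (snd p) x y) z k + bil n (snd p) (bil n (snd p) y z) x k
            + bil n (snd p) (bil n (snd p) z x) y k = 0) \<and>
       (\<forall>k. bil n (snd p) (bil n (fst p) x y) z k =
            bil n (fst p) (bil n (snd p) x z) y k + bil n (fst p) x (bil n (snd p) y z) k))"

text \<open>g (with inverse h) is an invertible n x n matrix; g e_i = sum_k g k i e_k.\<close>
definition invpair :: "nat \<Rightarrow> (nat \<Rightarrow> nat \<Rightarrow> complex) \<Rightarrow> (nat \<Rightarrow> nat \<Rightarrow> complex) \<Rightarrow> bool" where
  "invpair n g h \<longleftrightarrow>
     (\<forall>i j. \<not> (i \<in> idx n \<and> j \<in> idx n) \<longrightarrow> g i j = 0 \<and> h i j = 0) \<and>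
     (\<forall>i\<in>idx n. \<forall>k\<in>idx n. (\<Sum>j\<in>idx n. g i j * h j k) = (if i = k then 1 else 0)) \<and>
     (\<forall>i\<in>idx n. \<forall>k\<in>idx n. (\<Sum>j\<in>idx n. h i j * g j k) = (if i = k then 1 else 0))"

text \<open>(g * mu)(x,y) = g mu(g^-1 x, g^-1 y) in structure constants.\<close>
definition act1 :: "nat \<Rightarrow> (nat \<Rightarrow> nat \<Rightarrow> complex) \<Rightarrow> (nat \<Rightarrow> nat \<Rightarrow> complex) \<Rightarrow> sconst \<Rightarrow> sconst" where
  "act1 n g h c = (\<lambda>i j k. if i \<in> idx n \<and> j \<in> idx n \<and> k \<in> idx n then
      (\<Sum>a\<in>idx n. \<Sum>b\<in>idx n. \<Sum>l\<in>idx n. h a i * h b j * c a b l * g k l) else 0)"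

definition act :: "nat \<Rightarrow> (nat \<Rightarrow> nat \<Rightarrow> complex) \<Rightarrow> (nat \<Rightarrow> nat \<Rightarrow> complex) \<Rightarrow> pstruct \<Rightarrow> pstruct" where
  "act n g h p = (act1 n g h (fst p), act1 n g h (snd p))"

definition orbit :: "nat \<Rightarrow> pstruct \<Rightarrow> pstruct set" where
  "orbit n p = {act n g h p | g h. invpair n g h}"

inductive_set polyfun :: "nat \<Rightarrow> (pstruct \<Rightarrow> complex) set" for n where
  pconst: "(\<lambda>_. a) \<in> polyfun n"
| pcoord1: "i \<in> idx n \<Longrightarrow> j \<in> idx n \<Longrightarrow> k \<in> idx n \<Longrightarrow> (\<lambda>p. fst p i j k) \<in> polyfun n"
| pcoord2: "i \<in> idx n \<Longrightarrow> j \<in> idx n \<Longrightarrow> k \<in> idx n \<Longrightarrow> (\<lambda>p. snd p i j k) \<in> polyfun n"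
| padd: "f \<in> polyfun n \<Longrightarrow> g \<in> polyfun n \<Longrightarrow> (\<lambda>p. f p + g p) \<in> polyfun n"
| pmult: "f \<in> polyfun n \<Longrightarrow> g \<in> polyfun n \<Longrightarrow> (\<lambda>p. f p * g p) \<in> polyfun n"

definition zclosed :: "nat \<Rightarrow> pstruct set \<Rightarrow> bool" where
  "zclosed n Z \<longleftrightarrow> (\<exists>F \<subseteq> polyfun n. Z = {p \<in> space n. \<forall>f\<in>F. f p = 0})"

definition zclosure :: "nat \<Rightarrow> pstruct set \<Rightarrow> pstruct set" where
  "zclosure n X = \<Inter> {Z. zclosed n Z \<and> X \<subseteq> Z}"

definition rel_zclosed :: "nat \<Rightarrow> pstruct set \<Rightarrow> pstruct set \<Rightarrow> bool" where
  "rel_zclosed n X Z \<longleftrightarrow> (\<exists>C. zclosed n C \<and> Z = X \<inter> C)"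

definition irreducible_z :: "nat \<Rightarrow> pstruct set \<Rightarrow> bool" where
  "irreducible_z n Z \<longleftrightarrow> Z \<noteq> {} \<and>
     (\<forall>A B. zclosed n A \<longrightarrow> zclosed n B \<longrightarrow> Z \<subseteq> A \<union> B \<longrightarrow> Z \<subseteq> A \<or> Z \<subseteq> B)"

definition has_chain :: "nat \<Rightarrow> pstruct set \<Rightarrow> nat \<Rightarrow> bool" where
  "has_chain n X k \<longleftrightarrow> (\<exists>Z :: nat \<Rightarrow> pstruct set.
      (\<forall>i\<le>k. rel_zclosed n X (Z i) \<and> irreducible_z n (Z i)) \<and> (\<forall>i<k. Z i \<subset> Z (Suc i)))"

definition zdim :: "nat \<Rightarrow> pstruct set \<Rightarrow> nat \<Rightarrow> bool" where
  "zdim n X d \<longleftrightarrow> has_chain n X d \<and> \<not> has_chain n X (Suc d)"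

definition iso :: "nat \<Rightarrow> pstruct \<Rightarrow> pstruct \<Rightarrow> bool" where
  "iso n p q \<longleftrightarrow> q \<in> orbit n p"

definition degen :: "nat \<Rightarrow> pstruct \<Rightarrow> pstruct \<Rightarrow> bool" where
  "degen n p q \<longleftrightarrow> (\<exists>q' \<in> orbit n q. q' \<in> zclosure n (orbit n p))"

definition primary :: "nat \<Rightarrow> pstruct \<Rightarrow> pstruct \<Rightarrow> bool" where
  "primary n p q \<longleftrightarrow> degen n p q \<and> \<not> iso n p q \<and>
     \<not> (\<exists>r. poisson n r \<and> degen n p r \<and> \<not> iso n p r \<and> degen n r q \<and> \<not> iso n r q)"

definition chainm :: "nat \<Rightarrow> nat \<Rightarrow> sconst" where
  "chainm n N = (\<lambda>i j k. if i \<in> idx n \<and> j \<in> idx n \<and> 2 \<le> i + j \<and> i + j \<le> N \<and> k = i + j then 1 else 0)"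

definition br1n :: "nat \<Rightarrow> nat \<Rightarrow> sconst" where
  "br1n n t = (\<lambda>i j k. if i = 1 \<and> j = n \<and> k = t then 1 else if i = n \<and> j = 1 \<and> k = t then -1 else 0)"

definition sqn :: "nat \<Rightarrow> sconst" where
  "sqn n = (\<lambda>i j k. if i = n \<and> j = n \<and> k = n - 1 then 1 else 0)"

datatype alg = P0 | P11 | P12 | P13 | P14 | P15

fun alg_struct :: "nat \<Rightarrow> alg \<Rightarrow> pstruct" where
  "alg_struct n P0  = (chainm n n, (\<lambda>i j k. 0))"
| "alg_struct n P11 = (chainm n (n - 1), (\<lambda>i j k. 0))"
| "alg_struct n P12 = (chainm n (n - 1), br1n n n)"
| "alg_struct n P13 = (chainm n (n - 1), br1n n (n - 1))"
| "alg_struct n P14 = (\<lambda>i j k. chainm n (n - 1) i j k + sqn n i j k, (\<lambda>i j k. 0))"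
| "alg_struct n P15 = (\<lambda>i j k. chainm n (n - 1) i j k + sqn n i j k, br1n n (n - 1))"

definition prim_list :: "(alg \<times> alg) set" where
  "prim_list = {(P12, P13), (P15, P13), (P15, P14), (P0, P14), (P13, P11), (P14, P11)}"

end

theory Submission
  imports "Jordan_Normal_Form.Determinant" "HOL-Library.Function_Algebras" Defs
begin

text \<open>
  Let E = e_1. On the open set where E, E^2, ..., E^(n-1), e_n are linearly independent, every Poisson structure in
  which all n-fold products vanish has a canonical basis: the powers of E together with the correction w of e_n by
  powers of E for which E w = 0. In this basis the structure constants are those of the algebra with
  w w = b E^(n-1) and {E, w} = c E^(n-1) + d w, where b d = 0, and the orbits of P11, ..., P15 are cut out by
  vanishing and non-vanishing conditions on b, c, d. Hence each orbit is birational to an affine space whose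
  coordinates are the powers of E, the coefficients of E e_n, and the free ones among b, c, d; for P0 the powers
  E^2, ..., E^n suffice. The coordinates are regular functions on an open set, so coordinate subspaces give a
  chain of irreducible subsets of full length and their vanishing obstructs degenerations. Longer chains are
  impossible: a chain of length k yields k functions with linearly independent monomials, while pullbacks
  to a d-dimensional affine space leave room only for k at most d.

  Each of the six orbits contains a nonempty open subset of its closure, so an algebra strictly between two of them
  would produce a strictly longer chain of closures; since the dimensions in the list differ by one, the listed
  degenerations are primary.
\<close>

section \<open>Algebras of functions\<close>

text \<open>The functions b, c, d are only rational on the space of structure constants, so they are
  not themselves equations of closures. They become usable because every normal form lies where D is
  nonzero: an orbit is irreducible, its part with D nonzero is dense, and a coordinate vanishing
  there must vanish at each normal form in the closure. Which of b, c, d are coordinates on an orbit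
  is decided by the remaining freedom E -> a E, w -> t w + r E^(n-1), which sends (b, c, d) to (t^2
  b / a^(n-1), (t c - d r) / a^(n-2), a d): a nonzero d makes c arbitrary, and for d = 0 nonzero
  values of b and c can be normalised. The n (n - 2) entries of E^2, ..., E^(n-1) and n - 2
  coefficients of E e_n give n^2 - n - 2 coordinates, and each free parameter adds one; for P0 there
  are n (n - 1) entries.\<close>

definition funalg :: "('x \<Rightarrow> complex) set \<Rightarrow> bool" where
  "funalg R \<longleftrightarrow> (\<forall>a. (\<lambda>_. a) \<in> R) \<and>
     (\<forall>f\<in>R. \<forall>g\<in>R. (\<lambda>x. f x + g x) \<in> R \<and> (\<lambda>x. f x * g x) \<in> R)"

lemma funalg_const: "funalg R \<Longrightarrow> (\<lambda>_. a) \<in> R"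
  and funalg_add: "funalg R \<Longrightarrow> f \<in> R \<Longrightarrow> g \<in> R \<Longrightarrow> (\<lambda>x. f x + g x) \<in> R"
  and funalg_mult: "funalg R \<Longrightarrow> f \<in> R \<Longrightarrow> g \<in> R \<Longrightarrow> (\<lambda>x. f x * g x) \<in> R"
  by (auto simp: funalg_def)

lemma funalg_uminus: "funalg R \<Longrightarrow> f \<in> R \<Longrightarrow> (\<lambda>x. - f x) \<in> R"
  using funalg_mult[OF _ funalg_const, of R f "-1"] by simp

lemma funalg_diff: "funalg R \<Longrightarrow> f \<in> R \<Longrightarrow> g \<in> R \<Longrightarrow> (\<lambda>x. f x - g x) \<in> R"
  using funalg_add[OF _ _ funalg_uminus, of R f g] by simp

lemma funalg_power: "funalg R \<Longrightarrow> f \<in> R \<Longrightarrow> (\<lambda>x. f x ^ m) \<in> R"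
  by (induction m) (auto intro: funalg_const funalg_mult)

lemma funalg_sum:
  assumes "funalg R" "\<And>i. i \<in> A \<Longrightarrow> f i \<in> R"
  shows "(\<lambda>x. \<Sum>i\<in>A. f i x) \<in> R"
  using assms(2)
  by (induction A rule: infinite_finite_induct)
     (auto intro: funalg_const[OF assms(1)] funalg_add[OF assms(1)])

lemma funalg_prod:
  assumes "funalg R" "\<And>i. i \<in> A \<Longrightarrow> f i \<in> R"
  shows "(\<lambda>x. \<Prod>i\<in>A. f i x) \<in> R"
  using assms(2)
  by (induction A rule: infinite_finite_induct)
     (auto intro: funalg_const[OF assms(1)] funalg_mult[OF assms(1)])

lemma funalg_polyfun: "funalg (polyfun n)"
  by (auto simp: funalg_def intro: polyfun.intros)

section \<open>Polynomial functions of the parameters and their localisations\<close>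

inductive_set Pol :: "'i set \<Rightarrow> (('i \<Rightarrow> complex) \<Rightarrow> complex) set" for I where
  Pol_const: "(\<lambda>_. a) \<in> Pol I"
| Pol_coord: "i \<in> I \<Longrightarrow> (\<lambda>x. x i) \<in> Pol I"
| Pol_add: "f \<in> Pol I \<Longrightarrow> g \<in> Pol I \<Longrightarrow> (\<lambda>x. f x + g x) \<in> Pol I"
| Pol_mult: "f \<in> Pol I \<Longrightarrow> g \<in> Pol I \<Longrightarrow> (\<lambda>x. f x * g x) \<in> Pol I"

lemma funalg_Pol: "funalg (Pol I)"
  by (auto simp: funalg_def intro: Pol.intros)

lemma Pol_comp:
  assumes "funalg R" "F \<in> Pol I" "\<And>i. i \<in> I \<Longrightarrow> (\<lambda>y. \<psi> y i) \<in> R"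
  shows "(\<lambda>y. F (\<psi> y)) \<in> R"
  using assms(2)
  by induction (auto intro: assms(3) funalg_const[OF assms(1)] funalg_add[OF assms(1)] funalg_mult[OF assms(1)])

text \<open>The localisation of R at D; nothing is required where D vanishes.\<close>
definition reg :: "('x \<Rightarrow> complex) set \<Rightarrow> ('x \<Rightarrow> complex) \<Rightarrow> ('x \<Rightarrow> complex) set" where
  "reg R D = {F. \<exists>m. \<exists>P\<in>R. \<forall>x. D x \<noteq> 0 \<longrightarrow> F x * D x ^ m = P x}"

lemma regI: "P \<in> R \<Longrightarrow> (\<And>x. D x \<noteq> 0 \<Longrightarrow> F x * D x ^ m = P x) \<Longrightarrow> F \<in> reg R D"
  by (auto simp: reg_def)

lemma reg_base: "P \<in> R \<Longrightarrow> P \<in> reg R D"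
  by (rule regI[where m = 0]) auto

lemma reg_inverse: "funalg R \<Longrightarrow> (\<lambda>x. 1 / D x) \<in> reg R D"
  by (rule regI[where m = 1, OF funalg_const[of R 1]]) auto

lemma funalg_reg:
  assumes R: "funalg R" and D: "D \<in> R"
  shows "funalg (reg R D)"
  unfolding funalg_def
proof (intro conjI allI ballI)
  show "(\<lambda>_. a) \<in> reg R D" for a
    by (rule reg_base[OF funalg_const[OF R]])
  fix f g assume "f \<in> reg R D" "g \<in> reg R D"
  then obtain m P k Q where P: "P \<in> R" "\<And>x. D x \<noteq> 0 \<Longrightarrow> f x * D x ^ m = P x"
    and Q: "Q \<in> R" "\<And>x. D x \<noteq> 0 \<Longrightarrow> g x * D x ^ k = Q x"
    unfolding reg_def by blast
  note c = funalg_mult[OF R] funalg_add[OF R] funalg_power[OF R D]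
  show "(\<lambda>x. f x + g x) \<in> reg R D"
  proof (rule regI[where m = "m + k"])
    show "(\<lambda>x. P x * D x ^ k + Q x * D x ^ m) \<in> R"
      by (intro c P Q)
  next
    fix x assume x: "D x \<noteq> 0"
    show "(f x + g x) * D x ^ (m + k) = P x * D x ^ k + Q x * D x ^ m"
      unfolding P(2)[OF x, symmetric] Q(2)[OF x, symmetric] by (simp add: algebra_simps power_add)
  qed
  show "(\<lambda>x. f x * g x) \<in> reg R D"
  proof (rule regI[where m = "m + k"])
    show "(\<lambda>x. P x * Q x) \<in> R"
      by (intro c P Q)
  next
    fix x assume x: "D x \<noteq> 0"
    show "(f x * g x) * D x ^ (m + k) = P x * Q x"
      unfolding P(2)[OF x, symmetric] Q(2)[OF x, symmetric] by (simp add: algebra_simps power_add)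
  qed
qed

definition regmap :: "nat \<Rightarrow> ('x \<Rightarrow> complex) set \<Rightarrow> ('x \<Rightarrow> pstruct) \<Rightarrow> bool" where
  "regmap n R \<Theta> \<longleftrightarrow> (\<forall>i\<in>idx n. \<forall>j\<in>idx n. \<forall>k\<in>idx n.
      (\<lambda>x. fst (\<Theta> x) i j k) \<in> R \<and> (\<lambda>x. snd (\<Theta> x) i j k) \<in> R)"

lemma polyfun_comp:
  assumes "funalg R" "regmap n R \<Theta>" "f \<in> polyfun n"
  shows "(\<lambda>x. f (\<Theta> x)) \<in> R"
  using assms(3)
  by induction (use assms(2) in \<open>auto simp: regmap_def intro: funalg_const[OF assms(1)]
     funalg_add[OF assms(1)] funalg_mult[OF assms(1)]\<close>)

lemma regmap_id: "regmap n (polyfun n) (\<lambda>y. y)"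
  by (auto simp: regmap_def intro: polyfun.intros)

section \<open>Zariski closure and irreducibility\<close>

lemma zclosed_zeros: "F \<subseteq> polyfun n \<Longrightarrow> zclosed n {p \<in> space n. \<forall>f\<in>F. f p = 0}"
  unfolding zclosed_def by (intro exI[of _ F] conjI refl)

lemma in_zclosure_iff:
  assumes "X \<subseteq> space n"
  shows "y \<in> zclosure n X \<longleftrightarrow> y \<in> space n \<and> (\<forall>f\<in>polyfun n. (\<forall>x\<in>X. f x = 0) \<longrightarrow> f y = 0)"
proof
  assume y: "y \<in> zclosure n X"
  have "f y = 0 \<and> y \<in> space n" if "f \<in> polyfun n" "\<forall>x\<in>X. f x = 0" for f
    using y zclosed_zeros[of "{f}" n] that assms unfolding zclosure_def by fastforce
  \<comment> \<open>The zero polynomial meets the premise and supplies membership in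
    \<open>space n\<close>.\<close>
  from this[of "\<lambda>_. 0"] this show "y \<in> space n \<and> (\<forall>f\<in>polyfun n. (\<forall>x\<in>X. f x = 0) \<longrightarrow> f y = 0)"
    by (auto intro: polyfun.intros)
next
  assume y: "y \<in> space n \<and> (\<forall>f\<in>polyfun n. (\<forall>x\<in>X. f x = 0) \<longrightarrow> f y = 0)"
  show "y \<in> zclosure n X"
    unfolding zclosure_def
  proof (rule InterI)
    fix Z assume "Z \<in> {Z. zclosed n Z \<and> X \<subseteq> Z}"
    then obtain F where "F \<subseteq> polyfun n" "Z = {p \<in> space n. \<forall>f\<in>F. f p = 0}" "X \<subseteq> Z"
      unfolding zclosed_def by blast
    then have "f y = 0" if "f \<in> F" for f
      using y that by blast
    with \<open>Z = _\<close> y show "y \<in> Z"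
      by simp
  qed
qed

lemma zclosure_zclosed:
  assumes "X \<subseteq> space n"
  shows "zclosed n (zclosure n X)"
proof -
  have "zclosure n X = {p \<in> space n. \<forall>f\<in>{f \<in> polyfun n. \<forall>x\<in>X. f x = 0}. f p = 0}"
    using in_zclosure_iff[OF assms] by blast
  then show ?thesis
    using zclosed_zeros[of "{f \<in> polyfun n. \<forall>x\<in>X. f x = 0}" n] by auto
qed

lemma zclosure_superset: "X \<subseteq> zclosure n X"
  by (auto simp: zclosure_def)

lemma zclosed_subset_space: "zclosed n C \<Longrightarrow> C \<subseteq> space n"
  by (auto simp: zclosed_def)

lemma zclosure_subset_space: "X \<subseteq> space n \<Longrightarrow> zclosure n X \<subseteq> space n"
  by (rule zclosed_subset_space[OF zclosure_zclosed])

lemma zclosure_minimal: "zclosed n C \<Longrightarrow> X \<subseteq> C \<Longrightarrow> zclosure n X \<subseteq> C"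
  by (auto simp: zclosure_def)

lemma zclosed_separate:
  assumes "zclosed n C" "z \<in> space n" "z \<notin> C"
  obtains f where "f \<in> polyfun n" "\<forall>x\<in>C. f x = 0" "f z \<noteq> 0"
proof -
  obtain F where F: "F \<subseteq> polyfun n" "C = {p \<in> space n. \<forall>f\<in>F. f p = 0}"
    using assms(1) unfolding zclosed_def by auto
  with assms(2,3) obtain f where "f \<in> F" "f z \<noteq> 0"
    by auto
  with F show ?thesis
    by (intro that[of f]) auto
qed

text \<open>One polynomial separates a point from a closed set, so covers by two closed sets reduce
  to products of two polynomials.\<close>

lemma irreducible_z_iff:
  assumes "Z \<subseteq> space n"
  shows "irreducible_z n Z \<longleftrightarrow> Z \<noteq> {} \<and>
    (\<forall>f\<in>polyfun n. \<forall>g\<in>polyfun n. (\<forall>z\<in>Z. f z * g z = 0) \<longrightarrow> (\<forall>z\<in>Z. f z = 0) \<or> (\<forall>z\<in>Z. g z = 0))"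
    (is "_ \<longleftrightarrow> _ \<and> ?prod")
proof
  assume irr: "irreducible_z n Z"
  have ?prod
  proof (intro ballI impI)
    fix f g assume fg: "f \<in> polyfun n" "g \<in> polyfun n" "\<forall>z\<in>Z. f z * g z = 0"
    let ?V = "\<lambda>f. {p \<in> space n. \<forall>f\<in>{f}. f p = 0}"
    have "Z \<subseteq> ?V f \<union> ?V g"
      using fg(3) assms by auto
    then have "Z \<subseteq> ?V f \<or> Z \<subseteq> ?V g"
      using irr fg zclosed_zeros[of "{f}" n] zclosed_zeros[of "{g}" n]
      unfolding irreducible_z_def by blast
    then show "(\<forall>z\<in>Z. f z = 0) \<or> (\<forall>z\<in>Z. g z = 0)"
      by auto
  qed
  with irr show "Z \<noteq> {} \<and> ?prod"
    by (auto simp: irreducible_z_def)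
next
  assume pr: "Z \<noteq> {} \<and> ?prod"
  show "irreducible_z n Z"
    unfolding irreducible_z_def
  proof (intro conjI allI impI)
    fix A B assume AB: "zclosed n A" "zclosed n B" "Z \<subseteq> A \<union> B"
    show "Z \<subseteq> A \<or> Z \<subseteq> B"
    proof (rule ccontr)
      assume "\<not> (Z \<subseteq> A \<or> Z \<subseteq> B)"
      then obtain z z' where z: "z \<in> Z" "z \<notin> A" "z' \<in> Z" "z' \<notin> B"
        by blast
      obtain f where f: "f \<in> polyfun n" "\<forall>x\<in>A. f x = 0" "f z \<noteq> 0"
        using zclosed_separate[OF AB(1), of z] z assms by blast
      obtain g where g: "g \<in> polyfun n" "\<forall>x\<in>B. g x = 0" "g z' \<noteq> 0"
        using zclosed_separate[OF AB(2), of z'] z assms by blast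
      have "\<forall>z\<in>Z. f z * g z = 0"
        using AB(3) f(2) g(2) by auto
      then show False
        using pr f g z by blast
    qed
  qed (use pr in auto)
qed

lemma irreducible_z_mult:
  assumes "irreducible_z n Z" "Z \<subseteq> space n" "f \<in> polyfun n" "g \<in> polyfun n" "\<forall>z\<in>Z. f z * g z = 0"
  shows "(\<forall>z\<in>Z. f z = 0) \<or> (\<forall>z\<in>Z. g z = 0)"
  by (rule irreducible_z_iff[OF assms(2), THEN iffD1, OF assms(1), THEN conjunct2, THEN bspec[of _ _ f],
      OF assms(3), THEN bspec[of _ _ g], OF assms(4), THEN mp, OF assms(5)])

text \<open>\<open>Y\<close> and \<open>Z\<close> have the same vanishing polynomials, so the
  product criterion transfers. This serves closures relative to an orbit as well as full
  closures.\<close>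

lemma irreducible_z_between:
  assumes "irreducible_z n Y" "Y \<subseteq> Z" "Z \<subseteq> zclosure n Y" "Y \<subseteq> space n"
  shows "irreducible_z n Z"
proof -
  have Z: "Z \<subseteq> space n"
    using assms zclosure_subset_space by blast
  have "(\<forall>z\<in>Z. f z = 0) \<longleftrightarrow> (\<forall>z\<in>Y. f z = 0)" if "f \<in> polyfun n" for f
    using in_zclosure_iff[OF assms(4)] assms(2,3) that by blast
  moreover have "Z \<noteq> {}"
    using assms irreducible_z_def by blast
  moreover have "(\<forall>z\<in>Y. f z = 0) \<or> (\<forall>z\<in>Y. g z = 0)"
    if "f \<in> polyfun n" "g \<in> polyfun n" "\<forall>z\<in>Z. f z * g z = 0" for f g
    using irreducible_z_mult[OF assms(1,4) that(1,2)] that(3) assms(2) by auto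
  ultimately show ?thesis
    unfolding irreducible_z_iff[OF Z] by simp
qed

text \<open>Along a line a polynomial in many parameters becomes a polynomial in one variable, where
  the absence of zero divisors and the existence of non-roots are at hand.\<close>

lemma Pol_line:
  assumes "F \<in> Pol I"
  shows "\<exists>p. \<forall>t. F (\<lambda>i. x1 i + t * (x2 i - x1 i)) = poly p t"
  using assms
proof induction
  case (Pol_const a)
  show ?case by (intro exI[of _ "[:a:]"]) simp
next
  case (Pol_coord i)
  show ?case by (intro exI[of _ "[:x1 i, x2 i - x1 i:]"]) simp
next
  case (Pol_add f g)
  then obtain p q where "\<forall>t. f (\<lambda>i. x1 i + t * (x2 i - x1 i)) = poly p t"
    "\<forall>t. g (\<lambda>i. x1 i + t * (x2 i - x1 i)) = poly q t" by blast
  then show ?case by (intro exI[of _ "p + q"]) simp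
next
  case (Pol_mult f g)
  then obtain p q where "\<forall>t. f (\<lambda>i. x1 i + t * (x2 i - x1 i)) = poly p t"
    "\<forall>t. g (\<lambda>i. x1 i + t * (x2 i - x1 i)) = poly q t" by blast
  then show ?case by (intro exI[of _ "p * q"]) simp
qed

text \<open>Two points of the parameter domain are joined by a line, on which every regular function
  becomes a quotient of polynomials in one variable.\<close>
lemma irreducible_z_image:
  assumes L: "\<And>x1 x2 t. x1 \<in> L \<Longrightarrow> x2 \<in> L \<Longrightarrow> (\<lambda>i. x1 i + t * (x2 i - x1 i)) \<in> L"
    and \<Delta>: "\<Delta> \<in> Pol I" and \<Theta>: "regmap n (reg (Pol I) \<Delta>) \<Theta>"
    and ne: "{x \<in> L. \<Delta> x \<noteq> 0} \<noteq> {}" and sp: "\<Theta> ` {x \<in> L. \<Delta> x \<noteq> 0} \<subseteq> space n"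
  shows "irreducible_z n (\<Theta> ` {x \<in> L. \<Delta> x \<noteq> 0})"
  unfolding irreducible_z_iff[OF sp]
proof (intro conjI ballI impI)
  fix f g assume fg: "f \<in> polyfun n" "g \<in> polyfun n" "\<forall>z\<in>\<Theta> ` {x \<in> L. \<Delta> x \<noteq> 0}. f z * g z = 0"
  note fr = funalg_reg[OF funalg_Pol \<Delta>]
  obtain m P where P: "P \<in> Pol I" "\<And>x. \<Delta> x \<noteq> 0 \<Longrightarrow> f (\<Theta> x) * \<Delta> x ^ m = P x"
    using polyfun_comp[OF fr \<Theta> fg(1)] unfolding reg_def by blast
  obtain k Q where Q: "Q \<in> Pol I" "\<And>x. \<Delta> x \<noteq> 0 \<Longrightarrow> g (\<Theta> x) * \<Delta> x ^ k = Q x"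
    using polyfun_comp[OF fr \<Theta> fg(2)] unfolding reg_def by blast
  show "(\<forall>z\<in>\<Theta> ` {x \<in> L. \<Delta> x \<noteq> 0}. f z = 0) \<or> (\<forall>z\<in>\<Theta> ` {x \<in> L. \<Delta> x \<noteq> 0}. g z = 0)"
  proof (rule ccontr)
    assume "\<not> ?thesis"
    then obtain x1 x2 where x: "x1 \<in> L" "\<Delta> x1 \<noteq> 0" "f (\<Theta> x1) \<noteq> 0" "x2 \<in> L" "\<Delta> x2 \<noteq> 0" "g (\<Theta> x2) \<noteq> 0"
      by blast
    define l where "l t = (\<lambda>i. x1 i + t * (x2 i - x1 i))" for t
    have l: "l 0 = x1" "l 1 = x2" "l t \<in> L" for t
      using L[OF x(1,4)] by (auto simp: l_def)
    obtain p q d where pqd: "\<And>t. P (l t) = poly p t" "\<And>t. Q (l t) = poly q t" "\<And>t. \<Delta> (l t) = poly d t"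
      using Pol_line[OF P(1), of x1 x2] Pol_line[OF Q(1), of x1 x2] Pol_line[OF \<Delta>, of x1 x2]
      unfolding l_def by metis
    \<comment> \<open>The factor \<open>d\<close> takes care of the parameters with
      \<open>\<Delta> (l t) = 0\<close>, about which the assumption says nothing.\<close>
    have "poly (p * q * d) t = 0" for t
    proof (cases "\<Delta> (l t) = 0")
      case True
      then show ?thesis using pqd(3) by simp
    next
      case False
      then have "f (\<Theta> (l t)) * g (\<Theta> (l t)) = 0"
        using fg(3) l(3) by auto
      then have "P (l t) * Q (l t) = 0"
        using P(2)[OF False] Q(2)[OF False] by auto
      then show ?thesis using pqd by simp
    qed
    then have "p * q * d = 0"
      using poly_all_0_iff_0 by blast
    moreover have "poly p 0 \<noteq> 0" "poly q 1 \<noteq> 0" "poly d 0 \<noteq> 0"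
      using x P(2)[of x1] Q(2)[of x2] pqd(1)[of 0] pqd(2)[of 1] pqd(3)[of 0] l by auto
    ultimately show False
      by auto
  qed
qed (use ne in blast)

section \<open>Dimension bounds\<close>

text \<open>The exponents form a list parallel to the functions; a surplus function or exponent
  contributes the factor 1.\<close>

fun mnl :: "('x \<Rightarrow> complex) list \<Rightarrow> nat list \<Rightarrow> 'x \<Rightarrow> complex" where
  "mnl (f # fs) (a # as) x = f x ^ a * mnl fs as x"
| "mnl _ _ x = 1"

definition exps :: "nat \<Rightarrow> nat \<Rightarrow> nat list set" where
  "exps k t = {l. set l \<subseteq> {..<t} \<and> length l = k}"

text \<open>Algebraic independence of the restrictions to \<open>Z\<close>. Relations are cut off at
  exponents below \<open>t\<close> so that the monomials involved can be counted.\<close>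

definition monindep :: "'x set \<Rightarrow> ('x \<Rightarrow> complex) list \<Rightarrow> bool" where
  "monindep Z fs \<longleftrightarrow> (\<forall>t c. (\<forall>z\<in>Z. (\<Sum>l\<in>exps (length fs) t. c l * mnl fs l z) = 0) \<longrightarrow>
      (\<forall>l\<in>exps (length fs) t. c l = 0))"

lemma finite_exps: "finite (exps k t)" and card_exps: "card (exps k t) = t ^ k"
  using finite_lists_length_eq[of "{..<t}" k] card_lists_length_eq[of "{..<t}" k]
  by (auto simp: exps_def)

lemma sum_exps_Suc:
  "(\<Sum>l\<in>exps (Suc k) t. h l) = (\<Sum>j<t. \<Sum>l\<in>exps k t. h (j # l))" for h :: "nat list \<Rightarrow> complex"
proof -
  have "(\<Sum>j<t. \<Sum>l\<in>exps k t. h (j # l)) = (\<Sum>(j, l)\<in>{..<t} \<times> exps k t. h (j # l))"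
    by (simp add: sum.cartesian_product)
  also have "\<dots> = (\<Sum>l\<in>exps (Suc k) t. h l)"
    by (rule sum.reindex_bij_witness[of _ "\<lambda>l. (hd l, tl l)" "\<lambda>(j, l). j # l"])
       (auto simp: exps_def length_Suc_conv)
  finally show ?thesis by simp
qed

lemma mon_polyfun: "set fs \<subseteq> polyfun n \<Longrightarrow> mnl fs l \<in> polyfun n"
proof (induction fs arbitrary: l)
  case Nil
  have "mnl [] l = (\<lambda>_. 1 :: complex)"
    by (auto simp: fun_eq_iff)
  then show ?case by (simp add: polyfun.pconst)
next
  case IH: (Cons f fs)
  show ?case
  proof (cases l)
    case Nil
    have "mnl (f # fs) [] = (\<lambda>_. 1 :: complex)"
      by (auto simp: fun_eq_iff)
    with Nil show ?thesis by (simp add: polyfun.pconst)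
  next
    case (Cons a as)
    have "mnl (f # fs) l = (\<lambda>x. f x ^ a * mnl fs as x)"
      using Cons by auto
    also have "\<dots> \<in> polyfun n"
      using IH by (intro funalg_mult funalg_power funalg_polyfun) auto
    finally show ?thesis .
  qed
qed

text \<open>A relation among the monomials in g and fs on Z can be divided by g, which does not vanish
  on the irreducible Z; restricting to the zeros Z' of g leaves a relation among the monomials in fs.\<close>
lemma monindep_Cons:
  assumes irr: "irreducible_z n Z" and Z: "Z \<subseteq> space n" and Z': "Z' \<subseteq> Z"
    and g: "g \<in> polyfun n" "\<forall>z\<in>Z'. g z = 0" "\<exists>z\<in>Z. g z \<noteq> 0"
    and fs: "set fs \<subseteq> polyfun n" "monindep Z' fs"
  shows "monindep Z (g # fs)"
  unfolding monindep_def
proof (intro allI impI)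
  fix t c assume "\<forall>z\<in>Z. (\<Sum>l\<in>exps (length (g # fs)) t. c l * mnl (g # fs) l z) = 0"
  then have rel: "(\<Sum>j<t. g z ^ j * (\<Sum>l\<in>exps (length fs) t. c (j # l) * mnl fs l z)) = 0" if "z \<in> Z" for z
    using that by (auto simp: sum_exps_Suc sum_distrib_left algebra_simps)
  define R where "R j z = (\<Sum>l\<in>exps (length fs) t. c (j # l) * mnl fs l z)" for j z
  have Rp: "R j \<in> polyfun n" for j
    unfolding R_def
    by (intro funalg_sum funalg_mult funalg_const funalg_polyfun mon_polyfun fs)
  have c0: "j < t \<longrightarrow> (\<forall>l\<in>exps (length fs) t. c (j # l) = 0)" for j
  proof (induction j rule: less_induct)
    case (less j)
    show ?case
    proof
      assume j: "j < t"
      \<comment> \<open>\<open>S\<close> is the relation divided by g^j: by the induction hypothesis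
        the coefficients of all lower powers of \<open>g\<close> vanish.\<close>
      define S where "S z = (\<Sum>i\<in>{j..<t}. g z ^ (i - j) * R i z)" for z
      have "g z ^ j * S z = 0" if "z \<in> Z" for z
      proof -
        have "R i z = 0" if "i < j" for i
          using less[OF that] that j by (auto simp: R_def)
        then have "(\<Sum>i<t. g z ^ i * R i z) = (\<Sum>i\<in>{j..<t}. g z ^ i * R i z)"
          by (intro sum.mono_neutral_right) auto
        also have "\<dots> = g z ^ j * S z"
          by (auto simp: S_def sum_distrib_left power_add[symmetric] mult.assoc[symmetric] intro!: sum.cong)
        finally show ?thesis
          using rel[OF that] by (simp add: R_def)
      qed
      moreover have "(\<lambda>z. g z ^ j) \<in> polyfun n" "S \<in> polyfun n"
        unfolding S_def
        by (intro funalg_sum funalg_mult funalg_power funalg_polyfun Rp g(1))+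
      ultimately have "(\<forall>z\<in>Z. g z ^ j = 0) \<or> (\<forall>z\<in>Z. S z = 0)"
        using irreducible_z_mult[OF irr Z] by blast
      then have S0: "\<forall>z\<in>Z. S z = 0"
        using g(3) by auto
      have "R j z = 0" if "z \<in> Z'" for z
      proof -
        \<comment> \<open>On \<open>Z'\<close> every power of \<open>g\<close> except the zeroth
          vanishes.\<close>
        have "S z = (\<Sum>i\<in>{j..<t}. if i = j then R j z else 0)"
          unfolding S_def using g(2) that by (intro sum.cong) auto
        also have "\<dots> = R j z"
          using j by simp
        finally show ?thesis
          using S0 that Z' by auto
      qed
      then show "\<forall>l\<in>exps (length fs) t. c (j # l) = 0"
        using fs(2)[unfolded monindep_def, THEN spec[of _ t], THEN spec[of _ "\<lambda>l. c (j # l)"]]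
        by (simp add: R_def)
    qed
  qed
  show "\<forall>l\<in>exps (length (g # fs)) t. c l = 0"
    using c0 by (auto simp: exps_def length_Suc_conv)
qed

text \<open>Each step of the chain contributes the polynomial that separates its two members, placed
  in front of the list obtained for the smaller one. This is the bound of chain length by
  transcendence degree.\<close>

lemma chain_monindep:
  assumes "\<And>i. i \<le> k \<Longrightarrow> irreducible_z n (Z i) \<and> Z i \<subseteq> space n"
    and "\<And>i. i < k \<Longrightarrow> Z i \<subseteq> Z (Suc i) \<and> (\<exists>f\<in>polyfun n. (\<forall>z\<in>Z i. f z = 0) \<and> (\<exists>z\<in>Z (Suc i). f z \<noteq> 0))"
  shows "\<exists>fs. length fs = k \<and> set fs \<subseteq> polyfun n \<and> monindep (Z k) fs"
  using assms
proof (induction k)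
  case 0
  have "Z 0 \<noteq> {}"
    using 0 irreducible_z_def by blast
  moreover have "exps 0 t = {[]}" for t
    by (auto simp: exps_def)
  ultimately have "monindep (Z 0) []"
    by (auto simp: monindep_def)
  then show ?case
    by (intro exI[of _ "[]"]) auto
next
  case (Suc k)
  obtain fs where fs: "length fs = k" "set fs \<subseteq> polyfun n" "monindep (Z k) fs"
    using Suc.IH[OF Suc.prems(1) Suc.prems(2)] by auto
  obtain f where f: "f \<in> polyfun n" "\<forall>z\<in>Z k. f z = 0" "\<exists>z\<in>Z (Suc k). f z \<noteq> 0"
    using Suc.prems(2)[of k] by auto
  have "monindep (Z (Suc k)) (f # fs)"
    using monindep_Cons[of n "Z (Suc k)" "Z k" f fs] Suc.prems(1)[of "Suc k"] Suc.prems(2)[of k] fs f by auto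
  then show ?case
    using fs f by (intro exI[of _ "f # fs"]) auto
qed

section \<open>Counting monomials in the parameters\<close>

interpretation fvs: vector_space "\<lambda>(c::complex) (f :: 'x \<Rightarrow> complex) x. c * f x"
  by unfold_locales (auto simp: algebra_simps plus_fun_def fun_eq_iff)

text \<open>Bounding each exponent separately, rather than the total degree, makes the count at most
  (s + 1)^d and the bounds additive under products.\<close>

definition mnls :: "'i set \<Rightarrow> nat \<Rightarrow> (('i \<Rightarrow> complex) \<Rightarrow> complex) set" where
  "mnls I s = (\<lambda>e x. \<Prod>i\<in>I. x i ^ e i) ` (PiE I (\<lambda>_. {..s}))"

lemma finite_mnls: "finite I \<Longrightarrow> finite (mnls I s)"
  by (auto simp: mnls_def intro: finite_PiE)

lemma card_mnls:
  assumes "finite I"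
  shows "card (mnls I s) \<le> Suc s ^ card I"
proof -
  have "card (mnls I s) \<le> card (PiE I (\<lambda>_. {..s}))"
    unfolding mnls_def by (intro card_image_le finite_PiE assms) auto
  then show ?thesis
    using assms by (simp add: card_PiE)
qed

lemma mnls_mono: "s \<le> s' \<Longrightarrow> mnls I s \<subseteq> mnls I s'"
  unfolding mnls_def by (intro image_mono PiE_mono) auto

lemma mnlsI:
  assumes "\<And>i. i \<in> I \<Longrightarrow> e i \<le> s" "\<And>x. f x = (\<Prod>i\<in>I. x i ^ e i)"
  shows "f \<in> mnls I s"
proof -
  have "f = (\<lambda>x. \<Prod>i\<in>I. x i ^ (restrict e I) i)"
    by (rule ext) (simp add: assms(2) cong: prod.cong)
  then show ?thesis
    unfolding mnls_def using assms(1) by (intro image_eqI[of _ _ "restrict e I"]) auto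
qed

lemma mnls_mult:
  assumes "f \<in> mnls I s" "g \<in> mnls I s'"
  shows "(\<lambda>x. f x * g x) \<in> mnls I (s + s')"
proof -
  obtain d e where d: "d \<in> PiE I (\<lambda>_. {..s})" "f = (\<lambda>x. \<Prod>i\<in>I. x i ^ d i)"
    and e: "e \<in> PiE I (\<lambda>_. {..s'})" "g = (\<lambda>x. \<Prod>i\<in>I. x i ^ e i)"
    using assms unfolding mnls_def by blast
  show ?thesis
  proof (rule mnlsI[where e = "\<lambda>i. d i + e i"])
    show "d i + e i \<le> s + s'" if "i \<in> I" for i
      using d e that by (intro add_mono) (auto simp: PiE_iff)
  qed (simp add: d e power_add prod.distrib)
qed

lemma span_mnls_mult:
  assumes "f \<in> fvs.span (mnls I s)" "g \<in> fvs.span (mnls I s')"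
  shows "(\<lambda>x. f x * g x) \<in> fvs.span (mnls I (s + s'))"
proof -
  have one: "(\<lambda>x. f x * g x) \<in> fvs.span (mnls I (s + s'))"
    if f: "f \<in> mnls I s" and "g \<in> fvs.span (mnls I s')" for f g
    using that(2)
  proof (induction rule: fvs.span_induct_alt)
    case base
    show ?case using fvs.span_zero by (simp add: zero_fun_def)
  next
    case (step c h g)
    have "(\<lambda>x. f x * ((\<lambda>x. c * h x) + g) x) = (\<lambda>x. c * (f x * h x)) + (\<lambda>x. f x * g x)"
      by (auto simp: fun_eq_iff algebra_simps)
    then show ?case
      using fvs.span_add[OF fvs.span_scale[OF fvs.span_base[OF mnls_mult[OF f step(1)]], of c] step(2)] by simp
  qed
  show ?thesis
    using assms(1)
  proof (induction rule: fvs.span_induct_alt)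
    case base
    show ?case using fvs.span_zero by (simp add: zero_fun_def)
  next
    case (step c h f)
    have "(\<lambda>x. ((\<lambda>x. c * h x) + f) x * g x) = (\<lambda>x. c * (h x * g x)) + (\<lambda>x. f x * g x)"
      by (auto simp: fun_eq_iff algebra_simps)
    then show ?case
      using fvs.span_add[OF fvs.span_scale[OF one[OF step(1) assms(2)], of c] step(2)] by simp
  qed
qed

lemma span_mnls_mono: "s \<le> s' \<Longrightarrow> f \<in> fvs.span (mnls I s) \<Longrightarrow> f \<in> fvs.span (mnls I s')"
  using fvs.span_mono[OF mnls_mono] by blast

lemma span_mnls_const: "(\<lambda>_. a) \<in> fvs.span (mnls I s)"
proof -
  have "(\<lambda>_. 1) \<in> mnls I s"
    by (rule mnlsI[where e = "\<lambda>_. 0"]) auto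
  from fvs.span_scale[OF fvs.span_base[OF this], of a] show ?thesis
    by simp
qed

lemma span_mnls_power:
  assumes "f \<in> fvs.span (mnls I s)"
  shows "(\<lambda>x. f x ^ m) \<in> fvs.span (mnls I (s * m))"
proof (induction m)
  case 0
  show ?case using span_mnls_const[of 1] by simp
next
  case (Suc m)
  show ?case using span_mnls_mult[OF assms Suc] by simp
qed

lemma Pol_span_mnls:
  assumes "finite I" "F \<in> Pol I"
  shows "\<exists>s. F \<in> fvs.span (mnls I s)"
  using assms(2)
proof induction
  case (Pol_const a)
  show ?case using span_mnls_const by blast
next
  case (Pol_coord i)
  have "(\<lambda>x. x i) \<in> mnls I 1"
    by (rule mnlsI[where e = "\<lambda>j. if j = i then 1 else 0"])
       (use assms(1) Pol_coord in \<open>auto simp: if_distrib[of "\<lambda>e. _ ^ e"] prod.delta cong: if_cong\<close>)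
  then show ?case using fvs.span_base by blast
next
  case (Pol_add f g)
  then obtain s s' where "f \<in> fvs.span (mnls I s)" "g \<in> fvs.span (mnls I s')"
    by blast
  then have "f \<in> fvs.span (mnls I (s + s'))" "g \<in> fvs.span (mnls I (s + s'))"
    using span_mnls_mono by (metis le_add1, metis le_add2)
  from fvs.span_add[OF this] show ?case
    by (auto simp: plus_fun_def)
next
  case (Pol_mult f g)
  then show ?case using span_mnls_mult by blast
qed

text \<open>Linear dependence of a set does not see repetitions, so a family with F a = F b for
  distinct a and b is settled separately by the relation F a - F b = 0.\<close>

lemma linear_relation:
  fixes F :: "'a \<Rightarrow> 'x \<Rightarrow> complex"
  assumes A: "finite A" and T: "finite T" "F ` A \<subseteq> fvs.span T" "card T < card A"
  shows "\<exists>c. (\<exists>a\<in>A. c a \<noteq> 0) \<and> (\<forall>x. (\<Sum>a\<in>A. c a * F a x) = 0)"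
proof (cases "inj_on F A")
  case False
  then obtain a b where ab: "a \<in> A" "b \<in> A" "a \<noteq> b" "F a = F b"
    by (auto simp: inj_on_def)
  define c where "c = (\<lambda>d. if d = a then 1 else if d = b then -1 else (0::complex))"
  have "(\<Sum>d\<in>A. c d * F d x) = 0" for x
  proof -
    have "(\<Sum>d\<in>A. c d * F d x) = (\<Sum>d\<in>{a, b}. c d * F d x)"
      by (rule sum.mono_neutral_right) (use A ab in \<open>auto simp: c_def\<close>)
    then show ?thesis
      using ab by (simp add: c_def)
  qed
  then show ?thesis
    using ab by (intro exI[of _ c]) (auto simp: c_def)
next
  case True
  have "fvs.dependent (F ` A)"
    using fvs.independent_span_bound[OF T(1) _ T(2)] T(3) card_image[OF True] by auto
  then obtain u where u: "(\<Sum>v\<in>F ` A. (\<lambda>x. u v * v x)) = 0" "\<exists>v\<in>F ` A. u v \<noteq> 0"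
    unfolding fvs.dependent_finite[OF finite_imageI[OF A]] by (elim exE conjE) (rule that)
  have "(\<Sum>v\<in>F ` A. (\<lambda>x. u v * v x)) x = (\<Sum>v\<in>F ` A. u v * v x)" for x
    using finite_imageI[OF A, of F] by (induction rule: finite_induct) auto
  then have "(\<Sum>v\<in>F ` A. u v * v x) = 0" for x
    unfolding u(1) by simp
  then have "(\<Sum>a\<in>A. u (F a) * F a x) = 0" for x
    by (simp add: sum.reindex[OF True])
  then show ?thesis
    using u(2) by (intro exI[of _ "u \<circ> F"]) auto
qed

text \<open>Degree and pole order of the pulled back monomials grow at most linearly in
  \<open>t\<close>, with constants \<open>C\<close> and \<open>M\<close> that are the same for all
  monomials. The comparison of t^k with t^d rests on this linear growth.\<close>

lemma mon_pullback:
  assumes I: "finite I" and \<Delta>: "\<Delta> \<in> Pol I" and \<Theta>: "regmap n (reg (Pol I) \<Delta>) \<Theta>"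
    and fs: "set fs \<subseteq> polyfun n"
  shows "\<exists>C M. \<forall>t. \<forall>l\<in>exps (length fs) t. \<exists>Q\<in>fvs.span (mnls I (C * t)).
     \<forall>x. \<Delta> x \<noteq> 0 \<longrightarrow> mnl fs l (\<Theta> x) * \<Delta> x ^ (M * t) = Q x"
  using fs
proof (induction fs)
  case Nil
  show ?case
    by (rule exI[of _ 0], rule exI[of _ 0], intro allI ballI, rule bexI[OF _ span_mnls_const[of 1]]) simp
next
  case (Cons f fs)
  from Cons.IH Cons.prems have "\<exists>C M. \<forall>t. \<forall>l\<in>exps (length fs) t. \<exists>Q\<in>fvs.span (mnls I (C * t)).
     \<forall>x. \<Delta> x \<noteq> 0 \<longrightarrow> mnl fs l (\<Theta> x) * \<Delta> x ^ (M * t) = Q x"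
    by simp
  then obtain C M where CM: "\<And>t l. l \<in> exps (length fs) t \<Longrightarrow> \<exists>Q\<in>fvs.span (mnls I (C * t)).
     \<forall>x. \<Delta> x \<noteq> 0 \<longrightarrow> mnl fs l (\<Theta> x) * \<Delta> x ^ (M * t) = Q x"
    by blast
  obtain m P where P: "P \<in> Pol I" "\<And>x. \<Delta> x \<noteq> 0 \<Longrightarrow> f (\<Theta> x) * \<Delta> x ^ m = P x"
    using polyfun_comp[OF funalg_reg[OF funalg_Pol \<Delta>] \<Theta>, of f] Cons.prems unfolding reg_def by auto
  obtain s s0 where s: "P \<in> fvs.span (mnls I s)" "\<Delta> \<in> fvs.span (mnls I s0)"
    using Pol_span_mnls[OF I P(1)] Pol_span_mnls[OF I \<Delta>] by auto
  have "\<exists>Q\<in>fvs.span (mnls I ((s + s0 * m + C) * t)).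
     \<forall>x. \<Delta> x \<noteq> 0 \<longrightarrow> mnl (f # fs) l (\<Theta> x) * \<Delta> x ^ ((m + M) * t) = Q x"
    if l0: "l \<in> exps (length (f # fs)) t" for t l
  proof -
    obtain a l' where l: "l = a # l'" "a < t" "l' \<in> exps (length fs) t"
      using l0 by (cases l) (auto simp: exps_def)
    obtain Q where Q: "Q \<in> fvs.span (mnls I (C * t))"
      "\<And>x. \<Delta> x \<noteq> 0 \<Longrightarrow> mnl fs l' (\<Theta> x) * \<Delta> x ^ (M * t) = Q x"
      using CM[OF l(3)] by blast
    \<comment> \<open>The a-th power of \<open>f\<close> has pole order at most m a; the extra
      factor \<Delta>^(m (t - a)) brings all monomials to the common denominator \<Delta>^((m + M)
      t).\<close>
    define W where "W x = P x ^ a * \<Delta> x ^ (m * (t - a)) * Q x" for x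
    have "W \<in> fvs.span (mnls I (s * a + s0 * (m * (t - a)) + C * t))"
      unfolding W_def by (intro span_mnls_mult span_mnls_power s Q)
    moreover have "s * a + s0 * (m * (t - a)) + C * t \<le> (s + s0 * m + C) * t"
    proof -
      have "s * a \<le> s * t" "s0 * (m * (t - a)) \<le> s0 * (m * t)"
        using l(2) by (auto intro!: mult_le_mono)
      then show ?thesis
        unfolding add_mult_distrib by (simp only: mult.assoc add_le_mono le_refl)
    qed
    ultimately have "W \<in> fvs.span (mnls I ((s + s0 * m + C) * t))"
      using span_mnls_mono by blast
    moreover have "mnl (f # fs) l (\<Theta> x) * \<Delta> x ^ ((m + M) * t) = W x" if x: "\<Delta> x \<noteq> 0" for x
    proof -
      have "m * t = m * a + m * (t - a)"
        using l(2) by (simp add: algebra_simps)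
      then have "(m + M) * t = m * a + m * (t - a) + M * t"
        by (simp add: algebra_simps)
      then have "\<Delta> x ^ ((m + M) * t) = (\<Delta> x ^ m) ^ a * \<Delta> x ^ (m * (t - a)) * \<Delta> x ^ (M * t)"
        by (simp only: power_add power_mult)
      then show ?thesis
        unfolding W_def P(2)[OF x, symmetric] Q(2)[OF x, symmetric] l
        by (simp only: mnl.simps power_mult_distrib mult_ac)
    qed
    ultimately show ?thesis
      by blast
  qed
  then show ?case
    by (intro exI[of _ "s + s0 * m + C"] exI[of _ "m + M"]) simp
qed

text \<open>There are t^k monomials of degree below t in each of k functions, but their pullbacks lie in a
  space of dimension O(t^d), where d is the number of parameters.\<close>
lemma pullback_relation:
  assumes I: "finite I" and \<Delta>: "\<Delta> \<in> Pol I" and \<Theta>: "regmap n (reg (Pol I) \<Delta>) \<Theta>"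
    and fs: "set fs \<subseteq> polyfun n" "card I < length fs"
  shows "\<exists>t c. (\<exists>l\<in>exps (length fs) t. c l \<noteq> 0) \<and>
     (\<forall>x. \<Delta> x \<noteq> 0 \<longrightarrow> (\<Sum>l\<in>exps (length fs) t. c l * mnl fs l (\<Theta> x)) = 0)"
proof -
  let ?k = "length fs" and ?d = "card I"
  obtain C M where CM: "\<And>t l. l \<in> exps ?k t \<Longrightarrow> \<exists>Q\<in>fvs.span (mnls I (C * t)).
     \<forall>x. \<Delta> x \<noteq> 0 \<longrightarrow> mnl fs l (\<Theta> x) * \<Delta> x ^ (M * t) = Q x"
    using mon_pullback[OF I \<Delta> \<Theta> fs(1)] by blast
  \<comment> \<open>The cut-off exceeds (C + 1)^d, so that (C + 1)^d t^d < t^(d + 1) <= t^k.\<close>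
  define t where "t = Suc ((C + 1) ^ ?d)"
  have "\<forall>l. \<exists>Q. l \<in> exps ?k t \<longrightarrow> Q \<in> fvs.span (mnls I (C * t)) \<and>
     (\<forall>x. \<Delta> x \<noteq> 0 \<longrightarrow> mnl fs l (\<Theta> x) * \<Delta> x ^ (M * t) = Q x)"
    using CM by blast
  then obtain Q where Q: "\<And>l. l \<in> exps ?k t \<Longrightarrow> Q l \<in> fvs.span (mnls I (C * t))"
    "\<And>l x. l \<in> exps ?k t \<Longrightarrow> \<Delta> x \<noteq> 0 \<Longrightarrow> mnl fs l (\<Theta> x) * \<Delta> x ^ (M * t) = Q l x"
    by metis
  have "card (mnls I (C * t)) \<le> Suc (C * t) ^ ?d"
    by (rule card_mnls[OF I])
  also have "\<dots> \<le> ((C + 1) * t) ^ ?d"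
    by (intro power_mono) (auto simp: t_def)
  also have "\<dots> = (C + 1) ^ ?d * t ^ ?d"
    by (rule power_mult_distrib)
  also have "\<dots> < t * t ^ ?d"
    by (intro mult_strict_right_mono) (auto simp: t_def)
  also have "\<dots> = t ^ Suc ?d"
    by simp
  also have "\<dots> \<le> t ^ ?k"
    using fs(2) by (intro power_increasing) (auto simp: t_def)
  finally have "card (mnls I (C * t)) < card (exps ?k t)"
    by (simp add: card_exps)
  then obtain c where c: "\<exists>l\<in>exps ?k t. c l \<noteq> 0" "\<And>x. (\<Sum>l\<in>exps ?k t. c l * Q l x) = 0"
    using linear_relation[OF finite_exps finite_mnls[OF I], of Q ?k t "C * t"] Q(1) by blast
  have "(\<Sum>l\<in>exps ?k t. c l * mnl fs l (\<Theta> x)) = 0" if x: "\<Delta> x \<noteq> 0" for x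
  proof -
    have "(\<Sum>l\<in>exps ?k t. c l * mnl fs l (\<Theta> x)) * \<Delta> x ^ (M * t) = (\<Sum>l\<in>exps ?k t. c l * Q l x)"
      by (simp add: sum_distrib_right Q(2)[OF _ x, symmetric] mult.assoc cong: sum.cong)
    then show ?thesis
      using c(2) x by simp
  qed
  then show ?thesis
    using c(1) by blast
qed

text \<open>A separating polynomial at each step replaces relative closedness, which depends on the
  surrounding set; chains in an orbit and chains in its closure thus become comparable.\<close>

definition strict_chain :: "nat \<Rightarrow> (nat \<Rightarrow> pstruct set) \<Rightarrow> nat \<Rightarrow> bool" where
  "strict_chain n Z k \<longleftrightarrow> (\<forall>i\<le>k. irreducible_z n (Z i) \<and> Z i \<subseteq> space n) \<and>
    (\<forall>i<k. Z i \<subseteq> Z (Suc i) \<and> (\<exists>f\<in>polyfun n. (\<forall>z\<in>Z i. f z = 0) \<and> (\<exists>z\<in>Z (Suc i). f z \<noteq> 0)))"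

lemma has_chain_strict_chain:
  assumes X: "X \<subseteq> space n" and "has_chain n X k"
  obtains Z where "strict_chain n Z k" "Z k \<subseteq> X"
proof -
  obtain Z where Z: "\<And>i. i \<le> k \<Longrightarrow> rel_zclosed n X (Z i) \<and> irreducible_z n (Z i)"
    "\<And>i. i < k \<Longrightarrow> Z i \<subset> Z (Suc i)"
    using assms(2) unfolding has_chain_def by auto
  have ZX: "Z i \<subseteq> X" if "i \<le> k" for i
    using Z(1)[OF that] unfolding rel_zclosed_def by auto
  have "\<exists>f\<in>polyfun n. (\<forall>z\<in>Z i. f z = 0) \<and> (\<exists>z\<in>Z (Suc i). f z \<noteq> 0)" if i: "i < k" for i
  proof -
    obtain C where C: "zclosed n C" "Z i = X \<inter> C"
      using Z(1)[of i] i unfolding rel_zclosed_def by auto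
    obtain z where z: "z \<in> Z (Suc i)" "z \<notin> Z i"
      using Z(2)[OF i] by auto
    then have "z \<in> X"
      using ZX[of "Suc i"] i by auto
    then obtain f where "f \<in> polyfun n" "\<forall>x\<in>C. f x = 0" "f z \<noteq> 0"
      using zclosed_separate[OF C(1), of z] z C(2) X by auto
    then show ?thesis
      using z(1) C(2) by (intro bexI[of _ f]) auto
  qed
  then have "strict_chain n Z k"
    unfolding strict_chain_def using Z ZX X by (meson order_trans psubset_imp_subset)
  then show ?thesis
    using ZX[of k] that by auto
qed

text \<open>The upper bound concerns chains in the closure, not only in X, and the last clause says that X contains
  a nonempty open subset of its closure.\<close>
definition tame :: "nat \<Rightarrow> pstruct set \<Rightarrow> nat \<Rightarrow> bool" where
  "tame n X d \<longleftrightarrow> has_chain n X d \<and>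
    (\<forall>Z k. strict_chain n Z k \<longrightarrow> Z k \<subseteq> zclosure n X \<longrightarrow> k \<le> d) \<and>
    (\<exists>f\<in>polyfun n. (\<exists>y\<in>X. f y \<noteq> 0) \<and> (\<forall>y\<in>zclosure n X. f y \<noteq> 0 \<longrightarrow> y \<in> X))"

lemma tame_zdim:
  assumes "X \<subseteq> space n" "tame n X d"
  shows "zdim n X d"
proof -
  have "\<not> has_chain n X (Suc d)"
  proof
    assume "has_chain n X (Suc d)"
    then obtain Z where "strict_chain n Z (Suc d)" "Z (Suc d) \<subseteq> X"
      using has_chain_strict_chain[OF assms(1)] by auto
    then have "Suc d \<le> d"
      using assms(2) zclosure_superset[of X n] unfolding tame_def by (meson subset_trans)
    then show False by simp
  qed
  then show ?thesis
    using assms(2) unfolding zdim_def tame_def by simp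
qed

text \<open>X is birational to the affine space with coordinates I, by mutually inverse regular maps
  between the loci where D and Delta do not vanish.\<close>
locale chart =
  fixes n :: nat and X :: "pstruct set" and D :: "pstruct \<Rightarrow> complex" and I :: "'i set"
    and \<Delta> :: "('i \<Rightarrow> complex) \<Rightarrow> complex" and \<Theta> :: "('i \<Rightarrow> complex) \<Rightarrow> pstruct"
    and \<psi> :: "pstruct \<Rightarrow> 'i \<Rightarrow> complex"
  assumes X_space: "X \<subseteq> space n" and X_irr: "irreducible_z n X" and D: "D \<in> polyfun n"
    and I: "finite I" and \<Delta>: "\<Delta> \<in> Pol I" and \<Theta>: "regmap n (reg (Pol I) \<Delta>) \<Theta>"
    and \<psi>: "\<And>i. i \<in> I \<Longrightarrow> (\<lambda>y. \<psi> y i) \<in> reg (polyfun n) D"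
    and \<psi>_out: "\<And>y i. i \<notin> I \<Longrightarrow> \<psi> y i = 0"
    and \<Theta>_X: "\<And>x. (\<And>i. i \<notin> I \<Longrightarrow> x i = 0) \<Longrightarrow> \<Delta> x \<noteq> 0 \<Longrightarrow> \<Theta> x \<in> X \<and> D (\<Theta> x) \<noteq> 0 \<and> \<psi> (\<Theta> x) = x"
    and X_\<Theta>: "\<And>y. y \<in> X \<Longrightarrow> D y \<noteq> 0 \<Longrightarrow> \<Theta> (\<psi> y) = y \<and> \<Delta> (\<psi> y) \<noteq> 0"
    and base: "\<exists>x. (\<forall>i. i \<notin> I \<longrightarrow> x i = 0) \<and> \<Delta> x \<noteq> 0"
begin

text \<open>The product of \<open>f\<close> and \<open>D\<close> vanishes on the irreducible
  \<open>X\<close> while \<open>D\<close> does not, so the part of \<open>X\<close> with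
  \<open>D\<close> nonzero is dense in the closure.\<close>

lemma vanish_on_open:
  assumes f: "f \<in> polyfun n" "\<And>y. y \<in> X \<Longrightarrow> D y \<noteq> 0 \<Longrightarrow> f y = 0" and y: "y \<in> zclosure n X"
  shows "f y = 0"
proof -
  obtain x where "\<And>i. i \<notin> I \<Longrightarrow> x i = 0" "\<Delta> x \<noteq> 0"
    using base by auto
  from \<Theta>_X[OF this] have "\<not> (\<forall>z\<in>X. D z = 0)"
    by auto
  moreover have "\<forall>z\<in>X. f z * D z = 0"
    using f(2) by auto
  ultimately have "\<forall>z\<in>X. f z = 0"
    using irreducible_z_mult[OF X_irr X_space f(1) D] by auto
  then show ?thesis
    using y in_zclosure_iff[OF X_space] f(1) by auto
qed

text \<open>The same density for rational functions: after clearing a power of \<open>D\<close>, the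
  value at a point where \<open>D\<close> is nonzero is still controlled. This is how a coordinate
  obstructs a degeneration.\<close>

lemma reg_vanish_on_open:
  assumes F: "F \<in> reg (polyfun n) D" "\<And>y. y \<in> X \<Longrightarrow> D y \<noteq> 0 \<Longrightarrow> F y = 0"
    and y: "y \<in> zclosure n X" "D y \<noteq> 0"
  shows "F y = 0"
proof -
  obtain m P where P: "P \<in> polyfun n" "\<And>x. D x \<noteq> 0 \<Longrightarrow> F x * D x ^ m = P x"
    using F(1) unfolding reg_def by auto
  have "P y = 0"
    by (rule vanish_on_open[OF P(1) _ y(1)]) (simp add: P(2)[symmetric] F(2))
  then show ?thesis
    using P(2)[OF y(2)] y(2) by simp
qed

lemma chain_bound:
  assumes Z: "strict_chain n Z k" "Z k \<subseteq> zclosure n X"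
  shows "k \<le> card I"
proof (rule ccontr)
  assume k: "\<not> k \<le> card I"
  obtain fs where fs: "length fs = k" "set fs \<subseteq> polyfun n" "monindep (Z k) fs"
    using chain_monindep[of k n Z] Z(1) unfolding strict_chain_def by auto
  obtain t c where c: "\<exists>l\<in>exps k t. c l \<noteq> 0"
    "\<And>x. \<Delta> x \<noteq> 0 \<Longrightarrow> (\<Sum>l\<in>exps k t. c l * mnl fs l (\<Theta> x)) = 0"
    using pullback_relation[OF I \<Delta> \<Theta> fs(2)] fs(1) k by auto
  have pf: "(\<lambda>y. \<Sum>l\<in>exps k t. c l * mnl fs l y) \<in> polyfun n"
    by (intro funalg_sum funalg_mult funalg_const funalg_polyfun mon_polyfun fs)
  \<comment> \<open>\<open>\<psi>\<close> carries the relation on the parameters to the open part of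
    \<open>X\<close>; density then extends it to the closure.\<close>
  have "(\<Sum>l\<in>exps k t. c l * mnl fs l y) = 0" if "y \<in> X" "D y \<noteq> 0" for y
    using c(2)[of "\<psi> y"] X_\<Theta>[OF that] by simp
  then have "(\<Sum>l\<in>exps k t. c l * mnl fs l y) = 0" if "y \<in> Z k" for y
    using vanish_on_open[OF pf, of y] that Z(2) by auto
  then have "\<forall>l\<in>exps k t. c l = 0"
    using fs(3)[unfolded monindep_def, THEN spec[of _ t], THEN spec[of _ c]] fs(1) by simp
  then show False
    using c(1) by simp
qed

lemma chain_exists: "has_chain n X (card I)"
proof -
  obtain x0 where x0: "\<And>i. i \<notin> I \<Longrightarrow> x0 i = 0" "\<Delta> x0 \<noteq> 0"
    using base by auto
  obtain e where e: "bij_betw e {0..<card I} I"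
    using ex_bij_betw_nat_finite[OF I] by auto
  \<comment> \<open>Affine subspaces through \<open>x0\<close> with the first \<open>k\<close>
    coordinates free. The origin would not do as base point, since \<open>\<Delta>\<close> may
    vanish there.\<close>
  define L where "L k = {x. (\<forall>i. i \<notin> I \<longrightarrow> x i = 0) \<and> (\<forall>m. k \<le> m \<longrightarrow> m < card I \<longrightarrow> x (e m) = x0 (e m))}" for k
  define U where "U k = {x \<in> L k. \<Delta> x \<noteq> 0}" for k
  define Y where "Y k = \<Theta> ` U k" for k
  \<comment> \<open>The images \<open>Y k\<close> need not be relatively closed in \<open>X\<close>;
    their closures within \<open>X\<close> are.\<close>
  define Z where "Z k = X \<inter> zclosure n (Y k)" for k
  have line: "(\<lambda>i. x1 i + t * (x2 i - x1 i)) \<in> L k" if "x1 \<in> L k" "x2 \<in> L k" for x1 x2 t k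
    using that by (auto simp: L_def)
  have x0U: "x0 \<in> U k" for k
    using x0 by (auto simp: U_def L_def)
  have YX: "Y k \<subseteq> X" for k
    unfolding Y_def U_def L_def using \<Theta>_X by auto
  have Ysp: "Y k \<subseteq> space n" for k
    using YX X_space by auto
  have irrY: "irreducible_z n (Y k)" for k
    unfolding Y_def U_def
    by (rule irreducible_z_image[OF line \<Delta> \<Theta>]) (use x0U[of k] Ysp[of k] in \<open>auto simp: U_def Y_def\<close>)
  have "irreducible_z n (Z k)" for k
    unfolding Z_def using YX[of k] zclosure_superset[of "Y k" n]
    by (intro irreducible_z_between[OF irrY[of k] _ _ Ysp]) blast+
  moreover have "rel_zclosed n X (Z k)" for k
    unfolding rel_zclosed_def Z_def using zclosure_zclosed[OF Ysp] by auto
  moreover have "Z k \<subset> Z (Suc k)" if k: "k < card I" for k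
  proof -
    have "L k \<subseteq> L (Suc k)"
      by (auto simp: L_def)
    then have "Y k \<subseteq> Y (Suc k)"
      by (auto simp: Y_def U_def)
    then have "Y k \<subseteq> zclosure n (Y (Suc k))"
      using zclosure_superset by blast
    then have sub: "Z k \<subseteq> Z (Suc k)"
      unfolding Z_def using zclosure_minimal[OF zclosure_zclosed[OF Ysp]] by blast
    have ek: "e k \<in> I"
      using e k by (auto simp: bij_betw_def)
    obtain m P where P: "P \<in> polyfun n" "\<And>y. D y \<noteq> 0 \<Longrightarrow> (\<psi> y (e k) - x0 (e k)) * D y ^ m = P y"
      using funalg_diff[OF funalg_reg[OF funalg_polyfun D] \<psi>[OF ek] reg_base[OF funalg_const[OF funalg_polyfun]], of "x0 (e k)"]
      unfolding reg_def by auto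
    have "P y = 0" if "y \<in> Y k" for y
    proof -
      obtain x where x: "x \<in> U k" "y = \<Theta> x"
        using \<open>y \<in> Y k\<close> by (auto simp: Y_def)
      then have "D y \<noteq> 0" "\<psi> y = x" "x (e k) = x0 (e k)"
        using \<Theta>_X[of x] k by (auto simp: U_def L_def)
      then show ?thesis
        using P(2)[of y] by simp
    qed
    then have P0: "P y = 0" if "y \<in> Z k" for y
      using that P(1) unfolding Z_def Int_iff in_zclosure_iff[OF Ysp] by simp
    define x1 where "x1 = x0(e k := x0 (e k) + 1)"
    obtain p where p: "\<And>t. \<Delta> (\<lambda>i. x0 i + t * (x1 i - x0 i)) = poly p t"
      using Pol_line[OF \<Delta>, of x0 x1] by auto
    have "poly p 0 \<noteq> 0"
      using x0(2) p[of 0] by simp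
    \<comment> \<open>The factor \<open>[:0, 1:]\<close> excludes t = 0, so the chosen point leaves
      \<open>L k\<close> while \<open>\<Delta>\<close> stays nonzero.\<close>
    then have "p * [:0, 1:] \<noteq> 0"
      by auto
    then obtain t where t: "poly p t \<noteq> 0" "t \<noteq> 0"
      using poly_all_0_iff_0[of "p * [:0, 1:]"] by auto
    define x where "x = (\<lambda>i. x0 i + t * (x1 i - x0 i))"
    have ek': "e m \<noteq> e k" if "Suc k \<le> m" "m < card I" for m
      using e k that inj_onD[of e "{0..<card I}" m k] by (auto simp: bij_betw_def)
    have x: "x \<in> U (Suc k)" "x (e k) \<noteq> x0 (e k)"
      using t p x0(1) ek ek' by (auto simp: x_def x1_def U_def L_def)
    have "\<Theta> x \<in> Y (Suc k)"
      using x(1) by (auto simp: Y_def)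
    then have "\<Theta> x \<in> Z (Suc k)"
      using YX[of "Suc k"] zclosure_superset[of "Y (Suc k)" n] unfolding Z_def by blast
    moreover have "D (\<Theta> x) \<noteq> 0" "\<psi> (\<Theta> x) = x"
      using \<Theta>_X[of x] x(1) by (auto simp: U_def L_def)
    then have "P (\<Theta> x) \<noteq> 0"
      using P(2)[of "\<Theta> x"] x(2) by auto
    ultimately show ?thesis
      using sub P0[of "\<Theta> x"] by auto
  qed
  ultimately show ?thesis
    unfolding has_chain_def by (intro exI[of _ Z]) auto
qed

text \<open>Where \<open>D y\<close> and \<open>\<Delta> (\<psi> y)\<close> are nonzero, the entries
  of \<open>\<Theta> (\<psi> y)\<close> and of \<open>y\<close> are regular functions that agree on
  a dense part of \<open>X\<close>. They therefore agree at points of the closure too, and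
  \<open>\<Theta>\<close> only takes values in \<open>X\<close> there.\<close>

lemma open_in_closure:
  "\<exists>f\<in>polyfun n. (\<exists>y\<in>X. f y \<noteq> 0) \<and> (\<forall>y\<in>zclosure n X. f y \<noteq> 0 \<longrightarrow> y \<in> X)"
proof -
  note fr = funalg_reg[OF funalg_polyfun D]
  have "(\<lambda>y. \<Delta> (\<psi> y)) \<in> reg (polyfun n) D"
    by (rule Pol_comp[OF fr \<Delta> \<psi>])
  then obtain m P where P: "P \<in> polyfun n" "\<And>y. D y \<noteq> 0 \<Longrightarrow> \<Delta> (\<psi> y) * D y ^ m = P y"
    unfolding reg_def by auto
  define f where "f y = D y * P y" for y
  have f: "f \<in> polyfun n"
    unfolding f_def by (intro funalg_mult funalg_polyfun D P)
  obtain x0 where x0: "\<And>i. i \<notin> I \<Longrightarrow> x0 i = 0" "\<Delta> x0 \<noteq> 0"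
    using base by auto
  then have "f (\<Theta> x0) \<noteq> 0" "\<Theta> x0 \<in> X"
    using \<Theta>_X[OF x0] P(2)[of "\<Theta> x0"] by (auto simp: f_def)
  moreover have "y \<in> X" if y: "y \<in> zclosure n X" "f y \<noteq> 0" for y
  proof -
    have Dy: "D y \<noteq> 0" and \<Delta>y: "\<Delta> (\<psi> y) \<noteq> 0"
      using y(2) P(2)[of y] by (auto simp: f_def)
    have eq: "G (\<Theta> (\<psi> y)) = G y" if G: "(\<lambda>x. G (\<Theta> x)) \<in> reg (Pol I) \<Delta>" "G \<in> polyfun n" for G
    proof -
      obtain k Q where Q: "Q \<in> Pol I" "\<And>x. \<Delta> x \<noteq> 0 \<Longrightarrow> G (\<Theta> x) * \<Delta> x ^ k = Q x"
        using G(1) unfolding reg_def by auto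
      have "G y * \<Delta> (\<psi> y) ^ k - Q (\<psi> y) = 0"
      proof (rule reg_vanish_on_open[OF _ _ y(1) Dy])
        show "(\<lambda>y. G y * \<Delta> (\<psi> y) ^ k - Q (\<psi> y)) \<in> reg (polyfun n) D"
          by (intro funalg_diff[OF fr] funalg_mult[OF fr] funalg_power[OF fr] reg_base G(2)
              Pol_comp[OF fr \<Delta> \<psi>] Pol_comp[OF fr Q(1) \<psi>])
        show "G y * \<Delta> (\<psi> y) ^ k - Q (\<psi> y) = 0" if "y \<in> X" "D y \<noteq> 0" for y
          using X_\<Theta>[OF that] Q(2)[of "\<psi> y"] by simp
      qed
      then show ?thesis
        using Q(2)[OF \<Delta>y] \<Delta>y by (metis eq_iff_diff_eq_0 mult_right_cancel power_not_zero)
    qed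
    have \<Theta>y: "\<Theta> (\<psi> y) \<in> X"
      using \<Theta>_X[of "\<psi> y"] \<psi>_out \<Delta>y by simp
    have "\<Theta> (\<psi> y) \<in> space n" "y \<in> space n"
      using \<Theta>y X_space y(1) zclosure_subset_space[OF X_space] by auto
    moreover have "fst (\<Theta> (\<psi> y)) i j k = fst y i j k \<and> snd (\<Theta> (\<psi> y)) i j k = snd y i j k"
      if "i \<in> idx n" "j \<in> idx n" "k \<in> idx n" for i j k
      using eq[of "\<lambda>y. fst y i j k"] eq[of "\<lambda>y. snd y i j k"] \<Theta> that
      by (auto simp: regmap_def intro: polyfun.intros)
    ultimately have "fst (\<Theta> (\<psi> y)) i j k = fst y i j k \<and> snd (\<Theta> (\<psi> y)) i j k = snd y i j k" for i j k
      unfolding space_def by (cases "i \<in> idx n \<and> j \<in> idx n \<and> k \<in> idx n") auto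
    then have "\<Theta> (\<psi> y) = y"
      by (simp add: prod_eq_iff fun_eq_iff)
    with \<Theta>y show ?thesis
      by simp
  qed
  ultimately show ?thesis
    using f by blast
qed

lemma tame: "tame n X (card I)"
  unfolding tame_def using chain_exists chain_bound open_in_closure by blast

end

section \<open>Matrices and the action of the linear group\<close>

definition ev :: "nat \<Rightarrow> nat \<Rightarrow> complex" where
  "ev i = (\<lambda>k. if k = i then 1 else 0)"

definition mv :: "nat \<Rightarrow> (nat \<Rightarrow> nat \<Rightarrow> complex) \<Rightarrow> (nat \<Rightarrow> complex) \<Rightarrow> nat \<Rightarrow> complex" where
  "mv n M x = (\<lambda>k. if k \<in> idx n then \<Sum>j\<in>idx n. M k j * x j else 0)"

definition mm :: "nat \<Rightarrow> (nat \<Rightarrow> nat \<Rightarrow> complex) \<Rightarrow> (nat \<Rightarrow> nat \<Rightarrow> complex) \<Rightarrow> nat \<Rightarrow> nat \<Rightarrow> complex" where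
  "mm n A B = (\<lambda>i k. if i \<in> idx n \<and> k \<in> idx n then \<Sum>j\<in>idx n. A i j * B j k else 0)"

definition idm :: "nat \<Rightarrow> nat \<Rightarrow> nat \<Rightarrow> complex" where
  "idm n = (\<lambda>i j. if i = j \<and> i \<in> idx n then 1 else 0)"

definition matn :: "nat \<Rightarrow> (nat \<Rightarrow> nat \<Rightarrow> complex) \<Rightarrow> bool" where
  "matn n M \<longleftrightarrow> (\<forall>i j. \<not> (i \<in> idx n \<and> j \<in> idx n) \<longrightarrow> M i j = 0)"

definition csupp :: "nat \<Rightarrow> sconst \<Rightarrow> bool" where
  "csupp n c \<longleftrightarrow> (\<forall>i j k. \<not> (i \<in> idx n \<and> j \<in> idx n \<and> k \<in> idx n) \<longrightarrow> c i j k = 0)"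

lemma space_iff: "p \<in> space n \<longleftrightarrow> csupp n (fst p) \<and> csupp n (snd p)"
  by (auto simp: space_def csupp_def)

lemma finite_idx [simp]: "finite (idx n)"
  by (simp add: idx_def)

lemma ev_vec: "i \<in> idx n \<Longrightarrow> ev i \<in> Defs.vec n"
  by (auto simp: Defs.vec_def ev_def)

lemma mv_vec [simp]: "mv n M x \<in> Defs.vec n"
  by (auto simp: Defs.vec_def mv_def)

lemma bil_vec [simp]: "bil n c x y \<in> Defs.vec n"
  by (auto simp: Defs.vec_def bil_def)

lemma vec_add: "x \<in> Defs.vec n \<Longrightarrow> y \<in> Defs.vec n \<Longrightarrow> x + y \<in> Defs.vec n"
  and vec_scale: "x \<in> Defs.vec n \<Longrightarrow> (\<lambda>k. a * x k) \<in> Defs.vec n"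
  by (auto simp: Defs.vec_def)

lemma invpair_iff:
  "invpair n g h \<longleftrightarrow> matn n g \<and> matn n h \<and> mm n g h = idm n \<and> mm n h g = idm n"
  by (auto simp: invpair_def matn_def mm_def idm_def fun_eq_iff)

lemma mv_ev: "matn n M \<Longrightarrow> i \<in> idx n \<Longrightarrow> mv n M (ev i) = (\<lambda>k. M k i)"
  by (auto simp: mv_def ev_def matn_def fun_eq_iff if_distrib[of "\<lambda>t. _ * t"] cong: if_cong)

lemma mv_mm: "mv n (mm n A B) x = mv n A (mv n B x)"
proof
  fix k
  show "mv n (mm n A B) x k = mv n A (mv n B x) k"
  proof (cases "k \<in> idx n")
    case True
    have "mv n (mm n A B) x k = (\<Sum>j\<in>idx n. \<Sum>i\<in>idx n. A k i * B i j * x j)"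
      using True by (simp add: mv_def mm_def sum_distrib_right cong: sum.cong)
    also have "\<dots> = (\<Sum>i\<in>idx n. \<Sum>j\<in>idx n. A k i * B i j * x j)"
      by (rule sum.swap)
    also have "\<dots> = mv n A (mv n B x) k"
      using True by (simp add: mv_def sum_distrib_left mult.assoc cong: sum.cong)
    finally show ?thesis .
  qed (simp add: mv_def)
qed

lemma mv_idm: "x \<in> Defs.vec n \<Longrightarrow> mv n (idm n) x = x"
  by (auto simp: mv_def idm_def Defs.vec_def fun_eq_iff if_distrib[of "\<lambda>t. t * _"] cong: if_cong)

lemma mat_eqI:
  assumes "matn n A" "matn n B" "\<And>j. j \<in> idx n \<Longrightarrow> mv n A (ev j) = mv n B (ev j)"
  shows "A = B"
proof (intro ext)
  fix i j
  show "A i j = B i j"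
    using assms fun_cong[OF assms(3)[of j], of i] mv_ev[of n A j] mv_ev[of n B j]
    by (cases "j \<in> idx n") (auto simp: matn_def fun_eq_iff)
qed

lemma matn_mm [simp]: "matn n (mm n A B)" and matn_idm [simp]: "matn n (idm n)"
  by (auto simp: matn_def mm_def idm_def)

lemma mm_assoc: "mm n (mm n A B) C = mm n A (mm n B C)"
  by (rule mat_eqI[of n]) (auto simp: mv_mm)

lemma mm_idm: "matn n A \<Longrightarrow> mm n A (idm n) = A" "matn n A \<Longrightarrow> mm n (idm n) A = A"
  by (auto intro!: mat_eqI[of n] simp: mv_mm mv_idm ev_vec)

lemma invpair_sym: "invpair n g h \<Longrightarrow> invpair n h g"
  by (auto simp: invpair_iff)

lemma invpair_idm: "invpair n (idm n) (idm n)"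
  by (simp add: invpair_iff mm_idm)

lemma invpair_mm:
  assumes "invpair n g h" "invpair n g' h'"
  shows "invpair n (mm n g g') (mm n h' h)"
proof -
  have "mm n (mm n g g') (mm n h' h) = mm n g (mm n (mm n g' h') h)"
    "mm n (mm n h' h) (mm n g g') = mm n h' (mm n (mm n h g) g')"
    by (simp_all add: mm_assoc)
  with assms show ?thesis
    by (simp add: invpair_iff mm_idm)
qed

lemma invpair_cancel:
  assumes "invpair n g h" "x \<in> Defs.vec n"
  shows "mv n g (mv n h x) = x" "mv n h (mv n g x) = x"
  using assms by (simp_all add: invpair_iff mv_mm[symmetric] mv_idm)

lemma invpair_unique:
  assumes "invpair n g h" "invpair n g h'"
  shows "h = h'"
proof -
  have "mm n h (mm n g h') = h"
    using assms by (simp add: invpair_iff mm_idm)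
  moreover have "mm n (mm n h g) h' = h'"
    using assms by (simp add: invpair_iff mm_idm)
  ultimately show ?thesis
    by (simp add: mm_assoc)
qed

lemma mv_add: "mv n M (x + y) = mv n M x + mv n M y"
  and mv_diff: "mv n M (x - y) = mv n M x - mv n M y"
  and mv_scale: "mv n M (\<lambda>k. a * x k) = (\<lambda>k. a * mv n M x k)"
  and mv_zero: "mv n M 0 = 0"
  by (auto simp: mv_def fun_eq_iff algebra_simps sum.distrib sum_subtractf sum_distrib_left)

lemma bil_add_left: "bil n c (x + x') y = bil n c x y + bil n c x' y"
  and bil_add_right: "bil n c x (y + y') = bil n c x y + bil n c x y'"
  and bil_diff_left: "bil n c (x - x') y = bil n c x y - bil n c x' y"
  and bil_diff_right: "bil n c x (y - y') = bil n c x y - bil n c x y'"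
  and bil_scale_left: "bil n c (\<lambda>k. a * x k) y = (\<lambda>k. a * bil n c x y k)"
  and bil_scale_right: "bil n c x (\<lambda>k. a * y k) = (\<lambda>k. a * bil n c x y k)"
  and bil_zero_left: "bil n c 0 y = 0" and bil_zero_right: "bil n c x 0 = 0"
  by (auto simp: bil_def fun_eq_iff algebra_simps sum.distrib sum_subtractf sum_distrib_left)

lemma bil_ev:
  assumes "i \<in> idx n" "j \<in> idx n" "csupp n c"
  shows "bil n c (ev i) (ev j) = c i j"
proof
  fix k
  have "(\<Sum>a\<in>idx n. \<Sum>b\<in>idx n. ev i a * ev j b * c a b k) = (\<Sum>a\<in>idx n. if a = i then c i j k else 0)"
    using assms by (intro sum.cong) (auto simp: ev_def if_distrib[of "\<lambda>t. t * _"] cong: if_cong)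
  then show "bil n c (ev i) (ev j) k = c i j k"
    using assms by (auto simp: bil_def csupp_def)
qed

lemma csupp_eqI:
  assumes "csupp n c" "csupp n c'" "\<And>i j. i \<in> idx n \<Longrightarrow> j \<in> idx n \<Longrightarrow> bil n c (ev i) (ev j) = bil n c' (ev i) (ev j)"
  shows "c = c'"
proof (intro ext)
  fix i j k
  show "c i j k = c' i j k"
    using assms(1,2) fun_cong[OF assms(3)[of i j], of k] bil_ev[of i n j c] bil_ev[of i n j c']
    by (cases "i \<in> idx n \<and> j \<in> idx n") (auto simp: csupp_def)
qed

lemma csupp_act1 [simp]: "csupp n (act1 n g h c)"
  by (auto simp: csupp_def act1_def)

lemma act_space [simp]: "act n g h p \<in> space n"
  by (simp add: space_iff act_def)

lemma sum_rotate:
  "(\<Sum>i\<in>A. \<Sum>j\<in>B. \<Sum>a\<in>C. F i j a) = (\<Sum>a\<in>C. \<Sum>i\<in>A. \<Sum>j\<in>B. F i j a)"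
  for F :: "'a \<Rightarrow> 'b \<Rightarrow> 'c \<Rightarrow> complex"
proof -
  have "(\<Sum>i\<in>A. \<Sum>j\<in>B. \<Sum>a\<in>C. F i j a) = (\<Sum>i\<in>A. \<Sum>a\<in>C. \<Sum>j\<in>B. F i j a)"
    by (intro sum.cong refl sum.swap)
  also have "\<dots> = (\<Sum>a\<in>C. \<Sum>i\<in>A. \<Sum>j\<in>B. F i j a)"
    by (rule sum.swap)
  finally show ?thesis .
qed

lemma bil_act1: "bil n (act1 n g h c) x y = mv n g (bil n c (mv n h x) (mv n h y))"
proof
  fix k
  show "bil n (act1 n g h c) x y k = mv n g (bil n c (mv n h x) (mv n h y)) k"
  proof (cases "k \<in> idx n")
    case True
    let ?s = "\<lambda>i j a b l. x i * y j * (h a i * h b j * c a b l * g k l)"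
    have "bil n (act1 n g h c) x y k =
        (\<Sum>i\<in>idx n. \<Sum>j\<in>idx n. \<Sum>a\<in>idx n. \<Sum>b\<in>idx n. \<Sum>l\<in>idx n. ?s i j a b l)"
      using True by (simp add: bil_def act1_def sum_distrib_left cong: sum.cong)
    also have "\<dots> = (\<Sum>a\<in>idx n. \<Sum>i\<in>idx n. \<Sum>j\<in>idx n. \<Sum>b\<in>idx n. \<Sum>l\<in>idx n. ?s i j a b l)"
      by (rule sum_rotate)
    also have "\<dots> = (\<Sum>a\<in>idx n. \<Sum>b\<in>idx n. \<Sum>i\<in>idx n. \<Sum>j\<in>idx n. \<Sum>l\<in>idx n. ?s i j a b l)"
      by (intro sum.cong refl sum_rotate)
    also have "\<dots> = (\<Sum>a\<in>idx n. \<Sum>b\<in>idx n. \<Sum>l\<in>idx n. \<Sum>i\<in>idx n. \<Sum>j\<in>idx n. ?s i j a b l)"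
      by (intro sum.cong refl sum_rotate)
    also have "\<dots> = (\<Sum>l\<in>idx n. \<Sum>a\<in>idx n. \<Sum>b\<in>idx n. \<Sum>i\<in>idx n. \<Sum>j\<in>idx n. ?s i j a b l)"
      by (rule sum_rotate)
    also have "\<dots> = (\<Sum>l\<in>idx n. \<Sum>a\<in>idx n. \<Sum>b\<in>idx n.
        g k l * ((\<Sum>i\<in>idx n. h a i * x i) * (\<Sum>j\<in>idx n. h b j * y j) * c a b l))"
      unfolding sum_product by (intro sum.cong refl) (simp add: sum_distrib_left sum_distrib_right mult_ac)
    also have "\<dots> = mv n g (bil n c (mv n h x) (mv n h y)) k"
      using True by (simp add: mv_def bil_def sum_distrib_left cong: sum.cong)
    finally show ?thesis .
  qed (simp add: bil_def mv_def)
qed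

lemma bil_act:
  "bil n (fst (act n g h p)) x y = mv n g (bil n (fst p) (mv n h x) (mv n h y))"
  "bil n (snd (act n g h p)) x y = mv n g (bil n (snd p) (mv n h x) (mv n h y))"
  by (simp_all add: act_def bil_act1)

lemma space_eqI:
  assumes "p \<in> space n" "q \<in> space n"
    "\<And>i j. i \<in> idx n \<Longrightarrow> j \<in> idx n \<Longrightarrow> bil n (fst p) (ev i) (ev j) = bil n (fst q) (ev i) (ev j)"
    "\<And>i j. i \<in> idx n \<Longrightarrow> j \<in> idx n \<Longrightarrow> bil n (snd p) (ev i) (ev j) = bil n (snd q) (ev i) (ev j)"
  shows "p = q"
  using assms by (auto simp: space_iff prod_eq_iff intro: csupp_eqI)

lemma act_act: "act n g h (act n g' h' p) = act n (mm n g g') (mm n h' h) p"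
  by (rule space_eqI[of _ n]) (auto simp: bil_act mv_mm)

lemma act_idm: "p \<in> space n \<Longrightarrow> act n (idm n) (idm n) p = p"
  by (rule space_eqI[of _ n]) (auto simp: bil_act mv_idm ev_vec)

lemma act_inverse:
  assumes "invpair n g h" "p \<in> space n"
  shows "act n g h (act n h g p) = p"
  using assms by (simp add: act_act invpair_iff act_idm)

text \<open>Structure constants with respect to the basis formed by the columns of h.\<close>
lemma act_eqI:
  assumes "invpair n g h" "q \<in> space n"
    "\<And>i j. i \<in> idx n \<Longrightarrow> j \<in> idx n \<Longrightarrow>
      bil n (fst p) (mv n h (ev i)) (mv n h (ev j)) = mv n h (bil n (fst q) (ev i) (ev j))"
    "\<And>i j. i \<in> idx n \<Longrightarrow> j \<in> idx n \<Longrightarrow>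
      bil n (snd p) (mv n h (ev i)) (mv n h (ev j)) = mv n h (bil n (snd q) (ev i) (ev j))"
  shows "act n g h p = q"
  using assms by (intro space_eqI) (auto simp: bil_act invpair_cancel)

lemma orbit_space: "orbit n p \<subseteq> space n"
  by (auto simp: orbit_def)

lemma orbitI: "invpair n g h \<Longrightarrow> act n g h p \<in> orbit n p"
  by (auto simp: orbit_def)

lemma orbit_refl: "p \<in> space n \<Longrightarrow> p \<in> orbit n p"
  using orbitI[OF invpair_idm, of n p] act_idm by auto

lemma orbit_sym: "p \<in> space n \<Longrightarrow> q \<in> orbit n p \<Longrightarrow> p \<in> orbit n q"
  unfolding orbit_def using invpair_sym act_inverse by (smt (verit) mem_Collect_eq)

lemma orbit_trans: "q \<in> orbit n p \<Longrightarrow> r \<in> orbit n q \<Longrightarrow> r \<in> orbit n p"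
  unfolding orbit_def using invpair_mm act_act by (smt (verit) mem_Collect_eq)

lemma regmap_act:
  assumes R: "funalg R" and p: "regmap n R p"
    and g: "\<And>i j. i \<in> idx n \<Longrightarrow> j \<in> idx n \<Longrightarrow> (\<lambda>x. g x i j) \<in> R"
    and h: "\<And>i j. i \<in> idx n \<Longrightarrow> j \<in> idx n \<Longrightarrow> (\<lambda>x. h x i j) \<in> R"
  shows "regmap n R (\<lambda>x. act n (g x) (h x) (p x))"
proof -
  have "(\<lambda>x. fst (p x) a b l) \<in> R" "(\<lambda>x. snd (p x) a b l) \<in> R"
    if "a \<in> idx n" "b \<in> idx n" "l \<in> idx n" for a b l
    using p that by (auto simp: regmap_def)
  then show ?thesis
    unfolding regmap_def
    by (auto simp: act_def act1_def intro!: funalg_sum[OF R] funalg_mult[OF R] g h)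
qed

lemma funalg_bil:
  assumes R: "funalg R" and k: "k \<in> idx n"
    and "\<And>i. i \<in> idx n \<Longrightarrow> (\<lambda>x. u x i) \<in> R" "\<And>i. i \<in> idx n \<Longrightarrow> (\<lambda>x. v x i) \<in> R"
    and "\<And>i j. i \<in> idx n \<Longrightarrow> j \<in> idx n \<Longrightarrow> (\<lambda>x. c x i j k) \<in> R"
  shows "(\<lambda>x. bil n (c x) (u x) (v x) k) \<in> R"
  using assms by (auto simp: bil_def intro!: funalg_sum[OF R] funalg_mult[OF R])

lemma funalg_mm:
  assumes R: "funalg R"
    and "\<And>i j. i \<in> idx n \<Longrightarrow> j \<in> idx n \<Longrightarrow> (\<lambda>x. A x i j) \<in> R"
    and "\<And>i j. i \<in> idx n \<Longrightarrow> j \<in> idx n \<Longrightarrow> (\<lambda>x. B x i j) \<in> R"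
    and "i \<in> idx n" "k \<in> idx n"
  shows "(\<lambda>x. mm n (A x) (B x) i k) \<in> R"
  using assms by (auto simp: mm_def intro!: funalg_sum[OF R] funalg_mult[OF R])

lemma funalg_mv:
  assumes R: "funalg R"
    and "\<And>i j. i \<in> idx n \<Longrightarrow> j \<in> idx n \<Longrightarrow> (\<lambda>x. A x i j) \<in> R"
    and "\<And>i. i \<in> idx n \<Longrightarrow> (\<lambda>x. u x i) \<in> R" and "k \<in> idx n"
  shows "(\<lambda>x. mv n (A x) (u x) k) \<in> R"
  using assms by (auto simp: mv_def intro!: funalg_sum[OF R] funalg_mult[OF R])

subsection \<open>Determinants\<close>

definition tomat :: "nat \<Rightarrow> (nat \<Rightarrow> nat \<Rightarrow> complex) \<Rightarrow> complex mat" where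
  "tomat n M = mat n n (\<lambda>(i, j). M (Suc i) (Suc j))"

definition mdet :: "nat \<Rightarrow> (nat \<Rightarrow> nat \<Rightarrow> complex) \<Rightarrow> complex" where
  "mdet n M = det (tomat n M)"

text \<open>The cofactor formula exhibits the entries of the inverse as regular functions wherever
  the determinant is invertible; an abstractly chosen inverse would not.\<close>

definition minv :: "nat \<Rightarrow> (nat \<Rightarrow> nat \<Rightarrow> complex) \<Rightarrow> nat \<Rightarrow> nat \<Rightarrow> complex" where
  "minv n M = (\<lambda>i j. if i \<in> idx n \<and> j \<in> idx n then 1 / mdet n M * adj_mat (tomat n M) $$ (i - 1, j - 1) else 0)"

lemma tomat_carrier: "tomat n M \<in> carrier_mat n n"
  by (simp add: tomat_def)

lemma sum_idx: "(\<Sum>j\<in>idx n. f j) = (\<Sum>j<n. f (Suc j))" for f :: "nat \<Rightarrow> 'a::comm_monoid_add"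
  unfolding idx_def by (rule sum.reindex_bij_witness[of _ Suc "\<lambda>j. j - 1"]) auto

lemma in_idx_Suc: "Suc j \<in> idx n \<longleftrightarrow> j < n"
  by (auto simp: idx_def)

lemma tomat_mult: "tomat n A * tomat n B = tomat n (mm n A B)"
  by (rule eq_matI)
     (auto simp: tomat_def mm_def scalar_prod_def sum_idx in_idx_Suc atLeast0LessThan)

lemma invpair_minv:
  assumes M: "matn n M" and d: "mdet n M \<noteq> 0"
  shows "invpair n M (minv n M)"
proof -
  note adj = adj_mat[OF tomat_carrier[of n M]]
  have "mm n M (minv n M) i k = idm n i k \<and> mm n (minv n M) M i k = idm n i k" for i k
  proof (cases "i \<in> idx n \<and> k \<in> idx n")
    case True
    then have ik: "i - 1 < n" "k - 1 < n" "Suc (i - 1) = i" "Suc (k - 1) = k"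
      by (auto simp: idx_def)
    have tomat_ix: "tomat n M $$ (j, l) = M (Suc j) (Suc l)" if "j < n" "l < n" for j l
      using that by (simp add: tomat_def)
    have A: "adj_mat (tomat n M) $$ (j, k - Suc 0) = minv n M (Suc j) k * mdet n M"
      "adj_mat (tomat n M) $$ (i - Suc 0, j) = minv n M i (Suc j) * mdet n M" if "j < n" for j
      using that d True by (simp_all add: minv_def in_idx_Suc)
    have "(tomat n M * adj_mat (tomat n M)) $$ (i - 1, k - 1) = (\<Sum>j<n. M i (Suc j) * (minv n M (Suc j) k * mdet n M))"
      using ik adj(1) tomat_carrier[of n M]
      by (auto simp: scalar_prod_def A tomat_ix atLeast0LessThan intro!: sum.cong)
    then have 1: "mm n M (minv n M) i k * mdet n M = (mdet n M \<cdot>\<^sub>m 1\<^sub>m n) $$ (i - 1, k - 1)"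
      using True adj(2) by (simp add: mm_def sum_idx sum_distrib_right mult.assoc mdet_def)
    have "(adj_mat (tomat n M) * tomat n M) $$ (i - 1, k - 1) = (\<Sum>j<n. (minv n M i (Suc j) * mdet n M) * M (Suc j) k)"
      using ik adj(1) tomat_carrier[of n M]
      by (auto simp: scalar_prod_def A tomat_ix atLeast0LessThan intro!: sum.cong)
    then have 2: "mm n (minv n M) M i k * mdet n M = (mdet n M \<cdot>\<^sub>m 1\<^sub>m n) $$ (i - 1, k - 1)"
      using True adj(3) by (simp add: mm_def sum_idx sum_distrib_right sum_distrib_left mult_ac mdet_def)
    have "(mdet n M \<cdot>\<^sub>m 1\<^sub>m n) $$ (i - 1, k - 1) = idm n i k * mdet n M"
      using ik True by (auto simp: idm_def) 
    with 1 2 d show ?thesis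
      by simp
  qed (auto simp: mm_def idm_def)
  then show ?thesis
    using M by (auto simp: invpair_iff matn_def minv_def fun_eq_iff)
qed

lemma invpair_mdet:
  assumes "invpair n g h"
  shows "mdet n g \<noteq> 0"
proof -
  have "tomat n g * tomat n h = 1\<^sub>m n"
    unfolding tomat_mult using assms
    by (intro eq_matI) (auto simp: invpair_iff tomat_def idm_def idx_def)
  then have "mdet n g * mdet n h = 1"
    unfolding mdet_def using det_mult[OF tomat_carrier tomat_carrier, of n g h] by simp
  then show ?thesis
    by auto
qed

lemma funalg_det:
  assumes R: "funalg R" and A: "\<And>x. A x \<in> carrier_mat m m"
    and e: "\<And>i j. i < m \<Longrightarrow> j < m \<Longrightarrow> (\<lambda>x. A x $$ (i, j)) \<in> R"
  shows "(\<lambda>x. det (A x)) \<in> R"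
proof -
  have "p i < m" if "p permutes {0..<m}" "i < m" for p i
    using permutes_in_image[OF that(1), of i] that(2) by auto
  then have "(\<lambda>x. \<Sum>p\<in>{p. p permutes {0..<m}}. signof p * (\<Prod>i = 0..<m. A x $$ (i, p i))) \<in> R"
    by (intro funalg_sum[OF R] funalg_mult[OF R] funalg_prod[OF R] funalg_const[OF R] e) auto
  moreover have "det (A x) = (\<Sum>p\<in>{p. p permutes {0..<m}}. signof p * (\<Prod>i = 0..<m. A x $$ (i, p i)))" for x
    using A[of x] by (simp add: det_def)
  ultimately show ?thesis
    by simp
qed

lemma funalg_mdet:
  assumes "funalg R" "\<And>i j. i \<in> idx n \<Longrightarrow> j \<in> idx n \<Longrightarrow> (\<lambda>x. M x i j) \<in> R"
  shows "(\<lambda>x. mdet n (M x)) \<in> R"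
  unfolding mdet_def
  by (rule funalg_det[OF assms(1) tomat_carrier]) (auto simp: tomat_def idx_def intro!: assms(2))

lemma funalg_minv:
  assumes R: "funalg R" and M: "\<And>i j. i \<in> idx n \<Longrightarrow> j \<in> idx n \<Longrightarrow> (\<lambda>x. M x i j) \<in> R"
    and d: "(\<lambda>x. 1 / mdet n (M x)) \<in> R" and ij: "i \<in> idx n" "j \<in> idx n"
  shows "(\<lambda>x. minv n (M x) i j) \<in> R"
proof -
  let ?m = "\<lambda>x. mat_delete (tomat n (M x)) (j - 1) (i - 1)"
  have car: "?m x \<in> carrier_mat (n - 1) (n - 1)" for x
    using mat_delete_carrier[OF tomat_carrier[of n "M x"]] by simp
  have "(\<lambda>x. ?m x $$ (a, b)) \<in> R" if "a < n - 1" "b < n - 1" for a b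
  proof -
    have "(if a < j - 1 then a else Suc a) < n" "(if b < i - 1 then b else Suc b) < n"
      using that by auto
    moreover have "?m x $$ (a, b) = M x (Suc (if a < j - 1 then a else Suc a)) (Suc (if b < i - 1 then b else Suc b))" for x
      using that by (simp add: mat_delete_def tomat_def)
    ultimately show ?thesis
      using M[of "Suc (if a < j - 1 then a else Suc a)" "Suc (if b < i - 1 then b else Suc b)"]
      by (simp add: idx_def)
  qed
  then have "(\<lambda>x. det (?m x)) \<in> R"
    by (intro funalg_det[OF R car])
  then have "(\<lambda>x. 1 / mdet n (M x) * ((-1) ^ (j - 1 + (i - 1)) * det (?m x))) \<in> R"
    by (intro funalg_mult[OF R] d funalg_const[OF R])
  moreover have "minv n (M x) i j = 1 / mdet n (M x) * ((-1) ^ (j - 1 + (i - 1)) * det (?m x))" for x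
  proof -
    have "i - 1 < n" "j - 1 < n"
      using ij by (auto simp: idx_def)
    then show ?thesis
      using ij by (simp add: minv_def adj_mat_def cofactor_def tomat_def)
  qed
  ultimately show ?thesis
    by simp
qed

subsection \<open>Orbits and degenerations\<close>

text \<open>The orbit is the image of the invertible matrices, an open part of an affine space. The
  parameter is the matrix \<open>h\<close>, from which \<open>g\<close> is recovered as its
  inverse.\<close>

lemma irreducible_orbit:
  assumes r: "r \<in> space n"
  shows "irreducible_z n (orbit n r)"
proof -
  define H where "H x = (\<lambda>i j. if i \<in> idx n \<and> j \<in> idx n then x (i, j) else 0)" for x :: "nat \<times> nat \<Rightarrow> complex"
  define I where "I = idx n \<times> idx n"
  define \<Delta> where "\<Delta> x = mdet n (H x)" for x
  define \<Theta> where "\<Theta> x = act n (minv n (H x)) (H x) r" for x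
  have H: "(\<lambda>x. H x i j) \<in> Pol I" if "i \<in> idx n" "j \<in> idx n" for i j
    using that by (auto simp: H_def I_def intro: Pol_coord)
  have matH: "matn n (H x)" for x
    by (simp add: matn_def H_def)
  have \<Delta>: "\<Delta> \<in> Pol I"
    unfolding \<Delta>_def by (rule funalg_mdet[OF funalg_Pol H])
  note fr = funalg_reg[OF funalg_Pol \<Delta>]
  have "regmap n (reg (Pol I) \<Delta>) (\<lambda>x. act n (minv n (H x)) (H x) r)"
  proof (rule regmap_act[OF fr])
    show "regmap n (reg (Pol I) \<Delta>) (\<lambda>x. r)"
      by (auto simp: regmap_def intro: funalg_const[OF fr])
    show "(\<lambda>x. minv n (H x) i j) \<in> reg (Pol I) \<Delta>" if "i \<in> idx n" "j \<in> idx n" for i j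
      by (rule funalg_minv[OF fr _ _ that])
         (use H reg_inverse[OF funalg_Pol, of \<Delta>] in \<open>auto simp: \<Delta>_def intro: reg_base\<close>)
  qed (use H in \<open>auto intro: reg_base\<close>)
  then have \<Theta>: "regmap n (reg (Pol I) \<Delta>) \<Theta>"
    by (simp add: \<Theta>_def[abs_def])
  have eq: "orbit n r = \<Theta> ` {x \<in> UNIV. \<Delta> x \<noteq> 0}"
  proof (intro equalityI subsetI)
    fix q assume "q \<in> orbit n r"
    then obtain g h where gh: "invpair n g h" "q = act n g h r"
      by (auto simp: orbit_def)
    have h: "H (\<lambda>(i, j). h i j) = h"
      using gh(1) by (auto simp: H_def fun_eq_iff invpair_iff matn_def)
    have hg: "invpair n h g"
      using gh(1) by (rule invpair_sym)
    have "matn n h"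
      using hg by (simp add: invpair_iff)
    then have "minv n h = g"
      using invpair_unique[OF invpair_minv[OF _ invpair_mdet[OF hg]] hg] by simp
    then have "q = \<Theta> (\<lambda>(i, j). h i j)" "\<Delta> (\<lambda>(i, j). h i j) \<noteq> 0"
      using gh(2) h invpair_mdet[OF hg] by (simp_all add: \<Theta>_def \<Delta>_def)
    then show "q \<in> \<Theta> ` {x \<in> UNIV. \<Delta> x \<noteq> 0}"
      by blast
  next
    fix q assume "q \<in> \<Theta> ` {x \<in> UNIV. \<Delta> x \<noteq> 0}"
    then show "q \<in> orbit n r"
      using orbitI[OF invpair_sym[OF invpair_minv[OF matH]], of _ r] by (auto simp: \<Theta>_def \<Delta>_def)
  qed
  show ?thesis
    unfolding eq
  proof (rule irreducible_z_image[OF _ \<Delta> \<Theta>])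
    show "\<Theta> ` {x \<in> UNIV. \<Delta> x \<noteq> 0} \<subseteq> space n"
      unfolding eq[symmetric] by (rule orbit_space)
    show "{x \<in> UNIV. \<Delta> x \<noteq> 0} \<noteq> {}"
      using orbit_refl[OF r] eq by auto
  qed auto
qed

text \<open>Acting by a fixed matrix is a polynomial map that preserves the orbit, so a polynomial
  vanishing on the orbit may be precomposed with it.\<close>

lemma zclosure_orbit_act:
  assumes gh: "invpair n g h" and q: "q \<in> zclosure n (orbit n p)"
  shows "act n g h q \<in> zclosure n (orbit n p)"
  unfolding in_zclosure_iff[OF orbit_space]
proof (intro conjI ballI impI)
  fix f assume f: "f \<in> polyfun n" "\<forall>x\<in>orbit n p. f x = 0"
  have "(\<lambda>q. f (act n g h q)) \<in> polyfun n"
    by (intro polyfun_comp[OF funalg_polyfun _ f(1)] regmap_act[OF funalg_polyfun regmap_id]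
        funalg_const[OF funalg_polyfun])
  moreover have "f (act n g h x) = 0" if "x \<in> orbit n p" for x
    using f(2) orbit_trans[OF that orbitI[OF gh]] by simp
  ultimately show "f (act n g h q) = 0"
    using q[unfolded in_zclosure_iff[OF orbit_space], THEN conjunct2, THEN bspec[of _ _ "\<lambda>q. f (act n g h q)"]]
    by simp
qed simp

lemma zclosure_orbit_orbit:
  assumes "q \<in> zclosure n (orbit n p)"
  shows "orbit n q \<subseteq> zclosure n (orbit n p)"
proof
  fix r assume "r \<in> orbit n q"
  then obtain g h where "invpair n g h" "r = act n g h q"
    unfolding orbit_def by blast
  then show "r \<in> zclosure n (orbit n p)"
    using zclosure_orbit_act[OF _ assms] by simp
qed

text \<open>The closure of an orbit is invariant under the group, so the choice of representative is
  irrelevant.\<close>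

lemma degen_iff:
  assumes "q \<in> space n"
  shows "degen n p q \<longleftrightarrow> q \<in> zclosure n (orbit n p)"
proof
  assume "degen n p q"
  then obtain q' where q': "q' \<in> orbit n q" "q' \<in> zclosure n (orbit n p)"
    unfolding degen_def by blast
  show "q \<in> zclosure n (orbit n p)"
    using zclosure_orbit_orbit[OF q'(2)] orbit_sym[OF assms q'(1)] by blast
next
  assume "q \<in> zclosure n (orbit n p)"
  then show "degen n p q"
    unfolding degen_def using orbit_refl[OF assms] by blast
qed

lemma degen_closure_mono:
  assumes "q \<in> space n" "degen n p q"
  shows "zclosure n (orbit n q) \<subseteq> zclosure n (orbit n p)"
  using assms degen_iff zclosure_orbit_orbit zclosure_minimal[OF zclosure_zclosed[OF orbit_space]] by metis

lemma degen_trans: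
  assumes "q \<in> space n" "r \<in> space n" "degen n p q" "degen n q r"
  shows "degen n p r"
  using assms degen_closure_mono[of q n p] degen_iff by blast

lemma iso_degen:
  assumes "q \<in> space n" "iso n p q"
  shows "degen n p q"
  using assms degen_iff zclosure_superset unfolding iso_def by blast

lemma iso_sym: "p \<in> space n \<Longrightarrow> iso n p q \<Longrightarrow> iso n q p"
  unfolding iso_def by (rule orbit_sym)

lemma tendsto_polyfun:
  assumes "f \<in> polyfun n"
    and "\<And>i j k. i \<in> idx n \<Longrightarrow> j \<in> idx n \<Longrightarrow> k \<in> idx n \<Longrightarrow>
      ((\<lambda>t. fst (P t) i j k) \<longlongrightarrow> fst q i j k) F \<and> ((\<lambda>t. snd (P t) i j k) \<longlongrightarrow> snd q i j k) F"
  shows "((\<lambda>t. f (P t)) \<longlongrightarrow> f q) F"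
  using assms(1)
  by induction (use assms(2) in \<open>auto intro: tendsto_add tendsto_mult\<close>)

text \<open>Polynomials are continuous, so limits in the usual topology stay in the Zariski closure.
  The degenerations are produced in this way.\<close>

lemma degen_limit:
  fixes P :: "nat \<Rightarrow> pstruct"
  assumes q: "q \<in> space n" and P: "\<And>m. P m \<in> orbit n p"
    and lim: "\<And>i j k. i \<in> idx n \<Longrightarrow> j \<in> idx n \<Longrightarrow> k \<in> idx n \<Longrightarrow>
      (\<lambda>m. fst (P m) i j k) \<longlonglongrightarrow> fst q i j k \<and> (\<lambda>m. snd (P m) i j k) \<longlonglongrightarrow> snd q i j k"
  shows "degen n p q"
  unfolding degen_iff[OF q] in_zclosure_iff[OF orbit_space]
proof (intro conjI ballI impI q)
  fix f assume f: "f \<in> polyfun n" "\<forall>x\<in>orbit n p. f x = 0"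
  have "(\<lambda>m. f (P m)) \<longlonglongrightarrow> f q"
    by (rule tendsto_polyfun[OF f(1) lim])
  moreover have "(\<lambda>m. f (P m)) = (\<lambda>_. 0)"
    using f(2) P by auto
  ultimately show "f q = 0"
    using LIMSEQ_unique tendsto_const by metis
qed

text \<open>A third orbit strictly between two orbits would produce a chain that is too long: both outer
  orbits are open in their closures, so all three closures differ.\<close>
lemma primary_of_tame:
  assumes p: "p \<in> space n" "tame n (orbit n p) (Suc d)" and q: "q \<in> space n" "tame n (orbit n q) d"
    and pq: "degen n p q" "\<not> iso n p q"
  shows "primary n p q"
proof -
  \<comment> \<open>A nonempty open part of the common closure meets the dense orbit of
    \<open>r\<close>; a common point makes the two orbits equal.\<close>
  have open_meets: "iso n r s \<and> iso n s r"
    if rs: "r \<in> space n" "s \<in> space n" "tame n (orbit n s) e" "zclosure n (orbit n r) = zclosure n (orbit n s)" for r s e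
  proof -
    obtain f where f: "f \<in> polyfun n" "\<exists>y\<in>orbit n s. f y \<noteq> 0" "\<forall>y\<in>zclosure n (orbit n s). f y \<noteq> 0 \<longrightarrow> y \<in> orbit n s"
      using rs(3) unfolding tame_def by blast
    have "\<exists>y\<in>orbit n r. f y \<noteq> 0"
    proof (rule ccontr)
      assume "\<not> (\<exists>y\<in>orbit n r. f y \<noteq> 0)"
      then have "\<forall>y\<in>zclosure n (orbit n r). f y = 0"
        using f(1) in_zclosure_iff[OF orbit_space[of n r]] by simp
      then show False
        using f(2) rs(4) zclosure_superset[of "orbit n s" n] by auto
    qed
    then obtain y where "y \<in> orbit n r" "f y \<noteq> 0"
      by blast
    then have "y \<in> orbit n r" "y \<in> orbit n s"
      using f(3) rs(4) zclosure_superset[of "orbit n r" n] by auto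
    then show ?thesis
      unfolding iso_def using rs(1,2) orbit_sym orbit_trans by meson
  qed
  have False if r: "poisson n r" "degen n p r" "\<not> iso n p r" "degen n r q" "\<not> iso n r q" for r
  proof -
    have rs: "r \<in> space n"
      using r(1) by (simp add: poisson_def)
    let ?c = "\<lambda>s. zclosure n (orbit n s)"
    have sub: "?c q \<subseteq> ?c r" "?c r \<subseteq> ?c p"
      using degen_closure_mono q(1) rs r by auto
    have ne: "?c q \<noteq> ?c r" "?c r \<noteq> ?c p"
      using open_meets[OF rs q(1) q(2)] open_meets[OF rs p(1) p(2)] r by auto
    have irr: "irreducible_z n (?c s)" "?c s \<subseteq> space n" if "s \<in> space n" for s
      using irreducible_z_between[OF irreducible_orbit[OF that] zclosure_superset order_refl orbit_space]
        zclosure_subset_space[OF orbit_space] by auto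
    have sep: "\<exists>f\<in>polyfun n. (\<forall>z\<in>?c s. f z = 0) \<and> (\<exists>z\<in>?c s'. f z \<noteq> 0)"
      if ss: "?c s \<subseteq> ?c s'" "?c s \<noteq> ?c s'" for s s'
    proof -
      obtain z where z: "z \<in> ?c s'" "z \<notin> ?c s"
        using ss by blast
      then obtain f where "f \<in> polyfun n" "\<forall>x\<in>?c s. f x = 0" "f z \<noteq> 0"
        using zclosed_separate[OF zclosure_zclosed[OF orbit_space], of z n s]
          zclosure_subset_space[OF orbit_space, of n s'] by auto
      then show ?thesis
        using z by (intro bexI[of _ f]) auto
    qed
    have "has_chain n (orbit n q) d"
      using q(2) unfolding tame_def by simp
    then obtain Z where Z: "strict_chain n Z d" "Z d \<subseteq> orbit n q"
      using has_chain_strict_chain[OF orbit_space] by blast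
    \<comment> \<open>A chain of d + 1 sets in the orbit of \<open>q\<close>, extended by the two
      larger closures, has d + 3 members, whereas the closure of the orbit of \<open>p\<close>
      admits at most d + 2.\<close>
    define Y where "Y i = (if i \<le> d then Z i else if i = Suc d then ?c r else ?c p)" for i
    have "strict_chain n Y (Suc (Suc d))"
      unfolding strict_chain_def
    proof (intro conjI allI impI)
      fix i assume "i \<le> Suc (Suc d)"
      show "irreducible_z n (Y i)" "Y i \<subseteq> space n"
        using Z(1) irr[OF rs] irr[OF p(1)] by (auto simp: Y_def strict_chain_def)
    next
      fix i assume "i < Suc (Suc d)"
      then consider "i < d" | "i = d" | "i = Suc d"
        by linarith
      then have "Y i \<subseteq> Y (Suc i) \<and> (\<exists>f\<in>polyfun n. (\<forall>z\<in>Y i. f z = 0) \<and> (\<exists>z\<in>Y (Suc i). f z \<noteq> 0))"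
      proof cases
        case 1
        then show ?thesis
          using Z(1) by (simp add: Y_def strict_chain_def)
      next
        case 2
        have "Z d \<subseteq> ?c q"
          using Z(2) zclosure_superset by blast
        then show ?thesis
          using 2 sub(1) sep[OF sub(1) ne(1)] by (auto simp: Y_def) 
      next
        case 3
        then show ?thesis
          using sub(2) sep[OF sub(2) ne(2)] by (simp add: Y_def)
      qed
      then show "Y i \<subseteq> Y (Suc i)" "\<exists>f\<in>polyfun n. (\<forall>z\<in>Y i. f z = 0) \<and> (\<exists>z\<in>Y (Suc i). f z \<noteq> 0)"
        by blast+
    qed
    moreover have "Y (Suc (Suc d)) \<subseteq> ?c p"
      by (simp add: Y_def)
    ultimately have "Suc (Suc d) \<le> Suc d"
      using p(2) unfolding tame_def by blast
    then show False
      by simp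
  qed
  then show ?thesis
    using pq unfolding primary_def by blast
qed

declare One_nat_def [simp del]

section \<open>Poisson structures\<close>

lemma poisson_iff:
  "poisson n p \<longleftrightarrow> p \<in> space n \<and> (\<forall>x\<in>Defs.vec n. \<forall>y\<in>Defs.vec n. \<forall>z\<in>Defs.vec n.
     bil n (fst p) x y = bil n (fst p) y x \<and>
     bil n (fst p) (bil n (fst p) x y) z = bil n (fst p) x (bil n (fst p) y z) \<and>
     bil n (snd p) x x = 0 \<and>
     bil n (snd p) (bil n (snd p) x y) z + bil n (snd p) (bil n (snd p) y z) x
       + bil n (snd p) (bil n (snd p) z x) y = 0 \<and>
     bil n (snd p) (bil n (fst p) x y) z = bil n (fst p) (bil n (snd p) x z) y + bil n (fst p) x (bil n (snd p) y z))"
  unfolding poisson_def by (simp add: fun_eq_iff)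

lemma poisson_act:
  assumes p: "poisson n p" and gh: "invpair n g h"
  shows "poisson n (act n g h p)"
  unfolding poisson_iff
proof (intro conjI ballI)
  fix x y z assume xyz: "x \<in> Defs.vec n" "y \<in> Defs.vec n" "z \<in> Defs.vec n"
  note P = p[unfolded poisson_iff, THEN conjunct2, THEN bspec, OF mv_vec[of n h x], THEN bspec, OF mv_vec[of n h y],
      THEN bspec, OF mv_vec[of n h z]]
  note simps = bil_act invpair_cancel[OF gh] mv_add[symmetric]
  show "bil n (fst (act n g h p)) x y = bil n (fst (act n g h p)) y x"
    unfolding bil_act by (rule arg_cong[OF P[THEN conjunct1]])
  show "bil n (fst (act n g h p)) (bil n (fst (act n g h p)) x y) z =
      bil n (fst (act n g h p)) x (bil n (fst (act n g h p)) y z)"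
    using P[THEN conjunct2, THEN conjunct1] by (simp add: simps)
  show "bil n (snd (act n g h p)) x x = 0"
    using P[THEN conjunct2, THEN conjunct2, THEN conjunct1] by (simp add: simps mv_zero)
  show "bil n (snd (act n g h p)) (bil n (snd (act n g h p)) x y) z + bil n (snd (act n g h p)) (bil n (snd (act n g h p)) y z) x
       + bil n (snd (act n g h p)) (bil n (snd (act n g h p)) z x) y = 0"
    using P[THEN conjunct2, THEN conjunct2, THEN conjunct2, THEN conjunct1] by (simp add: simps mv_zero)
  show "bil n (snd (act n g h p)) (bil n (fst (act n g h p)) x y) z =
      bil n (fst (act n g h p)) (bil n (snd (act n g h p)) x z) y + bil n (fst (act n g h p)) x (bil n (snd (act n g h p)) y z)"
    using P[THEN conjunct2, THEN conjunct2, THEN conjunct2, THEN conjunct2] by (simp add: simps)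
qed simp

lemma poisson_antisym:
  assumes "poisson n p" "x \<in> Defs.vec n" "y \<in> Defs.vec n"
  shows "bil n (snd p) x y = - bil n (snd p) y x"
proof -
  have "bil n (snd p) (x + y) (x + y) = 0" "bil n (snd p) x x = 0" "bil n (snd p) y y = 0"
    using assms vec_add[OF assms(2,3)] by (auto simp: poisson_iff)
  then show ?thesis
    by (simp add: bil_add_left bil_add_right eq_neg_iff_add_eq_0 add.commute)
qed

section \<open>Reduction of multilinear identities to basis vectors\<close>

lemma linear_eq_0:
  fixes F :: "(nat \<Rightarrow> complex) \<Rightarrow> nat \<Rightarrow> complex"
  assumes add: "\<And>x y. F (x + y) = F x + F y" and scale: "\<And>a x. F (\<lambda>k. a * x k) = (\<lambda>k. a * F x k)"
    and 0: "\<And>i. i \<in> idx n \<Longrightarrow> F (ev i) = 0" and x: "x \<in> Defs.vec n"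
  shows "F x = 0"
proof -
  have F0: "F 0 = 0"
    using scale[of 0 0] by (simp add: zero_fun_def)
  have "F (\<Sum>i\<in>A. (\<lambda>k. x i * ev i k)) = 0" if "finite A" "A \<subseteq> idx n" for A
    using that by (induction A rule: finite_induct) (auto simp: F0 add scale 0 fun_eq_iff)
  moreover have "(\<Sum>i\<in>A. (\<lambda>k. x i * ev i k)) k = (if k \<in> A then x k else 0)" if "finite A" for A k
    using that by (induction A rule: finite_induct) (auto simp: ev_def)
  then have "(\<Sum>i\<in>idx n. (\<lambda>k. x i * ev i k)) = x"
    using x by (auto simp: fun_eq_iff Defs.vec_def)
  ultimately show ?thesis
    by (metis finite_idx order_refl)
qed

lemma bilinear_eq_0:
  fixes F :: "(nat \<Rightarrow> complex) \<Rightarrow> (nat \<Rightarrow> complex) \<Rightarrow> nat \<Rightarrow> complex"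
  assumes "\<And>x x' y. F (x + x') y = F x y + F x' y" "\<And>a x y. F (\<lambda>k. a * x k) y = (\<lambda>k. a * F x y k)"
    and "\<And>x y y'. F x (y + y') = F x y + F x y'" "\<And>a x y. F x (\<lambda>k. a * y k) = (\<lambda>k. a * F x y k)"
    and "\<And>i j. i \<in> idx n \<Longrightarrow> j \<in> idx n \<Longrightarrow> F (ev i) (ev j) = 0" and "x \<in> Defs.vec n" "y \<in> Defs.vec n"
  shows "F x y = 0"
proof -
  have "F (ev i) y = 0" if "i \<in> idx n" for i
    by (rule linear_eq_0[of "F (ev i)" n]) (use assms that in auto)
  then show ?thesis
    using linear_eq_0[of "\<lambda>x. F x y" n x] assms by simp
qed

lemma trilinear_eq_0:
  fixes F :: "(nat \<Rightarrow> complex) \<Rightarrow> (nat \<Rightarrow> complex) \<Rightarrow> (nat \<Rightarrow> complex) \<Rightarrow> nat \<Rightarrow> complex"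
  assumes "\<And>x x' y z. F (x + x') y z = F x y z + F x' y z" "\<And>a x y z. F (\<lambda>k. a * x k) y z = (\<lambda>k. a * F x y z k)"
    and "\<And>x y y' z. F x (y + y') z = F x y z + F x y' z" "\<And>a x y z. F x (\<lambda>k. a * y k) z = (\<lambda>k. a * F x y z k)"
    and "\<And>x y z z'. F x y (z + z') = F x y z + F x y z'" "\<And>a x y z. F x y (\<lambda>k. a * z k) = (\<lambda>k. a * F x y z k)"
    and "\<And>i j k. i \<in> idx n \<Longrightarrow> j \<in> idx n \<Longrightarrow> k \<in> idx n \<Longrightarrow> F (ev i) (ev j) (ev k) = 0"
    and "x \<in> Defs.vec n" "y \<in> Defs.vec n" "z \<in> Defs.vec n"
  shows "F x y z = 0"
proof -
  have "F (ev i) y z = 0" if "i \<in> idx n" for i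
    by (rule bilinear_eq_0[of "F (ev i)" n]) (use assms that in auto)
  then show ?thesis
    using linear_eq_0[of "\<lambda>x. F x y z" n x] assms by simp
qed

lemma poisson_basisI:
  fixes n :: nat and p :: pstruct
  defines "m \<equiv> bil n (fst p)" and "l \<equiv> bil n (snd p)"
  assumes p: "p \<in> space n"
    and comm: "\<And>i j. i \<in> idx n \<Longrightarrow> j \<in> idx n \<Longrightarrow> m (ev i) (ev j) = m (ev j) (ev i)"
    and assoc: "\<And>i j k. i \<in> idx n \<Longrightarrow> j \<in> idx n \<Longrightarrow> k \<in> idx n \<Longrightarrow>
      m (m (ev i) (ev j)) (ev k) = m (ev i) (m (ev j) (ev k))"
    and anti: "\<And>i j. i \<in> idx n \<Longrightarrow> j \<in> idx n \<Longrightarrow> l (ev i) (ev j) = - l (ev j) (ev i)"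
    and jac: "\<And>i j k. i \<in> idx n \<Longrightarrow> j \<in> idx n \<Longrightarrow> k \<in> idx n \<Longrightarrow>
      l (l (ev i) (ev j)) (ev k) + l (l (ev j) (ev k)) (ev i) + l (l (ev k) (ev i)) (ev j) = 0"
    and leib: "\<And>i j k. i \<in> idx n \<Longrightarrow> j \<in> idx n \<Longrightarrow> k \<in> idx n \<Longrightarrow>
      l (m (ev i) (ev j)) (ev k) = m (l (ev i) (ev k)) (ev j) + m (ev i) (l (ev j) (ev k))"
  shows "poisson n p"
  unfolding poisson_iff m_def[symmetric] l_def[symmetric]
proof (intro conjI ballI)
  fix x y z assume xyz: "x \<in> Defs.vec n" "y \<in> Defs.vec n" "z \<in> Defs.vec n"
  note ext = bil_add_left bil_add_right and sc = bil_scale_left bil_scale_right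
  have "m x y - m y x = 0"
    by (rule bilinear_eq_0[of "\<lambda>x y. m x y - m y x" n];
        (rule xyz | (simp add: comm; fail) | (simp add: m_def ext; fail) | simp add: m_def sc fun_eq_iff algebra_simps))
  then show "m x y = m y x"
    by simp
  have "m (m x y) z - m x (m y z) = 0"
    by (rule trilinear_eq_0[of "\<lambda>x y z. m (m x y) z - m x (m y z)" n];
        (rule xyz | (simp add: assoc; fail) | (simp add: m_def ext; fail) | simp add: m_def sc fun_eq_iff algebra_simps))
  then show "m (m x y) z = m x (m y z)"
    by simp
  have anti': "l (ev i) (ev j) + l (ev j) (ev i) = 0" if "i \<in> idx n" "j \<in> idx n" for i j
    using anti[OF that] by simp
  \<comment> \<open>Antisymmetry on basis vectors yields only twice \<open>l x x\<close>; the factor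
    2 is then cancelled in the complex numbers.\<close>
  have "l x x + l x x = 0"
    by (rule bilinear_eq_0[of "\<lambda>x y. l x y + l y x" n];
        (rule xyz | (simp add: anti'; fail) | (simp add: l_def ext algebra_simps; fail) | simp add: l_def sc fun_eq_iff algebra_simps))
  then show "l x x = 0"
    by (auto simp: fun_eq_iff)
  show "l (l x y) z + l (l y z) x + l (l z x) y = 0"
    by (rule trilinear_eq_0[of "\<lambda>x y z. l (l x y) z + l (l y z) x + l (l z x) y" n];
        (rule xyz | (simp add: jac; fail) | (simp add: l_def ext algebra_simps; fail) | simp add: l_def sc fun_eq_iff algebra_simps))
  have "l (m x y) z - (m (l x z) y + m x (l y z)) = 0"
    by (rule trilinear_eq_0[of "\<lambda>x y z. l (m x y) z - (m (l x z) y + m x (l y z))" n];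
        (rule xyz | (simp add: leib; fail) | (simp add: l_def m_def ext algebra_simps
         ; fail) | simp add: l_def m_def sc fun_eq_iff algebra_simps))
  then show "l (m x y) z = m (l x z) y + m x (l y z)"
    by simp
qed (rule p)

text \<open>Repeated multiplication by one fixed element, applied later to e_1 and to
  \<open>w\<close>; this form is visibly invariant under a change of basis.\<close>

definition nilp :: "nat \<Rightarrow> nat \<Rightarrow> pstruct \<Rightarrow> bool" where
  "nilp n N p \<longleftrightarrow> (\<forall>x\<in>Defs.vec n. \<forall>z\<in>Defs.vec n. (bil n (fst p) x ^^ N) z = 0)"

lemma nilp_act:
  assumes p: "nilp n N p" and gh: "invpair n g h"
  shows "nilp n N (act n g h p)"
proof -
  have "(bil n (fst (act n g h p)) x ^^ j) z = mv n g ((bil n (fst p) (mv n h x) ^^ j) (mv n h z))"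
    if "z \<in> Defs.vec n" for x z j
  proof (induction j)
    case 0
    show ?case using that by (simp add: invpair_cancel[OF gh])
  next
    case (Suc j)
    have "(bil n (fst p) (mv n h x) ^^ j) (mv n h z) \<in> Defs.vec n"
      by (cases j) auto
    with Suc show ?case by (simp add: bil_act invpair_cancel[OF gh])
  qed
  with p show ?thesis
    by (simp add: nilp_def mv_zero)
qed

lemma bil_expand_right:
  assumes "x \<in> Defs.vec n"
  shows "bil n c u x k = (\<Sum>j\<in>idx n. x j * bil n c u (ev j) k)"
proof (cases "k \<in> idx n")
  case True
  have "bil n c u (ev j) k = (\<Sum>i\<in>idx n. u i * c i j k)" if "j \<in> idx n" for j
    using that True by (auto simp: bil_def ev_def if_distrib[of "\<lambda>t. t * _"] if_distrib[of "\<lambda>t. _ * t"] cong: if_cong)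
  then have "(\<Sum>j\<in>idx n. x j * bil n c u (ev j) k) = (\<Sum>j\<in>idx n. \<Sum>i\<in>idx n. u i * x j * c i j k)"
    by (simp add: sum_distrib_left mult_ac)
  also have "\<dots> = bil n c u x k"
    unfolding bil_def using True by (simp add: sum.swap[of "\<lambda>j i. u i * x j * c i j k"])
  finally show ?thesis by simp
qed (simp add: bil_def)

subsection \<open>The five algebras with a second generator\<close>

text \<open>The products e_n e_n = b e_(n-1) and {e_1, e_n} = c e_(n-1) + d e_n on top of the truncated chain.\<close>
definition NF :: "nat \<Rightarrow> complex \<Rightarrow> complex \<Rightarrow> complex \<Rightarrow> pstruct" where
  "NF n b c d = (\<lambda>i j k. chainm n (n - 1) i j k + b * sqn n i j k,
                 \<lambda>i j k. c * br1n n (n - 1) i j k + d * br1n n n i j k)"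

lemma alg_struct_NF:
  "alg_struct n P11 = NF n 0 0 0" "alg_struct n P12 = NF n 0 0 1" "alg_struct n P13 = NF n 0 1 0"
  "alg_struct n P14 = NF n 1 0 0" "alg_struct n P15 = NF n 1 1 0"
  by (simp_all add: NF_def)

text \<open>With e_k = 0 beyond \<open>N\<close>, the rule that e_i e_j is e_(i+j) needs no case
  distinction for truncation.\<close>

definition Ev :: "nat \<Rightarrow> nat \<Rightarrow> nat \<Rightarrow> complex" where
  "Ev N k = (if 1 \<le> k \<and> k \<le> N then ev k else 0)"

lemma Ev_ev: "1 \<le> k \<Longrightarrow> k \<le> N \<Longrightarrow> Ev N k = ev k"
  by (simp add: Ev_def)

lemma Ev_big: "N < k \<Longrightarrow> Ev N k = 0"
  by (simp add: Ev_def)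

lemma Ev_vec: "N \<le> n \<Longrightarrow> Ev N k \<in> Defs.vec n"
  by (auto simp: Ev_def Defs.vec_def ev_def idx_def)

lemma csupp_chainm: "N \<le> n \<Longrightarrow> csupp n (chainm n N)"
  by (auto simp: csupp_def chainm_def idx_def)

lemma NF_space:
  assumes "n > 3"
  shows "NF n b c d \<in> space n"
proof -
  have "csupp n (sqn n)" "csupp n (br1n n (n - 1))" "csupp n (br1n n n)"
    using assms by (auto simp: csupp_def sqn_def br1n_def idx_def)
  then show ?thesis
    using csupp_chainm[of "n - 1" n] by (simp add: space_iff NF_def csupp_def)
qed

lemma NF_mult:
  assumes "n > 3" "i \<in> idx n" "j \<in> idx n"
  shows "bil n (fst (NF n b c d)) (ev i) (ev j) =
    (if i < n \<and> j < n then Ev (n - 1) (i + j) else if i = n \<and> j = n then (\<lambda>k. b * ev (n - 1) k) else 0)"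
proof -
  have "csupp n (fst (NF n b c d))"
    using NF_space[OF assms(1)] by (simp add: space_iff)
  then have "bil n (fst (NF n b c d)) (ev i) (ev j) = fst (NF n b c d) i j"
    by (rule bil_ev[OF assms(2,3)])
  also have "\<dots> = (if i < n \<and> j < n then Ev (n - 1) (i + j) else if i = n \<and> j = n then (\<lambda>k. b * ev (n - 1) k) else 0)"
    using assms by (auto simp: NF_def chainm_def sqn_def Ev_def ev_def idx_def fun_eq_iff)
  finally show ?thesis .
qed

lemma NF_bracket:
  assumes "n > 3" "i \<in> idx n" "j \<in> idx n"
  shows "bil n (snd (NF n b c d)) (ev i) (ev j) =
    (if i = 1 \<and> j = n then (\<lambda>k. c * ev (n - 1) k) + (\<lambda>k. d * ev n k)
     else if i = n \<and> j = 1 then - ((\<lambda>k. c * ev (n - 1) k) + (\<lambda>k. d * ev n k)) else 0)"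
proof -
  have "csupp n (snd (NF n b c d))"
    using NF_space[OF assms(1)] by (simp add: space_iff)
  then have "bil n (snd (NF n b c d)) (ev i) (ev j) = snd (NF n b c d) i j"
    by (rule bil_ev[OF assms(2,3)])
  then show ?thesis
    using assms(1) by (auto simp: NF_def br1n_def ev_def fun_eq_iff)
qed

lemma bil_uminus_left: "bil n c (- x) y = - bil n c x y"
  and bil_uminus_right: "bil n c x (- y) = - bil n c x y"
  using bil_diff_left[of n c 0 x y] bil_diff_right[of n c x 0 y] by (simp_all add: bil_zero_left bil_zero_right)

text \<open>The condition removes the one product that could violate the Leibniz rule, {e_1, e_n}
  e_n = b d e_(n-1).\<close>

lemma NF_poisson:
  assumes n: "n > 3" and bd: "b * d = 0"
  shows "poisson n (NF n b c d)"
proof -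
  let ?m = "bil n (fst (NF n b c d))" and ?l = "bil n (snd (NF n b c d))"
  note M = NF_mult[OF n, of _ _ b c d] and L = NF_bracket[OF n, of _ _ b c d]
  have idx: "1 \<in> idx n" "n \<in> idx n" "n - 1 \<in> idx n"
    using n by (auto simp: idx_def)
  have idxn: "i \<in> idx n \<Longrightarrow> 1 \<le> i \<and> (i < n \<or> i = n)" for i
    by (auto simp: idx_def)
  have mE1: "?m (Ev (n - 1) u) (ev k) = (if k < n then Ev (n - 1) (u + k) else 0)"
    if "1 \<le> u" "k \<in> idx n" for u k
  proof (cases "u < n")
    case True
    then have "u \<in> idx n" using that by (auto simp: idx_def)
    then show ?thesis using True that M[of u k] by (auto simp: Ev_ev)
  qed (use that in \<open>auto simp: Ev_big bil_zero_left\<close>)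
  have mE2: "?m (ev k) (Ev (n - 1) u) = (if k < n then Ev (n - 1) (k + u) else 0)"
    if "1 \<le> u" "k \<in> idx n" for u k
  proof (cases "u < n")
    case True
    then have "u \<in> idx n" using that by (auto simp: idx_def)
    then show ?thesis using True that M[of k u] by (auto simp: Ev_ev)
  qed (use that in \<open>auto simp: Ev_big bil_zero_right\<close>)
  have lE: "?l (Ev (n - 1) u) (ev k) = 0" if "2 \<le> u" "k \<in> idx n" for u k
  proof (cases "u < n")
    case True
    then have "u \<in> idx n" using that by (auto simp: idx_def)
    then show ?thesis using True that L[of u k] by (auto simp: Ev_ev)
  qed (use that in \<open>auto simp: Ev_big bil_zero_left\<close>)
  have me: "?m (ev (n - 1)) (ev k) = 0" "?m (ev k) (ev (n - 1)) = 0" "?l (ev (n - 1)) (ev k) = 0"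
    "?l (ev k) (ev (n - 1)) = 0" if "k \<in> idx n" for k
    using that n M[OF idx(3) that] M[OF that idx(3)] L[OF idx(3) that] L[OF that idx(3)] idxn[OF that]
    by (auto simp: Ev_big)
  note lin = bil_add_left bil_add_right bil_scale_left bil_scale_right bil_zero_left bil_zero_right
    bil_diff_left bil_diff_right bil_uminus_left bil_uminus_right
  have z: "(\<lambda>k. a * (0 :: nat \<Rightarrow> complex) k) = 0" "(\<lambda>k. 0) = (0 :: nat \<Rightarrow> complex)" for a :: complex
    by (simp_all add: fun_eq_iff)
  show ?thesis
  proof (rule poisson_basisI)
    show "NF n b c d \<in> space n" by (rule NF_space[OF n])
  next
    fix i j assume "i \<in> idx n" "j \<in> idx n"
    then show "?m (ev i) (ev j) = ?m (ev j) (ev i)" by (simp add: M add.commute)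
  next
    fix i j k assume ijk: "i \<in> idx n" "j \<in> idx n" "k \<in> idx n"
    then show "?m (?m (ev i) (ev j)) (ev k) = ?m (ev i) (?m (ev j) (ev k))"
      using idxn[of i] idxn[of j] idxn[of k] by (auto simp: M mE1 mE2 me lin z add.assoc)
  next
    fix i j assume "i \<in> idx n" "j \<in> idx n"
    then show "?l (ev i) (ev j) = - ?l (ev j) (ev i)" using n by (simp add: L)
  next
    fix i j k assume ijk: "i \<in> idx n" "j \<in> idx n" "k \<in> idx n"
    then show "?l (?l (ev i) (ev j)) (ev k) + ?l (?l (ev j) (ev k)) (ev i) + ?l (?l (ev k) (ev i)) (ev j) = 0"
      using n by (auto simp: L me lin z)
  next
    fix i j k assume ijk: "i \<in> idx n" "j \<in> idx n" "k \<in> idx n"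
    have l0: "?l (?m (ev i) (ev j)) (ev k) = 0"
      using ijk idxn[of i] idxn[of j] by (auto simp: M lE me lin z)
    have db: "(\<lambda>k. d * (b * f k)) = 0" for f :: "nat \<Rightarrow> complex"
      using bd by (auto simp: fun_eq_iff)
    have "?m (?l (ev i) (ev k)) (ev j) = 0" "?m (ev i) (?l (ev j) (ev k)) = 0"
      using ijk n idx bd idxn[of i] idxn[of j] by (auto simp: L M me lin z db Ev_big)
    with l0 show "?l (?m (ev i) (ev j)) (ev k) = ?m (?l (ev i) (ev k)) (ev j) + ?m (ev i) (?l (ev j) (ev k))"
      by simp
  qed
qed

lemma bil_coord_0:
  assumes "\<And>i j. i \<in> idx n \<Longrightarrow> j \<in> idx n \<Longrightarrow> x i * y j * c i j k = 0"
  shows "bil n c x y k = 0"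
  unfolding bil_def by (auto intro!: sum.neutral simp: assms)

lemma NF_nilp:
  assumes n: "n > 3"
  shows "nilp n (n - 1) (NF n b c d)"
  unfolding nilp_def
proof (intro ballI)
  fix x z :: "nat \<Rightarrow> complex" assume "x \<in> Defs.vec n" "z \<in> Defs.vec n"
  \<comment> \<open>Only indices strictly between Suc j and n remain: no product has an e_n
    component, so after the first multiplication the square of e_n cannot contribute, and each
    further one raises the lowest index.\<close>
  have "\<forall>k. k \<le> Suc j \<or> k = n \<longrightarrow> (bil n (fst (NF n b c d)) x ^^ Suc j) z k = 0" for j
  proof (induction j)
    case 0
    show ?case
      using n by (auto intro!: bil_coord_0 simp: NF_def chainm_def sqn_def idx_def)
  next
    case (Suc j)
    let ?y = "(bil n (fst (NF n b c d)) x ^^ Suc j) z"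
    have "bil n (fst (NF n b c d)) x ?y k = 0" if "k \<le> Suc (Suc j) \<or> k = n" for k
    proof (rule bil_coord_0)
      fix i i' assume "i \<in> idx n" "i' \<in> idx n"
      show "x i * ?y i' * fst (NF n b c d) i i' k = 0"
      proof (cases "i' \<le> Suc j \<or> i' = n")
        case True
        then show ?thesis using Suc.IH[THEN spec, of i'] by auto
      next
        case False
        then have "fst (NF n b c d) i i' k = 0"
          using that n \<open>i \<in> idx n\<close> by (auto simp: NF_def chainm_def sqn_def idx_def)
        then show ?thesis by simp
      qed
    qed
    then show ?case by simp
  qed
  moreover have "Suc (n - 2) = n - 1"
    using n by simp
  ultimately have 0: "\<forall>k. k \<le> n - 1 \<or> k = n \<longrightarrow> (bil n (fst (NF n b c d)) x ^^ (n - 1)) z k = 0"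
    by metis
  have "(bil n (fst (NF n b c d)) x ^^ (n - 1)) z k = 0" if "k \<le> n" for k
    using 0 that by (cases "k = n") auto
  moreover have "(bil n (fst (NF n b c d)) x ^^ (n - 1)) z k = 0" if "n < k" for k
    using n that by (cases "n - 1") (auto simp: bil_def idx_def)
  ultimately show "(bil n (fst (NF n b c d)) x ^^ (n - 1)) z = 0"
    by (intro ext) (metis not_le zero_fun_apply)
qed

text \<open>Three isomorphism invariants tell the normal forms apart: the bracket vanishes; {x, {x, y}} = 0;
  every annihilator of the product is itself a product.\<close>
lemma NF_iso_invariants:
  assumes n: "n > 3" and bd: "b * d = 0" "b' * d' = 0" and gh: "invpair n g h"
    and eq: "act n g h (NF n b c d) = NF n b' c' d'"
  shows "b = 0 \<longleftrightarrow> b' = 0" "d = 0 \<longleftrightarrow> d' = 0" "c = 0 \<and> d = 0 \<longleftrightarrow> c' = 0 \<and> d' = 0"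
proof -
  \<comment> \<open>On normal forms, \<open>J\<close> holds exactly for b nonzero, \<open>K\<close>
    for d = 0, and \<open>L\<close> for c = d = 0.\<close>
  define J where "J p \<longleftrightarrow> (\<forall>y\<in>Defs.vec n. (\<forall>x\<in>Defs.vec n. bil n (fst p) x y = 0) \<longrightarrow>
      (\<exists>u\<in>Defs.vec n. \<exists>v\<in>Defs.vec n. y = bil n (fst p) u v))" for p :: pstruct
  define K where "K p \<longleftrightarrow> (\<forall>x\<in>Defs.vec n. \<forall>y\<in>Defs.vec n. bil n (snd p) x (bil n (snd p) x y) = 0)" for p :: pstruct
  define L where "L p \<longleftrightarrow> (\<forall>x\<in>Defs.vec n. \<forall>y\<in>Defs.vec n. bil n (snd p) x y = 0)" for p :: pstruct
  have idx: "1 \<in> idx n" "n \<in> idx n" "n - 1 \<in> idx n" "n - 2 \<in> idx n"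
    using n by (auto simp: idx_def)
  have nn: "n - 1 \<noteq> n" "n \<noteq> n - 1"
    using n by auto
  have inv: "(J p \<longrightarrow> J (act n g h p)) \<and> (K p \<longrightarrow> K (act n g h p)) \<and> (L p \<longrightarrow> L (act n g h p))"
    if gh: "invpair n g h" for g h p
  proof (intro conjI impI)
    assume Jp: "J p"
    show "J (act n g h p)"
      unfolding J_def
    proof (intro ballI impI)
      fix y assume y: "y \<in> Defs.vec n" "\<forall>x\<in>Defs.vec n. bil n (fst (act n g h p)) x y = 0"
      have "bil n (fst p) x (mv n h y) = 0" if "x \<in> Defs.vec n" for x
      proof -
        have "mv n h (bil n (fst (act n g h p)) (mv n g x) y) = 0"
          using y by (simp add: mv_zero)
        then show ?thesis
          using that by (simp add: bil_act invpair_cancel[OF gh])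
      qed
      then obtain u v where "u \<in> Defs.vec n" "v \<in> Defs.vec n" "mv n h y = bil n (fst p) u v"
        using Jp unfolding J_def by (meson mv_vec)
      then have "y = bil n (fst (act n g h p)) (mv n g u) (mv n g v)"
        using y(1) by (metis bil_act(1) invpair_cancel[OF gh])
      then show "\<exists>u\<in>Defs.vec n. \<exists>v\<in>Defs.vec n. y = bil n (fst (act n g h p)) u v"
        by (intro bexI[of _ "mv n g u"] bexI[of _ "mv n g v"]) simp_all
    qed
  next
    assume "K p"
    then show "K (act n g h p)"
      by (simp add: K_def bil_act invpair_cancel[OF gh] mv_zero)
  next
    assume "L p"
    then show "L (act n g h p)"
      by (simp add: L_def bil_act mv_zero)
  qed
  have bk: "act n h g (NF n b' c' d') = NF n b c d"
    unfolding eq[symmetric] by (rule act_inverse[OF invpair_sym[OF gh] NF_space[OF n]])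
  have JKL: "J (NF n b c d) = J (NF n b' c' d')" "K (NF n b c d) = K (NF n b' c' d')"
    "L (NF n b c d) = L (NF n b' c' d')"
    using inv[OF gh, of "NF n b c d"] inv[OF invpair_sym[OF gh], of "NF n b' c' d'"] unfolding eq bk by auto
  have prod_n: "bil n (fst (NF n b c d)) u v n = 0" for u v b c d
    by (rule bil_coord_0) (use n in \<open>auto simp: NF_def chainm_def sqn_def\<close>)
  have J: "J (NF n b c d) \<longleftrightarrow> b \<noteq> 0" for b c d
  proof
    assume JN: "J (NF n b c d)"
    show "b \<noteq> 0"
    proof
      assume "b = 0"
      then have "bil n (fst (NF n b c d)) x (ev n) = 0" for x
        by (intro ext) (use n in \<open>auto intro!: bil_coord_0 simp: NF_def chainm_def sqn_def ev_def\<close>)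
      then obtain u v where "ev n = bil n (fst (NF n b c d)) u v"
        using JN ev_vec[OF idx(2)] unfolding J_def by metis
      then show False
        using prod_n[of b c d u v] by (metis ev_def zero_neq_one)
    qed
  next
    assume b: "b \<noteq> 0"
    show "J (NF n b c d)"
      unfolding J_def
    proof (intro ballI impI)
      \<comment> \<open>Testing against e_1 and e_n leaves only a multiple of e_(n-1), which is the
        product e_1 e_(n-2).\<close>
      fix y assume y: "y \<in> Defs.vec n" "\<forall>x\<in>Defs.vec n. bil n (fst (NF n b c d)) x y = 0"
      have y1: "y k = 0" if "1 \<le> k" "k \<le> n - 2" for k
      proof -
        have "0 = bil n (fst (NF n b c d)) (ev 1) y (Suc k)"
          using y(2) ev_vec[OF idx(1)] by simp
        also have "\<dots> = (\<Sum>j\<in>idx n. y j * bil n (fst (NF n b c d)) (ev 1) (ev j) (Suc k))"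
          by (rule bil_expand_right[OF y(1)])
        also have "\<dots> = (\<Sum>j\<in>idx n. if j = k then y k else 0)"
          by (intro sum.cong refl, subst NF_mult[OF n idx(1)], assumption)
             (use n that in \<open>auto simp: Ev_def ev_def idx_def\<close>)
        also have "\<dots> = y k"
          using that n by (auto simp: idx_def)
        finally show ?thesis by simp
      qed
      have yn: "y n = 0"
      proof -
        have "0 = bil n (fst (NF n b c d)) (ev n) y (n - 1)"
          using y(2) ev_vec[OF idx(2)] by simp
        also have "\<dots> = (\<Sum>j\<in>idx n. y j * bil n (fst (NF n b c d)) (ev n) (ev j) (n - 1))"
          by (rule bil_expand_right[OF y(1)])
        also have "\<dots> = (\<Sum>j\<in>idx n. if j = n then y n * b else 0)"
          by (intro sum.cong refl, subst NF_mult[OF n idx(2)], assumption)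
             (use n in \<open>auto simp: ev_def idx_def\<close>)
        also have "\<dots> = y n * b"
          using idx by auto
        finally show ?thesis using b by simp
      qed
      have "y = (\<lambda>k. y (n - 1) * ev (n - 1) k)"
      proof
        fix k
        show "y k = y (n - 1) * ev (n - 1) k"
          using y(1) y1[of k] yn n by (cases "k = n - 1"; cases "k = n"; cases "k \<in> idx n")
            (auto simp: ev_def Defs.vec_def idx_def)
      qed
      moreover have "bil n (fst (NF n b c d)) (ev 1) (ev (n - 2)) = ev (n - 1)"
      proof -
        have "1 + (n - 2) = n - 1"
          using n by simp
        then show ?thesis
          using NF_mult[OF n idx(1,4), of b c d] n by (simp add: Ev_def)
      qed
      ultimately have "y = bil n (fst (NF n b c d)) (ev 1) (\<lambda>k. y (n - 1) * ev (n - 2) k)"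
        by (simp add: bil_scale_right)
      then show "\<exists>u\<in>Defs.vec n. \<exists>v\<in>Defs.vec n. y = bil n (fst (NF n b c d)) u v"
        using ev_vec[OF idx(1)] vec_scale[OF ev_vec[OF idx(4)]] by blast
    qed
  qed
  have l1n: "bil n (snd (NF n b c d)) (ev 1) (ev n) = (\<lambda>k. c * ev (n - 1) k) + (\<lambda>k. d * ev n k)" for b c d
    using NF_bracket[OF n idx(1,2)] by simp
  have L: "L (NF n b c d) \<longleftrightarrow> c = 0 \<and> d = 0" for b c d
  proof
    assume "L (NF n b c d)"
    then have "(\<lambda>k. c * ev (n - 1) k) + (\<lambda>k. d * ev n k) = 0"
      unfolding L_def using l1n ev_vec idx by metis
    from fun_cong[OF this, of "n - 1"] fun_cong[OF this, of n] show "c = 0 \<and> d = 0"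
      using nn by (simp add: ev_def)
  next
    assume "c = 0 \<and> d = 0"
    then show "L (NF n b c d)"
      by (auto simp: L_def NF_def bil_def fun_eq_iff)
  qed
  have K: "K (NF n b c d) \<longleftrightarrow> d = 0" for b c d
  proof
    assume "K (NF n b c d)"
    then have "bil n (snd (NF n b c d)) (ev 1) (bil n (snd (NF n b c d)) (ev 1) (ev n)) = 0"
      using ev_vec idx unfolding K_def by simp
    moreover have "bil n (snd (NF n b c d)) (ev 1) (ev (n - 1)) = 0"
      using NF_bracket[OF n idx(1,3), of b c d] n by simp
    ultimately have "(\<lambda>k. d * ((\<lambda>k. c * ev (n - 1) k) + (\<lambda>k. d * ev n k)) k) = 0"
      unfolding l1n bil_add_right bil_scale_right by (simp add: fun_eq_iff l1n)
    from fun_cong[OF this, of n] show "d = 0"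
      using nn by (simp add: ev_def)
  next
    assume d: "d = 0"
    have y0: "bil n (snd (NF n b c d)) x y k = 0" if "k \<noteq> n - 1" for x y k
      by (rule bil_coord_0) (use that d in \<open>auto simp: NF_def br1n_def\<close>)
    show "K (NF n b c d)"
      unfolding K_def
    proof (intro ballI ext)
      fix x y k
      have "x i * bil n (snd (NF n b c d)) x y j * snd (NF n b c d) i j k = 0" for i j
        using y0[of j x y] n by (cases "j = n - 1") (auto simp: NF_def br1n_def)
      then show "bil n (snd (NF n b c d)) x (bil n (snd (NF n b c d)) x y) k = 0 k"
        by (simp add: bil_coord_0)
    qed
  qed
  show "b = 0 \<longleftrightarrow> b' = 0" "d = 0 \<longleftrightarrow> d' = 0" "c = 0 \<and> d = 0 \<longleftrightarrow> c' = 0 \<and> d' = 0"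
    using JKL J K L by auto
qed

lemma bil_zero_fun: "bil n c (\<lambda>_. 0) y = 0" "bil n c x (\<lambda>_. 0) = 0"
  by (auto simp: bil_def fun_eq_iff)

section \<open>Changes of basis and rescaling of normal forms\<close>

definition colmat :: "nat \<Rightarrow> (nat \<Rightarrow> nat \<Rightarrow> complex) \<Rightarrow> nat \<Rightarrow> nat \<Rightarrow> complex" where
  "colmat n f = (\<lambda>i k. if i \<in> idx n \<and> k \<in> idx n then f k i else 0)"

lemma matn_colmat [simp]: "matn n (colmat n f)"
  by (simp add: matn_def colmat_def)

lemma mv_colmat: "k \<in> idx n \<Longrightarrow> f k \<in> Defs.vec n \<Longrightarrow> mv n (colmat n f) (ev k) = f k"
  using mv_ev[OF matn_colmat, of k n f] by (auto simp: colmat_def Defs.vec_def fun_eq_iff)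

lemma invpairI:
  assumes "matn n g" "matn n h" "\<And>k. k \<in> idx n \<Longrightarrow> mv n g (mv n h (ev k)) = ev k"
    "\<And>k. k \<in> idx n \<Longrightarrow> mv n h (mv n g (ev k)) = ev k"
  shows "invpair n g h"
proof -
  have "mm n g h = idm n" "mm n h g = idm n"
    by (rule mat_eqI[of n]; use assms in \<open>simp add: mv_mm mv_idm ev_vec\<close>)+
  with assms show ?thesis
    by (simp add: invpair_iff)
qed

text \<open>Only half of the multiplication table in the basis \<open>v\<close> is asked for;
  commutativity and antisymmetry supply the rest.\<close>

lemma NF_eqI:
  fixes p :: pstruct and n :: nat
  defines "m \<equiv> bil n (fst p)" and "l \<equiv> bil n (snd p)"
  assumes n: "n > 3" and p: "poisson n p" and gh: "invpair n g h"
    and v: "\<And>k. k \<in> idx n \<Longrightarrow> mv n h (ev k) = v k"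
    and m1: "\<And>i j. 1 \<le> i \<Longrightarrow> i < n \<Longrightarrow> 1 \<le> j \<Longrightarrow> j < n \<Longrightarrow> m (v i) (v j) = (if i + j < n then v (i + j) else 0)"
    and m2: "\<And>i. 1 \<le> i \<Longrightarrow> i < n \<Longrightarrow> m (v i) (v n) = 0"
    and m3: "m (v n) (v n) = (\<lambda>k. b * v (n - 1) k)"
    and l1: "\<And>i j. 1 \<le> i \<Longrightarrow> i < n \<Longrightarrow> 1 \<le> j \<Longrightarrow> j < n \<Longrightarrow> l (v i) (v j) = 0"
    and l2: "l (v 1) (v n) = (\<lambda>k. c * v (n - 1) k) + (\<lambda>k. d * v n k)"
    and l3: "\<And>i. 2 \<le> i \<Longrightarrow> i < n \<Longrightarrow> l (v i) (v n) = 0"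
  shows "act n g h p = NF n b c d"
proof -
  have idx: "1 \<in> idx n" "n \<in> idx n" "n - 1 \<in> idx n"
    using n by (auto simp: idx_def)
  have vv: "v k \<in> Defs.vec n" if "k \<in> idx n" for k
    using v[OF that] mv_vec by metis
  have comm: "m (v i) (v j) = m (v j) (v i)" if "i \<in> idx n" "j \<in> idx n" for i j
    using p vv[OF that(1)] vv[OF that(2)] unfolding poisson_iff m_def by blast
  have anti: "l (v i) (v j) = - l (v j) (v i)" if "i \<in> idx n" "j \<in> idx n" for i j
    unfolding l_def by (rule poisson_antisym[OF p vv[OF that(1)] vv[OF that(2)]])
  have cases: "i \<in> idx n \<longleftrightarrow> (1 \<le> i \<and> i < n) \<or> i = n" for i
    using n by (auto simp: idx_def)
  have two: "1 \<le> i \<Longrightarrow> i \<noteq> 1 \<Longrightarrow> 2 \<le> i" for i :: nat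
    by simp
  show ?thesis
  proof (rule act_eqI[OF gh NF_space[OF n]])
    fix i j assume ij: "i \<in> idx n" "j \<in> idx n"
    have Ev: "mv n h (Ev (n - 1) (i + j)) = (if i + j < n then v (i + j) else 0)"
      using ij n v[of "i + j"] by (auto simp: Ev_def mv_zero idx_def)
    have "m (v i) (v j) = mv n h (bil n (fst (NF n b c d)) (ev i) (ev j))"
      unfolding NF_mult[OF n ij] using ij n m1[of i j] m2[of i] m2[of j] m3 comm[OF ij] Ev v[OF idx(3)]
      by (auto simp: cases mv_scale mv_zero)
    then show "bil n (fst p) (mv n h (ev i)) (mv n h (ev j)) = mv n h (bil n (fst (NF n b c d)) (ev i) (ev j))"
      unfolding m_def v[OF ij(1)] v[OF ij(2)] .
    have vn: "l (v n) (v n) = 0"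
      using p vv[OF idx(2)] unfolding poisson_iff l_def by blast
    have "l (v i) (v j) = mv n h (bil n (snd (NF n b c d)) (ev i) (ev j))"
    proof (cases "i = n")
      case True
      show ?thesis
      proof (cases "j = n")
        case True
        with \<open>i = n\<close> show ?thesis
          unfolding NF_bracket[OF n ij] using vn n by (simp add: mv_zero)
      next
        case False
        then have j: "1 \<le> j" "j < n"
          using ij by (auto simp: cases)
        have "l (v n) (v j) = - l (v j) (v n)"
          by (rule anti[OF idx(2) ij(2)])
        also have "\<dots> = mv n h (bil n (snd (NF n b c d)) (ev n) (ev j))"
          unfolding NF_bracket[OF n idx(2) ij(2)] using j n l2 l3[OF two] v[OF idx(2)] v[OF idx(3)]
          by (auto simp: mv_diff mv_add mv_scale mv_zero mv_diff[of n h 0, simplified, unfolded mv_zero] fun_eq_iff)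
        finally show ?thesis
          using True by simp
      qed
    next
      case False
      then have i: "1 \<le> i" "i < n"
        using ij by (auto simp: cases)
      show ?thesis
        unfolding NF_bracket[OF n ij] using ij i n l1[of i j] l2 l3[OF two, of i] v[OF idx(2)] v[OF idx(3)]
        by (auto simp: cases mv_add mv_scale mv_zero)
    qed
    then show "bil n (snd p) (mv n h (ev i)) (mv n h (ev j)) = mv n h (bil n (snd (NF n b c d)) (ev i) (ev j))"
      unfolding l_def v[OF ij(1)] v[OF ij(2)] .
  qed
qed

text \<open>The new basis consists of a e_1, its powers up to the exponent n - 1, and t e_n + r
  e_(n-1), a vector that e_1 still annihilates. The stated constants are read off the products in
  this basis.\<close>

lemma NF_scale:
  assumes n: "n > 3" and bd: "b * d = 0" and at: "a \<noteq> 0" "t \<noteq> 0"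
  shows "NF n (t\<^sup>2 * b / a ^ (n - 1)) ((t * c - d * r) / a ^ (n - 2)) (a * d) \<in> orbit n (NF n b c d)"
proof -
  define v where "v k = (if k < n then (\<lambda>i. a ^ k * ev k i) else (\<lambda>i. t * ev n i) + (\<lambda>i. r * ev (n - 1) i))" for k
  \<comment> \<open>The coordinates of e_k in the basis \<open>v\<close>; for the last one, e_n =
    (v_n - (r / a^(n-1)) v_(n-1)) / t.\<close>
  define u where "u k = (if k < n then (\<lambda>i. (1 / a ^ k) * ev k i)
     else (\<lambda>i. (1 / t) * ev n i) + (\<lambda>i. (- r / (t * a ^ (n - 1))) * ev (n - 1) i))" for k
  let ?h = "colmat n v" and ?g = "colmat n u"
  have idx: "1 \<in> idx n" "n \<in> idx n" "n - 1 \<in> idx n"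
    using n by (auto simp: idx_def)
  have vv: "v k \<in> Defs.vec n" and uv: "u k \<in> Defs.vec n" if "k \<in> idx n" for k
    by (cases "k < n"; simp only: v_def u_def if_True if_False vec_add vec_scale ev_vec idx that)+
  have hv: "mv n ?h (ev k) = v k" and gu: "mv n ?g (ev k) = u k" if "k \<in> idx n" for k
    using mv_colmat[of k n] vv uv that by auto
  have gh: "invpair n ?g ?h"
  proof (rule invpairI)
    fix k assume k: "k \<in> idx n"
    have kn: "k = n" if "\<not> k < n"
      using that k by (simp add: idx_def)
    have n1: "n - 1 < n"
      using n by simp
    show "mv n ?g (mv n ?h (ev k)) = ev k"
    proof (cases "k < n")
      case True
      then show ?thesis
        unfolding hv[OF k] using at by (simp add: v_def mv_scale gu[OF k] u_def)
    next
      case False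
      have "t * (1 / t * x + - r / (t * a ^ (n - 1)) * y) + r * (1 / a ^ (n - 1) * y) = x" for x y
        using at by (simp add: field_simps)
      then show ?thesis
        unfolding kn[OF False] hv[OF idx(2)] using n1
        by (simp only: v_def u_def mv_add mv_scale gu[OF idx(2)] gu[OF idx(3)] if_True if_False less_irrefl plus_fun_apply fun_eq_iff)
           simp
    qed
    show "mv n ?h (mv n ?g (ev k)) = ev k"
    proof (cases "k < n")
      case True
      then show ?thesis
        unfolding gu[OF k] using at by (simp add: u_def mv_scale[of n ?h "1 / a ^ k", simplified] hv[OF k] v_def)
    next
      case False
      have "1 / t * (t * x + r * y) + - r / (t * a ^ (n - 1)) * (a ^ (n - 1) * y) = x" for x y
        using at by (simp add: field_simps)
      then show ?thesis
        unfolding kn[OF False] gu[OF idx(2)] using n1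
        by (simp only: v_def u_def mv_add mv_scale hv[OF idx(2)] hv[OF idx(3)] if_True if_False less_irrefl plus_fun_apply fun_eq_iff)
           simp
    qed
  qed simp_all
  let ?m = "bil n (fst (NF n b c d))" and ?l = "bil n (snd (NF n b c d))"
  have M: "?m (ev i) (ev j) = (if i < n \<and> j < n then Ev (n - 1) (i + j) else if i = n \<and> j = n then (\<lambda>k. b * ev (n - 1) k) else 0)"
    if "1 \<le> i" "i \<le> n" "1 \<le> j" "j \<le> n" for i j
    using NF_mult[OF n, of i j b c d] that by (simp add: idx_def)
  have L: "?l (ev i) (ev j) = (if i = 1 \<and> j = n then (\<lambda>k. c * ev (n - 1) k) + (\<lambda>k. d * ev n k)
     else if i = n \<and> j = 1 then - ((\<lambda>k. c * ev (n - 1) k) + (\<lambda>k. d * ev n k)) else 0)"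
    if "1 \<le> i" "i \<le> n" "1 \<le> j" "j \<le> n" for i j
    using NF_bracket[OF n, of i j b c d] that by (simp add: idx_def)
  have a1: "a ^ (n - 1) = a * a ^ (n - 2)"
  proof -
    have "n - 1 = Suc (n - 2)"
      using n by simp
    then show ?thesis
      by (simp only: power_Suc)
  qed
  note lin = bil_add_left bil_add_right bil_scale_left bil_scale_right
  have "act n ?g ?h (NF n b c d) = NF n (t\<^sup>2 * b / a ^ (n - 1)) ((t * c - d * r) / a ^ (n - 2)) (a * d)"
  proof (rule NF_eqI[OF n NF_poisson[OF n bd] gh hv])
    show "?m (v i) (v j) = (if i + j < n then v (i + j) else 0)" if "1 \<le> i" "i < n" "1 \<le> j" "j < n" for i j
      using that n M[of i j] by (auto simp: v_def lin Ev_def power_add fun_eq_iff)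
    show "?m (v i) (v n) = 0" if "1 \<le> i" "i < n" for i
      using that n M[of i n] M[of i "n - 1"] by (auto simp: v_def lin Ev_def fun_eq_iff)
    show "?m (v n) (v n) = (\<lambda>k. (t\<^sup>2 * b / a ^ (n - 1)) * v (n - 1) k)"
      using n at M[of n n] M[of n "n - 1"] M[of "n - 1" n] M[of "n - 1" "n - 1"]
      by (auto simp: v_def lin Ev_def fun_eq_iff power2_eq_square)
    show "?l (v i) (v j) = 0" if "1 \<le> i" "i < n" "1 \<le> j" "j < n" for i j
      using that n L[of i j] by (auto simp: v_def lin fun_eq_iff)
    show "?l (v i) (v n) = 0" if "2 \<le> i" "i < n" for i
      using that n L[of i n] L[of i "n - 1"] by (auto simp: v_def lin fun_eq_iff)
    show "?l (v 1) (v n) = (\<lambda>k. ((t * c - d * r) / a ^ (n - 2)) * v (n - 1) k) + (\<lambda>k. a * d * v n k)"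
      using n at L[of 1 n] L[of 1 "n - 1"] a1
      by (auto simp: v_def lin fun_eq_iff field_simps)
  qed
  then show ?thesis
    using orbitI[OF gh, of "NF n b c d"] by simp
qed

subsection \<open>Existence of the normal form\<close>

text \<open>The change of basis replacing e_n by e_n - sum (k < n - 1) a_(k+1) e_k.\<close>
definition Tm :: "nat \<Rightarrow> (nat \<Rightarrow> complex) \<Rightarrow> nat \<Rightarrow> nat \<Rightarrow> complex" where
  "Tm n a = colmat n (\<lambda>k. if k < n then ev k
     else (\<lambda>i. if i = n then 1 else if 1 \<le> i \<and> i \<le> n - 2 then - a (Suc i) else 0))"

lemma matn_Tm [simp]: "matn n (Tm n a)"
  by (simp add: Tm_def)

lemma Tm_mv:
  assumes n: "n > 3" and x: "x \<in> Defs.vec n"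
  shows "mv n (Tm n a) x = (\<lambda>i. if 1 \<le> i \<and> i \<le> n - 2 then x i - x n * a (Suc i) else x i)"
proof
  fix i
  show "mv n (Tm n a) x i = (if 1 \<le> i \<and> i \<le> n - 2 then x i - x n * a (Suc i) else x i)"
  proof (cases "i \<in> idx n")
    case True
    have n_idx: "n \<in> idx n"
      using n by (simp add: idx_def)
    have "mv n (Tm n a) x i = (\<Sum>j\<in>idx n. Tm n a i j * x j)"
      using True by (simp add: mv_def)
    also have "\<dots> = (\<Sum>j\<in>idx n. (if j = i then x i else 0) +
        (if j = n then (if 1 \<le> i \<and> i \<le> n - 2 then - a (Suc i) * x n else 0) else 0))"
      using True by (intro sum.cong) (auto simp: Tm_def colmat_def ev_def idx_def)
    also have "\<dots> = (if 1 \<le> i \<and> i \<le> n - 2 then x i - x n * a (Suc i) else x i)"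
      using True n_idx by (simp add: sum.distrib)
    finally show ?thesis .
  next
    case False
    then show ?thesis
      using x by (auto simp: mv_def Defs.vec_def idx_def)
  qed
qed

lemma Tm_invpair:
  assumes n: "n > 3"
  shows "invpair n (Tm n (\<lambda>k. - a k)) (Tm n a)"
proof (rule invpairI)
  fix k assume k: "k \<in> idx n"
  show "mv n (Tm n (\<lambda>k. - a k)) (mv n (Tm n a) (ev k)) = ev k"
    "mv n (Tm n a) (mv n (Tm n (\<lambda>k. - a k)) (ev k)) = ev k"
    unfolding Tm_mv[OF n mv_vec] unfolding Tm_mv[OF n ev_vec[OF k]] using n by (auto simp: fun_eq_iff)
qed simp_all

text \<open>Everything is read off the kernel of multiplication by e_1, which is spanned by e_(n-1)
  and w: it contains w w by associativity and {e_1, w} by the Leibniz rule applied to e_1 w =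
  0.\<close>

lemma NF_exists:
  fixes s :: pstruct and n :: nat
  defines "m \<equiv> bil n (fst s)" and "l \<equiv> bil n (snd s)"
  defines "a \<equiv> m (ev 1) (ev n)"
  assumes n: "n > 3" and s: "poisson n s" and nil: "nilp n (n - 1) s"
    and chain: "\<And>k. 1 \<le> k \<Longrightarrow> Suc k < n \<Longrightarrow> m (ev 1) (ev k) = ev (Suc k)"
  shows "\<exists>b c d. b * d = 0 \<and> act n (Tm n (\<lambda>k. - a k)) (Tm n a) s = NF n b c d"
proof -
  have idx: "1 \<in> idx n" "n \<in> idx n" "n - 1 \<in> idx n"
    using n by (auto simp: idx_def)
  have ev: "ev k \<in> Defs.vec n" if "1 \<le> k" "k \<le> n" for k
    using that by (intro ev_vec) (auto simp: idx_def)
  have nn: "n \<noteq> n - 1" "n - 1 \<noteq> n"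
    using n by auto
  note [simp] = ev nn
  have mv[simp]: "m x y \<in> Defs.vec n" and lv[simp]: "l x y \<in> Defs.vec n" for x y
    by (simp_all add: m_def l_def)
  have comm: "m x y = m y x" if "x \<in> Defs.vec n" "y \<in> Defs.vec n" for x y
    using s that unfolding poisson_iff m_def by blast
  have assoc: "m (m x y) z = m x (m y z)" if "x \<in> Defs.vec n" "y \<in> Defs.vec n" "z \<in> Defs.vec n" for x y z
    using s that unfolding poisson_iff m_def by blast
  have alt: "l x x = 0" if "x \<in> Defs.vec n" for x
    using s that unfolding poisson_iff l_def by blast
  have anti: "l x y = - l y x" if "x \<in> Defs.vec n" "y \<in> Defs.vec n" for x y
    using poisson_antisym[OF s that] by (simp add: l_def)
  have leib: "l (m x y) z = m (l x z) y + m x (l y z)" if "x \<in> Defs.vec n" "y \<in> Defs.vec n" "z \<in> Defs.vec n" for x y z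
    using s that unfolding poisson_iff m_def l_def by blast
  have nilm: "(m x ^^ (n - 1)) z = 0" if "x \<in> Defs.vec n" "z \<in> Defs.vec n" for x z
    using nil that unfolding nilp_def m_def by blast
  note linm = bil_add_left[of n "fst s", folded m_def] bil_add_right[of n "fst s", folded m_def]
    bil_scale_left[of n "fst s", folded m_def] bil_scale_right[of n "fst s", folded m_def]
    bil_zero_left[of n "fst s", folded m_def] bil_zero_right[of n "fst s", folded m_def]
    bil_zero_fun[of n "fst s", folded m_def]
  note linl = bil_add_left[of n "snd s", folded l_def] bil_add_right[of n "snd s", folded l_def]
    bil_scale_left[of n "snd s", folded l_def] bil_scale_right[of n "snd s", folded l_def]
    bil_zero_left[of n "snd s", folded l_def] bil_zero_right[of n "snd s", folded l_def]
    bil_zero_fun[of n "snd s", folded l_def]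
  define e where "e k = Ev (n - 1) k" for k
  have ek: "e k = ev k" if "1 \<le> k" "k < n" for k
    using that by (simp add: e_def Ev_def)
  have e0: "e k = 0" if "n \<le> k" for k
    using that n by (simp add: e_def Ev_def)
  have evv[simp]: "e k \<in> Defs.vec n" for k
    by (simp add: e_def Ev_vec)
  have pow: "(m (ev 1) ^^ j) (ev 1) = ev (Suc j)" if "Suc j < n" for j
    using that by (induction j) (auto simp: chain One_nat_def[symmetric])
  \<comment> \<open>This product is the n-th power of e_1, which nilpotency kills.\<close>
  have "m (ev 1) (ev (n - 1)) = 0"
  proof -
    have "(m (ev 1) ^^ Suc (n - 2)) (ev 1) = m (ev 1) (ev (Suc (n - 2)))"
      using pow[of "n - 2"] n by simp
    moreover have "Suc (n - 2) = n - 1"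
      using n by simp
    ultimately have "(m (ev 1) ^^ (n - 1)) (ev 1) = m (ev 1) (ev (n - 1))"
      by (simp only:)
    then show ?thesis
      using nilm[of "ev 1" "ev 1"] n by simp
  qed
  then have m1e: "m (ev 1) (e k) = e (Suc k)" if "1 \<le> k" for k
    using that n chain[of k] by (cases "Suc k < n"; cases "Suc k = n") (auto simp: ek e0 linm)
  have mee: "m (e i) (e j) = e (i + j)" if "1 \<le> i" "1 \<le> j" for i j
    using that(1)
  proof (induction i rule: dec_induct)
    case base
    show ?case using m1e[OF that(2)] n by (simp add: ek Suc_eq_plus1_left)
  next
    case (step i)
    have "m (e (Suc i)) (e j) = m (ev 1) (m (e i) (e j))"
      using m1e[OF step(1)] assoc[of "ev 1" "e i" "e j"] n by simp
    then show ?case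
      using step m1e[of "i + j"] by simp
  qed
  \<comment> \<open>Multiplication by e_1 in coordinates: a shift truncated at n - 1, plus the
    contribution \<open>a\<close> of e_n.\<close>
  have L: "m (ev 1) x = (\<lambda>k. (if 2 \<le> k \<and> k < n then x (k - 1) else 0) + x n * a k)" if x: "x \<in> Defs.vec n" for x
  proof
    fix k
    have "m (ev 1) x k = (\<Sum>j\<in>idx n. x j * m (ev 1) (ev j) k)"
      unfolding m_def by (rule bil_expand_right[OF x])
    also have "\<dots> = (\<Sum>j\<in>idx n. (if j = k - 1 then if 2 \<le> k \<and> k < n then x (k - 1) else 0 else 0) + (if j = n then x n * a k else 0))"
    proof (rule sum.cong)
      fix j assume j: "j \<in> idx n"
      show "x j * m (ev 1) (ev j) k = (if j = k - 1 then if 2 \<le> k \<and> k < n then x (k - 1) else 0 else 0) + (if j = n then x n * a k else 0)"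
      proof (cases "j = n")
        case True
        then show ?thesis by (auto simp: a_def)
      next
        case False
        then have "m (ev 1) (ev j) = e (Suc j)"
          using j m1e[of j] by (simp add: idx_def ek)
        then show ?thesis
          using j False by (auto simp: e_def Ev_def ev_def idx_def)
      qed
    qed simp
    also have "\<dots> = (if 2 \<le> k \<and> k < n then x (k - 1) else 0) + x n * a k"
      using idx(2) by (auto simp: sum.distrib idx_def)
    finally show "m (ev 1) x k = (if 2 \<le> k \<and> k < n then x (k - 1) else 0) + x n * a k" .
  qed
  have av: "a \<in> Defs.vec n"
    by (simp add: a_def)
  have Lv: "(m (ev 1) ^^ j) x \<in> Defs.vec n" if "x \<in> Defs.vec n" for j x
    using that by (cases j) auto
  \<comment> \<open>No basis vector other than e_n contributes to the e_n coordinate, so j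
    multiplications by e_1 give a_n^j there.\<close>
  have an: "a n = 0"
  proof -
    have "(m (ev 1) ^^ j) (ev n) n = a n ^ j" for j
    proof (induction j)
      case 0
      show ?case by (simp add: ev_def)
    next
      case (Suc j)
      then show ?case using L[OF Lv[OF ev[of n]], of j] n by simp
    qed
    from this[of "n - 1"] show ?thesis
      using nilm[of "ev 1" "ev n"] n by simp
  qed
  \<comment> \<open>Each further multiplication by e_1 moves the entry a_1 up by one index; after n
    - 2 of them it sits at e_(n-1), where nilpotency forces it to be 0.\<close>
  have a1: "a 1 = 0"
  proof -
    have "(m (ev 1) ^^ j) a n = 0 \<and> (m (ev 1) ^^ j) a (Suc j) = a 1" if "j \<le> n - 2" for j
      using that
    proof (induction j)
      case 0
      show ?case using an by (simp add: One_nat_def)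
    next
      case (Suc j)
      then show ?case using L[OF Lv[OF av], of j] n by simp
    qed
    from this[of "n - 2"] have "(m (ev 1) ^^ (n - 2)) a (n - 1) = a 1"
      using n by (simp add: Suc_diff_Suc numeral_2_eq_2 One_nat_def)
    moreover have "(m (ev 1) ^^ (n - 1)) (ev n) = (m (ev 1) ^^ (n - 2)) a"
    proof -
      have "n - 1 = Suc (n - 2)"
        using n by simp
      then show ?thesis
        by (simp only: funpow_Suc_right comp_apply a_def)
    qed
    ultimately show ?thesis
      using nilm[of "ev 1" "ev n"] n by simp
  qed
  \<comment> \<open>Since e_1 e_k = e_(k+1), subtracting the sum of a_(k+1) e_k over k <= n - 2
    cancels the entries a_2, ..., a_(n-1) of e_1 e_n; the entries a_1 and a_n are already
    zero.\<close>
  define w where "w = mv n (Tm n a) (ev n)"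
  have w: "w = (\<lambda>i. if 1 \<le> i \<and> i \<le> n - 2 then - a (Suc i) else ev n i)"
    unfolding w_def Tm_mv[OF n ev_vec[OF idx(2)]] using n by (auto simp: ev_def fun_eq_iff)
  have wv[simp]: "w \<in> Defs.vec n"
    by (simp add: w_def)
  have wn: "w n = 1" "w (n - 1) = 0"
    using n by (auto simp: w ev_def)
  have m1w: "m (ev 1) w = 0"
    unfolding L[OF wv]
  proof
    fix k
    consider "k = 0" | "k = 1" | "2 \<le> k" "k < n" | "k = n" | "n < k"
      by linarith
    then show "(if 2 \<le> k \<and> k < n then w (k - 1) else 0) + w n * a k = 0 k"
      using an a1 av n wn by cases (auto simp: w Defs.vec_def idx_def)
  qed
  have mew: "m (e k) w = 0" if "1 \<le> k" for k
    using that
  proof (induction k rule: dec_induct)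
    case base
    show ?case using m1w n by (simp add: ek)
  next
    case (step k)
    have "m (e (Suc k)) w = m (m (ev 1) (e k)) w"
      using m1e[OF step(1)] by simp
    also have "\<dots> = m (ev 1) (m (e k) w)"
      using n by (simp add: assoc)
    finally show ?case using step by (simp add: linm)
  qed
  have ker: "z = (\<lambda>k. z (n - 1) * ev (n - 1) k) + (\<lambda>k. z n * w k)" if z: "z \<in> Defs.vec n" "m (ev 1) z = 0" for z
  proof
    fix k
    have eq: "(if 2 \<le> i \<and> i < n then z (i - 1) else 0) + z n * a i = 0" for i
      using fun_cong[OF z(2), of i] unfolding L[OF z(1)] by simp
    consider "k \<notin> idx n" | "1 \<le> k" "k \<le> n - 2" | "k = n - 1" | "k = n"
      using n by (fastforce simp: idx_def)
    then show "z k = ((\<lambda>k. z (n - 1) * ev (n - 1) k) + (\<lambda>k. z n * w k)) k"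
    proof cases
      case 1
      then show ?thesis using z(1) wv n by (auto simp: Defs.vec_def ev_def idx_def)
    next
      case 2
      then have "z k + z n * a (Suc k) = 0"
        using eq[of "Suc k"] n by (auto split: if_splits)
      then have "z k = - (z n * a (Suc k))"
        by (simp add: eq_neg_iff_add_eq_0)
      then show ?thesis
        using 2 n by (auto simp: w ev_def)
    next
      case 3
      then show ?thesis using wn n by (simp add: ev_def)
    next
      case 4
      then show ?thesis using wn n by (auto simp: ev_def)
    qed
  qed
  have "m (ev 1) (m w w) = 0"
    using assoc[of "ev 1" w w] m1w n by (simp add: linm)
  from ker[OF mv this] obtain b b' where ww': "m w w = (\<lambda>k. b * ev (n - 1) k) + (\<lambda>k. b' * w k)"
    by blast
  have mwe: "m w (ev (n - 1)) = 0"
    using mew[of "n - 1"] n comm[of w "ev (n - 1)"] by (simp add: ek)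
  \<comment> \<open>Multiplying w by itself j times leaves the coefficient b'^j at w, because w
    e_(n-1) = 0.\<close>
  have "b' = 0"
  proof -
    have "\<exists>t. (m w ^^ j) w = (\<lambda>k. t * ev (n - 1) k) + (\<lambda>k. b' ^ j * w k)" for j
    proof (induction j)
      case 0
      show ?case by (rule exI[of _ 0]) (simp add: fun_eq_iff)
    next
      case (Suc j)
      then obtain t where t: "(m w ^^ j) w = (\<lambda>k. t * ev (n - 1) k) + (\<lambda>k. b' ^ j * w k)"
        by blast
      have "(m w ^^ Suc j) w = (\<lambda>k. t * m w (ev (n - 1)) k) + (\<lambda>k. b' ^ j * m w w k)"
        by (simp only: funpow.simps comp_apply t linm)
      also have "\<dots> = (\<lambda>k. (b' ^ j * b) * ev (n - 1) k) + (\<lambda>k. b' ^ Suc j * w k)"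
        by (rule ext, simp only: mwe ww' plus_fun_apply zero_fun_apply, simp only: power_Suc2 distrib_left mult.assoc mult_zero_right add_0)
      finally have "(m w ^^ Suc j) w = (\<lambda>k. (b' ^ j * b) * ev (n - 1) k) + (\<lambda>k. b' ^ Suc j * w k)" .
      then show ?case by blast
    qed
    then obtain t where "(m w ^^ (n - 1)) w = (\<lambda>k. t * ev (n - 1) k) + (\<lambda>k. b' ^ (n - 1) * w k)"
      by blast
    from fun_cong[OF this, of n] have "b' ^ (n - 1) = 0"
      using nilm[of w w] wn n by (simp add: ev_def)
    then show ?thesis by simp
  qed
  with ww' have ww: "m w w = (\<lambda>k. b * ev (n - 1) k)"
    by (simp add: fun_eq_iff)
  have "m (l w (ev 1)) (ev 1) = 0"
  proof -
    have "m w (ev 1) = 0"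
      using m1w comm[of w "ev 1"] n by simp
    then show ?thesis
      using leib[of w "ev 1" "ev 1"] alt[of "ev 1"] n by (simp add: linl linm)
  qed
  then have "m (ev 1) (l w (ev 1)) = 0"
    using comm[of "ev 1" "l w (ev 1)"] n by simp
  then have m1l: "m (ev 1) (l (ev 1) w) = 0"
    using anti[of "ev 1" w] n by (simp add: bil_uminus_right[of n "fst s", folded m_def])
  from ker[OF lv m1l] obtain c d where lw: "l (ev 1) w = (\<lambda>k. c * ev (n - 1) k) + (\<lambda>k. d * w k)"
    by blast
  have le1: "l (e k) (ev 1) = 0" if "1 \<le> k" for k
    using that
  proof (induction k rule: dec_induct)
    case base
    show ?case using alt[of "ev 1"] n by (simp add: ek)
  next
    case (step k)
    then show ?case
      using leib[of "ev 1" "e k" "ev 1"] m1e[of k] alt[of "ev 1"] n by (simp add: linm)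
  qed
  have lee: "l (e i) (e j) = 0" if "1 \<le> i" "1 \<le> j" for i j
    using that(1)
  proof (induction i rule: dec_induct)
    case base
    show ?case using anti[of "ev 1" "e j"] le1[OF that(2)] n by (simp add: ek)
  next
    case (step i)
    have "l (ev 1) (e j) = 0"
      using anti[of "ev 1" "e j"] le1[OF that(2)] n by simp
    then show ?case
      using leib[of "ev 1" "e i" "e j"] m1e[of i] step n by (simp add: linm)
  qed
  have mle: "m (l (ev 1) w) (e k) = 0" if "1 \<le> k" for k
  proof -
    have "m (ev (n - 1)) (e k) = 0"
      using mee[of "n - 1" k] that n by (simp add: ek e0)
    moreover have "m w (e k) = 0"
      using mew[OF that] comm[of w "e k"] by simp
    ultimately show ?thesis
      unfolding lw by (simp add: linm fun_eq_iff)
  qed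
  have lew: "l (e k) w = 0" if "2 \<le> k" for k
    using that
  proof (induction k rule: dec_induct)
    case base
    have "e 2 = m (ev 1) (e 1)"
      using m1e[of 1] by (simp add: numeral_2_eq_2 One_nat_def)
    then show ?case
      using leib[of "ev 1" "e 1" w] mle[of 1] m1l n by (simp add: ek)
  next
    case (step k)
    then show ?case
      using leib[of "ev 1" "e k" w] m1e[of k] mle[of k] n by (simp add: linm)
  qed
  \<comment> \<open>The Leibniz rule for {w w, e_1}: the left side is 0, as w w is a multiple of
    e_(n-1), and the right side is -2 b d e_(n-1).\<close>
  have bd: "b * d = 0"
  proof -
    have "l (m w w) (ev 1) = 0"
      unfolding ww using le1[of "n - 1"] n by (simp add: linl ek fun_eq_iff)
    then have "m (l w (ev 1)) w + m w (l w (ev 1)) = 0"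
      using leib[of w w "ev 1"] n by simp
    moreover have "m w (l w (ev 1)) = (\<lambda>k. - (b * d) * ev (n - 1) k)"
    proof -
      have "m w (l (ev 1) w) = (\<lambda>k. c * m w (ev (n - 1)) k) + (\<lambda>k. d * m w w k)"
        unfolding lw by (simp only: linm)
      then have "m w (l (ev 1) w) = (\<lambda>k. (b * d) * ev (n - 1) k)"
        unfolding mwe ww by (simp add: fun_eq_iff)
      moreover have "l w (ev 1) = - l (ev 1) w"
        using n by (intro anti) simp_all
      ultimately show ?thesis
        by (simp add: bil_uminus_right[of n "fst s", folded m_def]) (simp add: fun_eq_iff)
    qed
    moreover have "m (l w (ev 1)) w = m w (l w (ev 1))"
      by (rule comm) simp_all
    ultimately have "(\<lambda>k. - (b * d) * ev (n - 1) k) + (\<lambda>k. - (b * d) * ev (n - 1) k) = 0"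
      by simp
    from fun_cong[OF this, of "n - 1"] show ?thesis
      by (simp add: ev_def)
  qed
  define v where "v k = (if k < n then ev k else w)" for k
  have "act n (Tm n (\<lambda>k. - a k)) (Tm n a) s = NF n b c d"
  proof (rule NF_eqI[OF n s Tm_invpair[OF n], where v = v], fold m_def l_def)
    show "mv n (Tm n a) (ev k) = v k" if "k \<in> idx n" for k
    proof (cases "k = n")
      case True
      then show ?thesis by (simp add: w_def v_def)
    next
      case False
      then show ?thesis
        unfolding Tm_mv[OF n ev_vec[OF that]] using that n by (auto simp: v_def ev_def fun_eq_iff idx_def)
    qed
    show "m (v i) (v j) = (if i + j < n then v (i + j) else 0)" if "1 \<le> i" "i < n" "1 \<le> j" "j < n" for i j
      using that mee[of i j] by (auto simp: v_def ek e0)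
    show "m (v i) (v n) = 0" if "1 \<le> i" "i < n" for i
      using that mew[of i] by (simp add: v_def ek)
    show "m (v n) (v n) = (\<lambda>k. b * v (n - 1) k)"
      using ww n by (simp add: v_def)
    show "l (v i) (v j) = 0" if "1 \<le> i" "i < n" "1 \<le> j" "j < n" for i j
      using that lee[of i j] by (simp add: v_def ek)
    show "l (v 1) (v n) = (\<lambda>k. c * v (n - 1) k) + (\<lambda>k. d * v n k)"
      using lw n by (simp add: v_def)
    show "l (v i) (v n) = 0" if "2 \<le> i" "i < n" for i
      using that lew[of i] by (simp add: v_def ek)
  qed
  with bd show ?thesis
    by blast
qed

section \<open>Charts on the orbits\<close>

text \<open>Setting coordinates outside \<open>I\<close> to zero makes the maps below depend
  polynomially on \<open>I\<close> alone, although their formulas mention fixed indices such as (0,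
  2) that may lie outside \<open>I\<close>.\<close>

definition rs :: "'i set \<Rightarrow> ('i \<Rightarrow> complex) \<Rightarrow> 'i \<Rightarrow> complex" where
  "rs I x = (\<lambda>i. if i \<in> I then x i else 0)"

lemma rs_Pol: "(\<lambda>x. rs I x j) \<in> Pol I"
  by (cases "j \<in> I") (auto simp: rs_def intro: Pol.intros)

definition pw :: "nat \<Rightarrow> sconst \<Rightarrow> nat \<Rightarrow> nat \<Rightarrow> complex" where
  "pw n c k = (bil n c (ev 1) ^^ (k - 1)) (ev 1)"

lemma pw_1 [simp]: "pw n c 1 = ev 1"
  by (simp add: pw_def)

lemma pw_Suc: "1 \<le> k \<Longrightarrow> pw n c (Suc k) = bil n c (ev 1) (pw n c k)"
  by (cases k) (simp_all add: pw_def)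

lemma pw_vec: "n \<ge> 1 \<Longrightarrow> pw n c k \<in> Defs.vec n"
  unfolding pw_def by (cases "k - 1") (auto intro!: ev_vec simp: idx_def)

lemma pw_polyfun:
  assumes "i \<in> idx n"
  shows "(\<lambda>y. pw n (fst y) k i) \<in> polyfun n"
proof -
  have "(\<lambda>y. (bil n (fst y) (ev 1) ^^ j) (ev 1) i) \<in> polyfun n" if "i \<in> idx n" for j i
    using that
    by (induction j arbitrary: i)
       (auto intro!: funalg_bil funalg_polyfun polyfun.intros)
  with assms show ?thesis
    by (simp add: pw_def)
qed

definition B0 :: "nat \<Rightarrow> pstruct \<Rightarrow> nat \<Rightarrow> nat \<Rightarrow> complex" where
  "B0 n y = colmat n (\<lambda>k. if k < n then pw n (fst y) k else ev n)"

text \<open>The coordinates of e_1 e_n in the basis given by the columns of \<open>B0\<close>, that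
  is, the vector \<open>a\<close> of \<open>NF_exists\<close> after passing to this basis.\<close>

definition alpha :: "nat \<Rightarrow> pstruct \<Rightarrow> nat \<Rightarrow> complex" where
  "alpha n y = mv n (minv n (B0 n y)) (bil n (fst y) (ev 1) (ev n))"

text \<open>The structure constants of y in the basis e_1, ..., e_1^(n-1), w, where w is e_n corrected by powers
  of e_1 so that e_1 w = 0.\<close>
definition st :: "nat \<Rightarrow> pstruct \<Rightarrow> pstruct" where
  "st n y = act n (mm n (Tm n (\<lambda>k. - alpha n y k)) (minv n (B0 n y))) (mm n (B0 n y) (Tm n (alpha n y))) y"

lemma B0_cols:
  assumes "n > 3"
  shows "\<And>k. 1 \<le> k \<Longrightarrow> k < n \<Longrightarrow> mv n (B0 n y) (ev k) = pw n (fst y) k" "mv n (B0 n y) (ev n) = ev n"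
    "mv n (B0 n y) (ev 1) = ev 1"
proof -
  let ?f = "\<lambda>k. if k < n then pw n (fst y) k else ev n"
  have idx: "1 \<in> idx n" "n \<in> idx n"
    using assms by (auto simp: idx_def)
  show "mv n (B0 n y) (ev k) = pw n (fst y) k" if "1 \<le> k" "k < n" for k
    using mv_colmat[of k n ?f] that assms by (simp add: B0_def idx_def pw_vec)
  from this[of 1] show "mv n (B0 n y) (ev 1) = ev 1"
    using assms by simp
  show "mv n (B0 n y) (ev n) = ev n"
    using mv_colmat[OF idx(2), of ?f] ev_vec[OF idx(2)] by (simp add: B0_def)
qed

text \<open>In the basis \<open>B0\<close> the powers of e_1 are basis vectors, so
  \<open>NF_exists\<close> applies; the two changes of basis compose to the one in
  \<open>st\<close>.\<close>

lemma st_NF: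
  assumes n: "n > 3" and y: "poisson n y" "nilp n (n - 1) y" and D: "mdet n (B0 n y) \<noteq> 0"
  shows "\<exists>b c d. b * d = 0 \<and> st n y = NF n b c d"
proof -
  let ?G = "minv n (B0 n y)"
  have BG: "invpair n (B0 n y) ?G"
    by (rule invpair_minv[OF _ D]) (simp add: B0_def)
  note GB = invpair_sym[OF BG]
  define s where "s = act n ?G (B0 n y) y"
  have sc: "bil n (fst s) (ev 1) (ev k) = ev (Suc k)" if "1 \<le> k" "Suc k < n" for k
  proof -
    have "bil n (fst s) (ev 1) (ev k) = mv n ?G (pw n (fst y) (Suc k))"
      using that n by (simp add: s_def bil_act B0_cols pw_Suc)
    also have "\<dots> = mv n ?G (mv n (B0 n y) (ev (Suc k)))"
      using that n B0_cols(1)[OF n, of "Suc k" y] by simp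
    also have "\<dots> = ev (Suc k)"
      by (rule invpair_cancel(1)[OF GB ev_vec]) (use that n in \<open>simp add: idx_def\<close>)
    finally show ?thesis .
  qed
  have "alpha n y = bil n (fst s) (ev 1) (ev n)"
    using n by (simp add: alpha_def s_def bil_act B0_cols)
  moreover have "\<exists>b c d. b * d = 0 \<and>
      act n (Tm n (\<lambda>k. - bil n (fst s) (ev 1) (ev n) k)) (Tm n (bil n (fst s) (ev 1) (ev n))) s = NF n b c d"
    by (rule NF_exists[OF n _ _ sc]) (simp_all add: s_def poisson_act[OF y(1) GB] nilp_act[OF y(2) GB])
  ultimately show ?thesis
    by (simp add: st_def act_act s_def)
qed

text \<open>This is why just n - 2 coefficients of e_1 e_n become coordinates.\<close>

lemma Tm_cong: "(\<And>i. 2 \<le> i \<Longrightarrow> i < n \<Longrightarrow> a i = a' i) \<Longrightarrow> Tm n a = Tm n a'"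
  by (auto simp: Tm_def colmat_def fun_eq_iff)

text \<open>Column k < n holds a power of e_1, column n the coefficients of e_1 e_n, and row 0,
  which lies outside the index range, the parameters b, c, d. Since n > 3, the three places (0, 0),
  (0, 1), (0, 2) avoid column n.\<close>

definition coords :: "nat \<Rightarrow> pstruct \<Rightarrow> nat \<times> nat \<Rightarrow> complex" where
  "coords n y = (\<lambda>(i, k). if k = n then alpha n y i
     else if i \<in> idx n then pw n (fst y) k i
     else if k = 0 then fst (st n y) n n (n - 1)
     else if k = 1 then snd (st n y) 1 n (n - 1)
     else snd (st n y) 1 n n)"

definition Bx :: "nat \<Rightarrow> (nat \<times> nat \<Rightarrow> complex) \<Rightarrow> nat \<Rightarrow> nat \<Rightarrow> complex" where
  "Bx n x = colmat n (\<lambda>k. if k = 1 then ev 1 else if k < n then (\<lambda>i. if i \<in> idx n then x (i, k) else 0) else ev n)"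

text \<open>The inverse of \<open>coords\<close>: the normal form is transported back along the
  change of basis that \<open>st\<close> performs, now built from the parameters.\<close>

definition Th :: "nat \<Rightarrow> (nat \<times> nat \<Rightarrow> complex) \<Rightarrow> pstruct" where
  "Th n x = act n (mm n (Bx n x) (Tm n (\<lambda>i. x (i, n)))) (mm n (Tm n (\<lambda>i. - x (i, n))) (minv n (Bx n x)))
     (NF n (x (0, 0)) (x (0, 1)) (x (0, 2)))"

text \<open>The entries of e_1^2, ..., e_1^(n-1) and the coefficients of e_1 e_n.\<close>
definition baseI :: "nat \<Rightarrow> (nat \<times> nat) set" where
  "baseI n = idx n \<times> {2..<n} \<union> {2..<n} \<times> {n}"

definition extraI :: "(nat \<times> nat) set" where
  "extraI = {(0, 0), (0, 1), (0, 2)}"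

lemma finite_baseI [simp]: "finite (baseI n)"
  by (simp add: baseI_def)

lemma card_baseI: "n > 3 \<Longrightarrow> card (baseI n) = n\<^sup>2 - n - 2"
proof -
  assume n: "n > 3"
  have "card (baseI n) = n * (n - 2) + (n - 2)"
    unfolding baseI_def by (subst card_Un_disjoint) (auto simp: idx_def card_cartesian_product)
  also have "\<dots> = n\<^sup>2 - n - 2"
  proof -
    obtain m where "n = 2 + m"
      using le_Suc_ex[of 2 n] n by auto
    then show ?thesis
      by (simp add: power2_eq_square algebra_simps)
  qed
  finally show ?thesis .
qed

lemma baseI_extraI: "baseI n \<inter> extraI = {}"
  by (auto simp: baseI_def extraI_def idx_def)

lemma Bx_cols:
  assumes "n > 3"
  shows "mv n (Bx n x) (ev 1) = ev 1" "mv n (Bx n x) (ev n) = ev n"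
    "2 \<le> k \<Longrightarrow> k < n \<Longrightarrow> mv n (Bx n x) (ev k) = (\<lambda>i. if i \<in> idx n then x (i, k) else 0)"
proof -
  let ?f = "\<lambda>k. if k = 1 then ev 1 else if k < n then (\<lambda>i. if i \<in> idx n then x (i, k) else 0) else ev n"
  have idx: "1 \<in> idx n" "n \<in> idx n"
    using assms by (auto simp: idx_def)
  show "mv n (Bx n x) (ev 1) = ev 1"
    using mv_colmat[OF idx(1), of ?f] ev_vec[OF idx(1)] by (simp add: Bx_def)
  show "mv n (Bx n x) (ev n) = ev n"
    using mv_colmat[OF idx(2), of ?f] ev_vec[OF idx(2)] assms by (simp add: Bx_def)
  show "mv n (Bx n x) (ev k) = (\<lambda>i. if i \<in> idx n then x (i, k) else 0)" if "2 \<le> k" "k < n"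
    using mv_colmat[of k n ?f] that by (auto simp: Bx_def Defs.vec_def idx_def)
qed

lemma Th_invpair:
  assumes n: "n > 3" and \<Delta>: "mdet n (Bx n x) \<noteq> 0"
  shows "invpair n (mm n (Bx n x) (Tm n a)) (mm n (Tm n (\<lambda>i. - a i)) (minv n (Bx n x)))"
  by (rule invpair_mm[OF invpair_minv[OF _ \<Delta>] invpair_sym[OF Tm_invpair[OF n]]]) (simp add: Bx_def)

lemma NF_mult_e1:
  assumes n: "n > 3" and z: "z \<in> Defs.vec n"
  shows "bil n (fst (NF n b c d)) (ev 1) z = (\<lambda>k. if 2 \<le> k \<and> k < n then z (k - 1) else 0)"
proof
  fix k
  have 1: "1 \<in> idx n"
    using n by (simp add: idx_def)
  have "bil n (fst (NF n b c d)) (ev 1) z k = (\<Sum>j\<in>idx n. z j * bil n (fst (NF n b c d)) (ev 1) (ev j) k)"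
    by (rule bil_expand_right[OF z])
  also have "\<dots> = (\<Sum>j\<in>idx n. if j = k - 1 then if 2 \<le> k \<and> k < n then z (k - 1) else 0 else 0)"
    by (intro sum.cong refl, subst NF_mult[OF n 1], assumption)
       (use n in \<open>auto simp: Ev_def ev_def idx_def\<close>)
  also have "\<dots> = (if 2 \<le> k \<and> k < n then z (k - 1) else 0)"
    by (auto simp: idx_def)
  finally show "bil n (fst (NF n b c d)) (ev 1) z k = (if 2 \<le> k \<and> k < n then z (k - 1) else 0)" .
qed

text \<open>\<open>h\<close> is an isomorphism from the normal form onto \<open>Th n x\<close> that
  fixes e_1. It therefore carries e_k to the k-th power of e_1 in \<open>Th n x\<close>, and this
  image is the column prescribed by the parameters.\<close>

lemma Th_recover:
  assumes n: "n > 3" and \<Delta>: "mdet n (Bx n x) \<noteq> 0"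
  shows "B0 n (Th n x) = Bx n x"
    and "2 \<le> i \<Longrightarrow> i < n \<Longrightarrow> alpha n (Th n x) i = x (i, n)"
    and "st n (Th n x) = NF n (x (0, 0)) (x (0, 1)) (x (0, 2))"
    and "1 \<le> k \<Longrightarrow> k < n \<Longrightarrow> pw n (fst (Th n x)) k = mv n (Bx n x) (ev k)"
proof -
  define a where "a = (\<lambda>i. x (i, n))"
  define h where "h = mm n (Bx n x) (Tm n a)"
  define g where "g = mm n (Tm n (\<lambda>i. - a i)) (minv n (Bx n x))"
  define N where "N = NF n (x (0, 0)) (x (0, 1)) (x (0, 2))"
  let ?y = "Th n x"
  have y: "?y = act n h g N"
    by (simp add: Th_def h_def g_def N_def a_def)
  have hg: "invpair n h g"
    unfolding h_def g_def by (rule Th_invpair[OF n \<Delta>])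
  have idx: "1 \<in> idx n" "n \<in> idx n"
    using n by (auto simp: idx_def)
  have mult: "bil n (fst ?y) (mv n h u) (mv n h v) = mv n h (bil n (fst N) u v)"
    if "u \<in> Defs.vec n" "v \<in> Defs.vec n" for u v
    using that unfolding y by (simp add: bil_act invpair_cancel[OF hg])
  have hk: "mv n h (ev k) = mv n (Bx n x) (ev k)" if "1 \<le> k" "k < n" for k
  proof -
    have "k \<in> idx n"
      using that by (simp add: idx_def)
    then have "mv n (Tm n a) (ev k) = ev k"
      unfolding Tm_mv[OF n ev_vec[OF \<open>k \<in> idx n\<close>]] using that by (auto simp: ev_def fun_eq_iff)
    then show ?thesis
      by (simp add: h_def mv_mm)
  qed
  have h1: "mv n h (ev 1) = ev 1"
    using hk[of 1] n Bx_cols(1)[OF n] by simp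
  have pw: "pw n (fst ?y) k = mv n h (ev k)" if "1 \<le> k" "k < n" for k
    using that
  proof (induction k rule: dec_induct)
    case base
    show ?case using h1 by simp
  next
    case (step k)
    have kidx: "k \<in> idx n"
      using step by (simp add: idx_def)
    have "pw n (fst ?y) (Suc k) = bil n (fst ?y) (mv n h (ev 1)) (mv n h (ev k))"
      using step h1 by (simp add: pw_Suc)
    also have "\<dots> = mv n h (bil n (fst N) (ev 1) (ev k))"
      by (rule mult[OF ev_vec[OF idx(1)] ev_vec[OF kidx]])
    also have "bil n (fst N) (ev 1) (ev k) = ev (Suc k)"
      unfolding N_def NF_mult[OF n idx(1) kidx] using step n by (simp add: Ev_def Suc_eq_plus1_left)
    finally show ?case .
  qed
  then show pwB: "1 \<le> k \<Longrightarrow> k < n \<Longrightarrow> pw n (fst ?y) k = mv n (Bx n x) (ev k)" for k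
    using hk by simp
  show B0: "B0 n ?y = Bx n x"
  proof (rule mat_eqI[of n])
    fix k assume "k \<in> idx n"
    then show "mv n (B0 n ?y) (ev k) = mv n (Bx n x) (ev k)"
      using B0_cols(1)[OF n, of k ?y] B0_cols(2)[OF n, of ?y] Bx_cols(2)[OF n, of x] pwB[of k] by (cases "k = n") (auto simp: idx_def)
  qed (simp_all add: B0_def Bx_def)
  define u where "u = (\<lambda>k. if 2 \<le> k \<and> k < n then a k else 0)"
  have uv: "u \<in> Defs.vec n"
    by (auto simp: u_def Defs.vec_def idx_def)
  have "alpha n ?y = u"
  proof -
    \<comment> \<open>\<open>z\<close> is the preimage of e_n under \<open>h\<close>; in the normal
      form e_1 kills e_n and shifts the entries a_(k+1) of \<open>z\<close> from index k to k +
      1.\<close>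
    define z where "z = mv n (Tm n (\<lambda>i. - a i)) (ev n)"
    have zv: "z \<in> Defs.vec n"
      by (simp add: z_def)
    have "mv n h z = mv n (Bx n x) (ev n)"
      unfolding h_def z_def mv_mm
      using invpair_cancel(2)[OF Tm_invpair[OF n, of a] ev_vec[OF idx(2)]] by simp
    then have "bil n (fst ?y) (ev 1) (ev n) = bil n (fst ?y) (mv n h (ev 1)) (mv n h z)"
      using h1 Bx_cols(2)[OF n] by simp
    also have "\<dots> = mv n h (bil n (fst N) (ev 1) z)"
      by (rule mult[OF ev_vec[OF idx(1)] zv])
    also have "bil n (fst N) (ev 1) z = u"
      unfolding N_def NF_mult_e1[OF n zv] unfolding z_def Tm_mv[OF n ev_vec[OF idx(2)]]
      using n by (auto simp: u_def ev_def fun_eq_iff)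
    also have "mv n h u = mv n (Bx n x) (mv n (Tm n a) u)"
      by (simp add: h_def mv_mm)
    also have "mv n (Tm n a) u = u"
      unfolding Tm_mv[OF n uv] by (auto simp: u_def fun_eq_iff)
    finally show ?thesis
      using invpair_cancel(2)[OF invpair_minv[OF _ \<Delta>] uv] by (simp add: alpha_def B0 Bx_def)
  qed
  then show "2 \<le> i \<Longrightarrow> i < n \<Longrightarrow> alpha n ?y i = x (i, n)" for i
    by (simp add: u_def a_def)
  have T: "Tm n (alpha n ?y) = Tm n a" "Tm n (\<lambda>k. - alpha n ?y k) = Tm n (\<lambda>i. - a i)"
    by (rule Tm_cong; simp add: \<open>alpha n ?y = u\<close> u_def)+
  show "st n ?y = NF n (x (0, 0)) (x (0, 1)) (x (0, 2))"
    unfolding st_def B0 T unfolding g_def[symmetric] h_def[symmetric] y N_def[symmetric]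
    by (rule act_inverse[OF invpair_sym[OF hg]]) (simp add: N_def NF_space[OF n])
qed

lemma coords_recover:
  assumes n: "n > 3" and y: "y \<in> space n" and D: "mdet n (B0 n y) \<noteq> 0" and st: "st n y = NF n b c d"
    and x: "\<And>j. j \<in> baseI n \<union> extraI \<Longrightarrow> x j = coords n y j"
  shows "Bx n x = B0 n y" "Th n x = y" "x (0, 0) = b" "x (0, 1) = c" "x (0, 2) = d"
proof -
  have xpw: "x (i, k) = pw n (fst y) k i" if "i \<in> idx n" "2 \<le> k" "k < n" for i k
    using that x[of "(i, k)"] by (simp add: baseI_def coords_def)
  have xal: "x (i, n) = alpha n y i" if "2 \<le> i" "i < n" for i
    using that x[of "(i, n)"] by (simp add: baseI_def coords_def)
  show B: "Bx n x = B0 n y"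
  proof (rule mat_eqI[of n])
    fix k assume k: "k \<in> idx n"
    have "pw n (fst y) k \<in> Defs.vec n"
      using n by (intro pw_vec) simp
    then have pk: "pw n (fst y) k i = 0" if "i \<notin> idx n" for i
      using that by (simp add: Defs.vec_def)
    consider "k = 1" | "2 \<le> k" "k < n" | "k = n"
      using k by (fastforce simp: idx_def)
    then show "mv n (Bx n x) (ev k) = mv n (B0 n y) (ev k)"
    proof cases
      case 1
      then show ?thesis by (simp add: Bx_cols[OF n] B0_cols[OF n])
    next
      case 2
      then show ?thesis
        using B0_cols(1)[OF n, of k y] Bx_cols(3)[OF n 2, of x] xpw pk by (auto simp: fun_eq_iff)
    next
      case 3
      then show ?thesis by (simp add: Bx_cols[OF n] B0_cols[OF n])
    qed
  qed (simp_all add: B0_def Bx_def)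
  have "n - 1 \<noteq> n"
    using n by simp
  show x0: "x (0, 0) = b" and x1: "x (0, 1) = c" and x2: "x (0, 2) = d"
    using n x[of "(0, 0)"] x[of "(0, 1)"] x[of "(0, 2)"] \<open>n - 1 \<noteq> n\<close>
    by (auto simp: extraI_def coords_def idx_def st NF_def chainm_def sqn_def br1n_def)
  have T: "Tm n (\<lambda>i. x (i, n)) = Tm n (alpha n y)" "Tm n (\<lambda>i. - x (i, n)) = Tm n (\<lambda>i. - alpha n y i)"
    by (rule Tm_cong; simp add: xal)+
  have "mdet n (Bx n x) \<noteq> 0"
    using B D by simp
  from Th_invpair[OF n this, of "alpha n y"]
  have "invpair n (mm n (B0 n y) (Tm n (alpha n y))) (mm n (Tm n (\<lambda>i. - alpha n y i)) (minv n (B0 n y)))"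
    unfolding B .
  from act_inverse[OF this y] show "Th n x = y"
    unfolding Th_def T B x0 x1 x2 st[symmetric] st_def[symmetric] .
qed

lemma reg_Tm:
  assumes "funalg R" "\<And>k. 2 \<le> k \<Longrightarrow> k < n \<Longrightarrow> (\<lambda>x. a x k) \<in> R"
  shows "(\<lambda>x. Tm n (a x) i j) \<in> R"
  using assms
  by (cases "i \<in> idx n \<and> j \<in> idx n"; cases "j < n"; cases "i = n"; cases "1 \<le> i \<and> i \<le> n - 2")
     (auto simp: Tm_def colmat_def intro!: funalg_const funalg_uminus)

lemma B0_polyfun: "i \<in> idx n \<Longrightarrow> j \<in> idx n \<Longrightarrow> (\<lambda>y. B0 n y i j) \<in> polyfun n"
  by (cases "j < n") (auto simp: B0_def colmat_def intro: pw_polyfun polyfun.intros)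

lemma D_polyfun: "(\<lambda>y. mdet n (B0 n y)) \<in> polyfun n"
  by (rule funalg_mdet[OF funalg_polyfun B0_polyfun])

lemma coords_reg:
  assumes n: "n > 3"
  defines "R \<equiv> reg (polyfun n) (\<lambda>y. mdet n (B0 n y))"
  assumes j: "j \<in> baseI n \<union> extraI"
  shows "(\<lambda>y. coords n y j) \<in> R"
proof -
  have R: "funalg R"
    unfolding R_def by (rule funalg_reg[OF funalg_polyfun D_polyfun])
  have b: "f \<in> polyfun n \<Longrightarrow> f \<in> R" for f
    unfolding R_def by (rule reg_base)
  have dinv: "(\<lambda>y. 1 / mdet n (B0 n y)) \<in> R"
    unfolding R_def by (rule reg_inverse[OF funalg_polyfun])
  have minv: "(\<lambda>y. minv n (B0 n y) i k) \<in> R" if "i \<in> idx n" "k \<in> idx n" for i k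
    by (rule funalg_minv[OF R _ dinv that]) (intro b B0_polyfun)
  have al: "(\<lambda>y. alpha n y i) \<in> R" for i
  proof (cases "i \<in> idx n")
    case True
    show ?thesis
      unfolding alpha_def
      by (rule funalg_mv[OF R minv _ True]) (auto intro!: b funalg_bil funalg_polyfun polyfun.intros)
  qed (simp add: alpha_def mv_def funalg_const[OF R])
  have "regmap n R (st n)"
    unfolding st_def
  proof (rule regmap_act[OF R])
    show "regmap n R (\<lambda>y. y)"
      using regmap_id[of n] b by (auto simp: regmap_def)
    show "(\<lambda>y. mm n (Tm n (\<lambda>k. - alpha n y k)) (minv n (B0 n y)) i j) \<in> R" if "i \<in> idx n" "j \<in> idx n" for i j
      by (intro funalg_mm[OF R] reg_Tm[OF R] minv funalg_uminus[OF R] al that)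
    show "(\<lambda>y. mm n (B0 n y) (Tm n (alpha n y)) i j) \<in> R" if "i \<in> idx n" "j \<in> idx n" for i j
    proof (rule funalg_mm[OF R _ _ that])
      show "(\<lambda>y. B0 n y i j) \<in> R" if "i \<in> idx n" "j \<in> idx n" for i j
        by (intro b B0_polyfun that)
    qed (intro reg_Tm[OF R] al)
  qed
  then have "(\<lambda>y. fst (st n y) n n (n - 1)) \<in> R" "(\<lambda>y. snd (st n y) 1 n (n - 1)) \<in> R" "(\<lambda>y. snd (st n y) 1 n n) \<in> R"
    using n by (auto simp: regmap_def idx_def)
  moreover have "(\<lambda>y. pw n (fst y) k i) \<in> R" if "i \<in> idx n" for i k
    by (rule b[OF pw_polyfun[OF that]])
  moreover have "0 \<notin> idx n"
    by (simp add: idx_def)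
  ultimately show ?thesis
    using j al n by (auto simp: baseI_def extraI_def coords_def)
qed

text \<open>It lets conditions on b, c, d be stated for subsets of \<open>extraI\<close>; outside
  that set its value carries no meaning.\<close>

definition cf :: "complex \<Rightarrow> complex \<Rightarrow> complex \<Rightarrow> nat \<times> nat \<Rightarrow> complex" where
  "cf b c d = (\<lambda>j. if j = (0, 0) then b else if j = (0, 1) then c else d)"

text \<open>X consists of the parameters among b, c, d that vary in the orbit, Q of those that must not vanish.\<close>
lemma chart_NF:
  assumes n: "n > 3" and bd0: "b0 * d0 = 0" and X: "X \<subseteq> extraI" and Q: "Q \<subseteq> X"
    and H1: "\<And>b c d. (\<And>j. j \<in> extraI - X \<Longrightarrow> cf b c d j = 0) \<Longrightarrow> (\<And>j. j \<in> Q \<Longrightarrow> cf b c d j \<noteq> 0) \<Longrightarrow>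
      NF n b c d \<in> orbit n (NF n b0 c0 d0)"
    and H2: "\<And>b c d. b * d = 0 \<Longrightarrow> NF n b c d \<in> orbit n (NF n b0 c0 d0) \<Longrightarrow>
      (\<forall>j\<in>extraI - X. cf b c d j = 0) \<and> (\<forall>j\<in>Q. cf b c d j \<noteq> 0)"
  defines "I \<equiv> baseI n \<union> X"
  shows "chart n (orbit n (NF n b0 c0 d0)) (\<lambda>y. mdet n (B0 n y)) I
    (\<lambda>x. mdet n (Bx n (rs I x)) * (\<Prod>j\<in>Q. rs I x j)) (\<lambda>x. Th n (rs I x)) (\<lambda>y. rs I (coords n y))"
    (is "chart n ?X ?D I ?\<Delta> ?\<Theta> ?\<psi>")
proof -
  have finE: "finite extraI"
    by (simp add: extraI_def)
  then have finI: "finite I" and finQ: "finite Q"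
    using X Q by (auto simp: I_def intro: finite_subset)
  have sub: "I \<subseteq> baseI n \<union> extraI"
    using X by (auto simp: I_def)
  have QI: "Q \<subseteq> I"
    using Q by (auto simp: I_def)
  have cf: "x j = cf (x (0, 0)) (x (0, 1)) (x (0, 2)) j" if "j \<in> extraI" for x j
    using that by (auto simp: cf_def extraI_def)
  have Bx: "(\<lambda>x. Bx n (rs I x) i j) \<in> Pol I" for i j
    by (cases "i \<in> idx n \<and> j \<in> idx n"; cases "j = 1"; cases "j < n")
       (auto simp: Bx_def colmat_def intro!: Pol_const rs_Pol)
  have \<Delta>: "?\<Delta> \<in> Pol I"
    by (intro funalg_mult funalg_prod funalg_Pol funalg_mdet rs_Pol Bx)
  let ?R = "reg (Pol I) ?\<Delta>"
  have R: "funalg ?R"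
    by (rule funalg_reg[OF funalg_Pol \<Delta>])
  \<comment> \<open>Since \<open>\<Delta>\<close> is the determinant times the product over
    \<open>Q\<close>, the inverse of the determinant is that product divided by
    \<open>\<Delta>\<close>.\<close>
  have dinv: "(\<lambda>x. 1 / mdet n (Bx n (rs I x))) \<in> ?R"
    by (rule regI[where m = 1 and P = "\<lambda>x. \<Prod>j\<in>Q. rs I x j"]) (auto intro!: funalg_prod[OF funalg_Pol] rs_Pol)
  have \<Theta>: "regmap n ?R ?\<Theta>"
    unfolding Th_def
  proof (rule regmap_act[OF R])
    have "(\<lambda>x. a + rs I x j * a') \<in> ?R" "(\<lambda>x. rs I x j * a + rs I x j' * a') \<in> ?R" for a a' j j'
      by (intro funalg_add[OF R] funalg_mult[OF R] funalg_const[OF R] reg_base rs_Pol)+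
    then show "regmap n ?R (\<lambda>x. NF n (rs I x (0, 0)) (rs I x (0, 1)) (rs I x (0, 2)))"
      by (auto simp: regmap_def NF_def)
    show "(\<lambda>x. mm n (Bx n (rs I x)) (Tm n (\<lambda>i. rs I x (i, n))) i j) \<in> ?R" if "i \<in> idx n" "j \<in> idx n" for i j
      by (rule funalg_mm[OF R _ _ that]) (auto intro!: reg_base Bx reg_Tm[OF funalg_Pol] rs_Pol)
    show "(\<lambda>x. mm n (Tm n (\<lambda>i. - rs I x (i, n))) (minv n (Bx n (rs I x))) i j) \<in> ?R" if "i \<in> idx n" "j \<in> idx n" for i j
    proof (rule funalg_mm[OF R _ _ that])
      show "(\<lambda>x. minv n (Bx n (rs I x)) i j) \<in> ?R" if "i \<in> idx n" "j \<in> idx n" for i j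
        by (rule funalg_minv[OF R _ dinv that]) (intro reg_base Bx)
    qed (intro reg_base reg_Tm[OF funalg_Pol] funalg_uminus[OF funalg_Pol] rs_Pol)
  qed
  show ?thesis
  proof
    show "?X \<subseteq> space n"
      by (rule orbit_space)
    show "irreducible_z n ?X"
      by (rule irreducible_orbit[OF NF_space[OF n]])
    show "?D \<in> polyfun n"
      by (rule D_polyfun)
    show "finite I"
      by (rule finI)
    show "?\<Delta> \<in> Pol I"
      by (rule \<Delta>)
    show "regmap n ?R ?\<Theta>"
      by (rule \<Theta>)
    show "(\<lambda>y. rs I (coords n y) i) \<in> reg (polyfun n) ?D" if "i \<in> I" for i
      using coords_reg[OF n, of i] that sub by (auto simp: rs_def)
    show "rs I (coords n y) i = 0" if "i \<notin> I" for y i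
      using that by (simp add: rs_def)
  next
    fix x :: "nat \<times> nat \<Rightarrow> complex"
    assume x: "\<And>i. i \<notin> I \<Longrightarrow> x i = 0" and \<Delta>x: "?\<Delta> x \<noteq> 0"
    have rx: "rs I x = x"
      using x by (auto simp: rs_def)
    have det: "mdet n (Bx n x) \<noteq> 0" and Q0: "\<And>j. j \<in> Q \<Longrightarrow> x j \<noteq> 0"
      using \<Delta>x finQ by (auto simp: rx)
    have "NF n (x (0, 0)) (x (0, 1)) (x (0, 2)) \<in> ?X"
    proof (rule H1)
      show "cf (x (0, 0)) (x (0, 1)) (x (0, 2)) j = 0" if "j \<in> extraI - X" for j
        using that cf[of j x] x[of j] baseI_extraI by (auto simp: I_def)
      show "cf (x (0, 0)) (x (0, 1)) (x (0, 2)) j \<noteq> 0" if "j \<in> Q" for j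
        using that cf[of j x] Q0[of j] Q X by auto
    qed
    moreover have "Th n x \<in> orbit n (NF n (x (0, 0)) (x (0, 1)) (x (0, 2)))"
      unfolding Th_def by (rule orbitI[OF Th_invpair[OF n det]])
    ultimately have "Th n x \<in> ?X"
      by (rule orbit_trans)
    moreover note rec = Th_recover[OF n det]
    have "rs I (coords n (Th n x)) j = x j" for j
    proof (cases "j \<in> I")
      case True
      with sub have "j \<in> baseI n \<union> extraI"
        by auto
      then consider i k where "j = (i, k)" "i \<in> idx n" "2 \<le> k" "k < n" | i where "j = (i, n)" "2 \<le> i" "i < n" | "j \<in> extraI"
        by (auto simp: baseI_def)
      then have "coords n (Th n x) j = x j"
      proof cases
        case 1
        then show ?thesis
          using rec(4)[of k] Bx_cols(3)[OF n, of k x] by (simp add: coords_def)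
      next
        case 2
        then show ?thesis
          using rec(2)[of i] by (simp add: coords_def)
      next
        case 3
        have "n - 1 \<noteq> n"
          using n by simp
        with 3 n show ?thesis
          by (auto simp: extraI_def coords_def idx_def rec(3) NF_def chainm_def sqn_def br1n_def)
      qed
      with True show ?thesis
        by (simp add: rs_def)
    qed (simp add: rs_def x)
    then have "rs I (coords n (Th n x)) = x"
      by (rule ext)
    ultimately show "?\<Theta> x \<in> ?X \<and> ?D (?\<Theta> x) \<noteq> 0 \<and> ?\<psi> (?\<Theta> x) = x"
      using det rec(1) by (simp add: rx)
  next
    fix y assume y: "y \<in> ?X" and Dy: "?D y \<noteq> 0"
    obtain g h where gh: "invpair n g h" "y = act n g h (NF n b0 c0 d0)"
      using y unfolding orbit_def by blast
    obtain b c d where bcd: "b * d = 0" "st n y = NF n b c d"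
      using st_NF[OF n _ _ Dy] poisson_act[OF NF_poisson[OF n bd0] gh(1)] nilp_act[OF NF_nilp[OF n] gh(1)]
      unfolding gh(2) by blast
    have "invpair n (mm n (Tm n (\<lambda>k. - alpha n y k)) (minv n (B0 n y))) (mm n (B0 n y) (Tm n (alpha n y)))"
      by (rule invpair_mm[OF Tm_invpair[OF n] invpair_sym[OF invpair_minv[OF _ Dy]]]) (simp add: B0_def)
    from orbit_trans[OF y orbitI[OF this]] have "NF n b c d \<in> ?X"
      unfolding bcd(2)[symmetric] st_def .
    from H2[OF bcd(1) this] have out: "\<And>j. j \<in> extraI - X \<Longrightarrow> cf b c d j = 0" and inQ: "\<And>j. j \<in> Q \<Longrightarrow> cf b c d j \<noteq> 0"
      by auto
    define x where "x = rs I (coords n y)"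
    have ysp: "y \<in> space n"
      using gh(2) by simp
    have ce: "coords n y j = cf b c d j" if "j \<in> extraI" for j
    proof -
      have "coords n y (0, 0) = b" "coords n y (0, 1) = c" "coords n y (0, 2) = d"
        using coords_recover(3-5)[OF n ysp Dy bcd(2), of "coords n y"] by auto
      then show ?thesis
        using cf[OF that, of "coords n y"] by simp
    qed
    \<comment> \<open>Cutting the coordinates off outside \<open>X\<close> loses nothing, as those
      parameters vanish on this orbit.\<close>
    have xc: "x j = coords n y j" if "j \<in> baseI n \<union> extraI" for j
      using that out[of j] ce[of j] by (auto simp: x_def rs_def I_def)
    note rec = coords_recover[OF n ysp Dy bcd(2) xc]
    have "x j \<noteq> 0" if "j \<in> Q" for j
      using that inQ[of j] xc[of j] ce[of j] Q X by auto
    then have "mdet n (Bx n x) * (\<Prod>j\<in>Q. x j) \<noteq> 0"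
      using rec(1) Dy finQ by auto
    moreover have "rs I x = x"
      by (auto simp: x_def rs_def)
    ultimately show "?\<Theta> (?\<psi> y) = y \<and> ?\<Delta> (?\<psi> y) \<noteq> 0"
      using rec(2) by (simp add: x_def[symmetric])
  next
    \<comment> \<open>The base point has the identity matrix as basis and the value 1 for the free
      parameters, so neither the determinant nor the product over \<open>Q\<close> vanishes.\<close>
    define x :: "nat \<times> nat \<Rightarrow> complex" where "x = rs I (\<lambda>(i, k). if i = k \<or> i = 0 then 1 else 0)"
    have "Bx n x = idm n"
    proof (rule mat_eqI[of n])
      fix k assume k: "k \<in> idx n"
      consider "k = 1" | "2 \<le> k" "k < n" | "k = n"
        using k by (fastforce simp: idx_def)
      then show "mv n (Bx n x) (ev k) = mv n (idm n) (ev k)"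
        unfolding mv_idm[OF ev_vec[OF k]]
      proof cases
        case 2
        then show "mv n (Bx n x) (ev k) = ev k"
          unfolding Bx_cols(3)[OF n 2] using k by (auto simp: x_def rs_def I_def baseI_def ev_def fun_eq_iff idx_def)
      qed (simp_all add: Bx_cols[OF n])
    qed (simp_all add: Bx_def)
    then have "mdet n (Bx n x) \<noteq> 0"
      using invpair_mdet[OF invpair_idm] by simp
    moreover have "x j = 1" if "j \<in> Q" for j
      using that Q X QI by (auto simp: x_def rs_def extraI_def)
    then have "(\<Prod>j\<in>Q. x j) = 1"
      by simp
    moreover have "rs I x = x"
      by (auto simp: x_def rs_def)
    ultimately have "?\<Delta> x \<noteq> 0"
      by simp
    then show "\<exists>x. (\<forall>i. i \<notin> I \<longrightarrow> x i = 0) \<and> ?\<Delta> x \<noteq> 0"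
      by (intro exI[of _ x]) (simp add: x_def rs_def)
  qed
qed

subsection \<open>The algebra generated by one element\<close>

definition CH :: "nat \<Rightarrow> pstruct" where
  "CH n = (chainm n n, \<lambda>i j k. 0)"

lemma alg_struct_CH: "alg_struct n P0 = CH n"
  by (simp add: CH_def)

lemma CH_space: "CH n \<in> space n"
  using csupp_chainm[of n n] by (simp add: space_iff CH_def csupp_def)

lemma CH_bracket: "bil n (snd (CH n)) x y = 0"
  by (auto simp: CH_def bil_def fun_eq_iff)

lemma CH_mult:
  assumes "i \<in> idx n" "j \<in> idx n"
  shows "bil n (fst (CH n)) (ev i) (ev j) = Ev n (i + j)"
proof -
  have "bil n (fst (CH n)) (ev i) (ev j) = fst (CH n) i j"
    using CH_space[of n] by (intro bil_ev assms) (simp add: space_iff)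
  then show ?thesis
    using assms by (auto simp: CH_def chainm_def Ev_def ev_def idx_def fun_eq_iff)
qed

lemma CH_mult_Ev:
  assumes "1 \<le> i" "1 \<le> j"
  shows "bil n (fst (CH n)) (Ev n i) (Ev n j) = Ev n (i + j)"
proof (cases "i \<le> n \<and> j \<le> n")
  case True
  then show ?thesis
    using CH_mult[of i n j] assms by (simp add: Ev_def idx_def)
next
  case False
  then show ?thesis
    using assms by (auto simp: Ev_def bil_zero_left bil_zero_right)
qed

lemma CH_poisson: "poisson n (CH n)"
proof (rule poisson_basisI)
  have E: "ev i = Ev n i" "1 \<le> i" if "i \<in> idx n" for i
    using that by (auto simp: Ev_def idx_def)
  fix i j assume ij: "i \<in> idx n" "j \<in> idx n"
  show "bil n (fst (CH n)) (ev i) (ev j) = bil n (fst (CH n)) (ev j) (ev i)"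
    by (simp add: CH_mult ij add.commute)
  fix k assume k: "k \<in> idx n"
  show "bil n (fst (CH n)) (bil n (fst (CH n)) (ev i) (ev j)) (ev k) =
      bil n (fst (CH n)) (ev i) (bil n (fst (CH n)) (ev j) (ev k))"
    using E[OF ij(1)] E[OF ij(2)] E[OF k] by (simp add: CH_mult_Ev add.assoc)
qed (simp_all add: CH_space CH_bracket bil_zero_left bil_zero_right)

lemma CH_nilp: "nilp n n (CH n)"
  unfolding nilp_def
proof (intro ballI)
  fix x z assume "x \<in> Defs.vec n" and z: "z \<in> Defs.vec n"
  have "\<forall>k. k \<le> j \<longrightarrow> (bil n (fst (CH n)) x ^^ j) z k = 0" for j
  proof (induction j)
    case 0
    show ?case using z by (simp add: Defs.vec_def idx_def)
  next
    case (Suc j)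
    have "bil n (fst (CH n)) x ((bil n (fst (CH n)) x ^^ j) z) k = 0" if "k \<le> Suc j" for k
    proof (rule bil_coord_0)
      fix i i' assume "i \<in> idx n" "i' \<in> idx n"
      then show "x i * (bil n (fst (CH n)) x ^^ j) z i' * fst (CH n) i i' k = 0"
        using that Suc.IH[THEN spec, of i'] by (auto simp: CH_def chainm_def idx_def)
    qed
    then show ?case by simp
  qed
  moreover have "(bil n (fst (CH n)) x ^^ j) z \<in> Defs.vec n" for j
    using z by (cases j) auto
  ultimately have "(bil n (fst (CH n)) x ^^ n) z k = 0" for k
    by (cases "k \<le> n") (auto simp: Defs.vec_def idx_def)
  then show "(bil n (fst (CH n)) x ^^ n) z = 0"
    by (simp add: fun_eq_iff)
qed

definition B1 :: "nat \<Rightarrow> pstruct \<Rightarrow> nat \<Rightarrow> nat \<Rightarrow> complex" where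
  "B1 n y = colmat n (pw n (fst y))"

definition Bx1 :: "nat \<Rightarrow> (nat \<times> nat \<Rightarrow> complex) \<Rightarrow> nat \<Rightarrow> nat \<Rightarrow> complex" where
  "Bx1 n x = colmat n (\<lambda>k. if k = 1 then ev 1 else (\<lambda>i. if i \<in> idx n then x (i, k) else 0))"

lemma B1_cols:
  assumes "n > 3" "k \<in> idx n"
  shows "mv n (B1 n y) (ev k) = pw n (fst y) k"
  using mv_colmat[OF assms(2), of "pw n (fst y)"] assms(1) by (simp add: B1_def pw_vec)

lemma Bx1_cols:
  assumes "n > 3"
  shows "mv n (Bx1 n x) (ev 1) = ev 1"
    and "2 \<le> k \<Longrightarrow> k \<le> n \<Longrightarrow> mv n (Bx1 n x) (ev k) = (\<lambda>i. if i \<in> idx n then x (i, k) else 0)"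
proof -
  let ?f = "\<lambda>k. if k = 1 then ev 1 else (\<lambda>i. if i \<in> idx n then x (i, k) else 0)"
  have idx: "1 \<in> idx n"
    using assms by (auto simp: idx_def)
  show "mv n (Bx1 n x) (ev 1) = ev 1"
    using mv_colmat[OF idx, of ?f] ev_vec[OF idx] by (simp add: Bx1_def)
  show "mv n (Bx1 n x) (ev k) = (\<lambda>i. if i \<in> idx n then x (i, k) else 0)" if "2 \<le> k" "k \<le> n"
    using mv_colmat[of k n ?f] that by (auto simp: Bx1_def Defs.vec_def idx_def)
qed

text \<open>The powers of e_1 up to the n-th form a basis and the next one is zero, so associativity
  alone determines the multiplication table.\<close>

lemma CH_normal_form:
  assumes n: "n > 3" and y: "poisson n y" "nilp n n y" "\<And>u v. bil n (snd y) u v = 0"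
    and D: "mdet n (B1 n y) \<noteq> 0"
  shows "act n (minv n (B1 n y)) (B1 n y) y = CH n"
proof -
  have BG: "invpair n (B1 n y) (minv n (B1 n y))"
    by (rule invpair_minv[OF _ D]) (simp add: B1_def)
  note GB = invpair_sym[OF BG]
  have vn: "pw n (fst y) k \<in> Defs.vec n" for k
    using n by (intro pw_vec) simp
  have pw0: "pw n (fst y) k = 0" if "n < k" for k
  proof -
    have "(bil n (fst y) (ev 1) ^^ n) (ev 1) = 0"
      using y(2) n unfolding nilp_def by (simp add: ev_vec idx_def)
    then have 0: "pw n (fst y) (Suc n) = 0"
      by (simp add: pw_def)
    from that have "Suc n \<le> k"
      by simp
    then show ?thesis
      by (induction k rule: dec_induct) (auto simp: 0 pw_Suc bil_zero_right bil_zero_fun)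
  qed
  have e1: "ev 1 \<in> Defs.vec n"
    using n by (intro ev_vec) (simp add: idx_def)
  have pp: "bil n (fst y) (pw n (fst y) i) (pw n (fst y) j) = pw n (fst y) (i + j)" if "1 \<le> i" "1 \<le> j" for i j
    using that(1)
  proof (induction i rule: dec_induct)
    case base
    show ?case using that(2) by (simp add: pw_Suc[symmetric] Suc_eq_plus1_left)
  next
    case (step i)
    have "bil n (fst y) (bil n (fst y) (ev 1) (pw n (fst y) i)) (pw n (fst y) j) =
        bil n (fst y) (ev 1) (bil n (fst y) (pw n (fst y) i) (pw n (fst y) j))"
      using y(1) vn[of i] vn[of j] e1 unfolding poisson_iff by blast
    then show ?case
      using step that(2) by (simp add: pw_Suc)
  qed
  show ?thesis
  proof (rule act_eqI[OF GB CH_space])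
    fix i j assume ij: "i \<in> idx n" "j \<in> idx n"
    then show "bil n (fst y) (mv n (B1 n y) (ev i)) (mv n (B1 n y) (ev j)) =
        mv n (B1 n y) (bil n (fst (CH n)) (ev i) (ev j))"
      using pp[of i j] pw0[of "i + j"] B1_cols[OF n, of "i + j" y]
      by (auto simp: B1_cols[OF n] CH_mult Ev_def mv_zero idx_def)
    show "bil n (snd y) (mv n (B1 n y) (ev i)) (mv n (B1 n y) (ev j)) =
        mv n (B1 n y) (bil n (snd (CH n)) (ev i) (ev j))"
      by (simp add: y(3) CH_bracket mv_zero)
  qed
qed

lemma chart_CH:
  assumes n: "n > 3"
  defines "I \<equiv> idx n \<times> {2..n}"
  shows "chart n (orbit n (CH n)) (\<lambda>y. mdet n (B1 n y)) I (\<lambda>x. mdet n (Bx1 n (rs I x)))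
    (\<lambda>x. act n (Bx1 n (rs I x)) (minv n (Bx1 n (rs I x))) (CH n)) (\<lambda>y. rs I (\<lambda>(i, k). pw n (fst y) k i))"
    (is "chart n ?X ?D I ?\<Delta> ?\<Theta> ?\<psi>")
proof -
  have Bx: "(\<lambda>x. Bx1 n (rs I x) i j) \<in> Pol I" for i j
    by (cases "i \<in> idx n \<and> j \<in> idx n"; cases "j = 1")
       (auto simp: Bx1_def colmat_def intro!: Pol_const rs_Pol)
  have \<Delta>: "?\<Delta> \<in> Pol I"
    by (intro funalg_Pol funalg_mdet Bx)
  let ?R = "reg (Pol I) ?\<Delta>"
  have R: "funalg ?R"
    by (rule funalg_reg[OF funalg_Pol \<Delta>])
  have pws: "(\<lambda>y. pw n (fst y) k i) \<in> polyfun n" if "i \<in> idx n" for i k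
    by (rule pw_polyfun[OF that])
  have matB: "matn n (Bx1 n x)" for x
    by (simp add: Bx1_def)
  have BxB1: "Bx1 n x = B1 n y" if "\<And>i k. i \<in> idx n \<Longrightarrow> 2 \<le> k \<Longrightarrow> k \<le> n \<Longrightarrow> x (i, k) = pw n (fst y) k i" for x y
  proof (rule mat_eqI[of n])
    fix k assume k: "k \<in> idx n"
    have "pw n (fst y) k i = 0" if "i \<notin> idx n" for i
      using pw_vec[of n "fst y" k] n that by (simp add: Defs.vec_def)
    moreover have "k = 1 \<or> 2 \<le> k \<and> k \<le> n"
      using k by (auto simp: idx_def)
    ultimately show "mv n (Bx1 n x) (ev k) = mv n (B1 n y) (ev k)"
      using Bx1_cols(1)[OF n, of x] Bx1_cols(2)[OF n, of k x] that[of _ k]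
      by (auto simp: B1_cols[OF n k] fun_eq_iff)
  qed (simp_all add: B1_def Bx1_def)
  show ?thesis
  proof
    show "?X \<subseteq> space n"
      by (rule orbit_space)
    show "irreducible_z n ?X"
      by (rule irreducible_orbit[OF CH_space])
    show "?D \<in> polyfun n"
      by (rule funalg_mdet[OF funalg_polyfun]) (simp add: B1_def colmat_def pws)
    show "finite I"
      by (simp add: I_def)
    show "?\<Delta> \<in> Pol I"
      by (rule \<Delta>)
    show "regmap n ?R ?\<Theta>"
    proof (rule regmap_act[OF R])
      show "regmap n ?R (\<lambda>x. CH n)"
        by (auto simp: regmap_def intro: funalg_const[OF R])
      show "(\<lambda>x. minv n (Bx1 n (rs I x)) i j) \<in> ?R" if "i \<in> idx n" "j \<in> idx n" for i j
        by (rule funalg_minv[OF R _ reg_inverse[OF funalg_Pol] that]) (intro reg_base Bx)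
    qed (intro reg_base Bx)
    show "(\<lambda>y. rs I (\<lambda>(i, k). pw n (fst y) k i) j) \<in> reg (polyfun n) ?D" if "j \<in> I" for j
      using that by (auto simp: rs_def I_def intro!: reg_base pws)
    show "rs I (\<lambda>(i, k). pw n (fst y) k i) j = 0" if "j \<notin> I" for y j
      using that by (simp add: rs_def)
  next
    fix x :: "nat \<times> nat \<Rightarrow> complex"
    assume x: "\<And>i. i \<notin> I \<Longrightarrow> x i = 0" and \<Delta>x: "?\<Delta> x \<noteq> 0"
    have rx: "rs I x = x"
      using x by (auto simp: rs_def)
    have BG: "invpair n (Bx1 n x) (minv n (Bx1 n x))"
      using \<Delta>x by (intro invpair_minv matB) (simp add: rx)
    define y where "y = act n (Bx1 n x) (minv n (Bx1 n x)) (CH n)"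
    have mult: "bil n (fst y) (mv n (Bx1 n x) u) (mv n (Bx1 n x) v) = mv n (Bx1 n x) (bil n (fst (CH n)) u v)"
      if "u \<in> Defs.vec n" "v \<in> Defs.vec n" for u v
      using that unfolding y_def by (simp add: bil_act invpair_cancel[OF BG])
    have 1: "1 \<in> idx n"
      using n by (simp add: idx_def)
    have pw: "pw n (fst y) k = mv n (Bx1 n x) (ev k)" if "1 \<le> k" "k \<le> n" for k
      using that
    proof (induction k rule: dec_induct)
      case base
      show ?case using Bx1_cols(1)[OF n] by simp
    next
      case (step k)
      then have k: "k \<in> idx n"
        by (simp add: idx_def)
      have "pw n (fst y) (Suc k) = bil n (fst y) (mv n (Bx1 n x) (ev 1)) (mv n (Bx1 n x) (ev k))"
        using step Bx1_cols(1)[OF n] by (simp add: pw_Suc)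
      also have "\<dots> = mv n (Bx1 n x) (bil n (fst (CH n)) (ev 1) (ev k))"
        by (rule mult[OF ev_vec[OF 1] ev_vec[OF k]])
      also have "bil n (fst (CH n)) (ev 1) (ev k) = ev (Suc k)"
        unfolding CH_mult[OF 1 k] using step by (simp add: Ev_def Suc_eq_plus1_left)
      finally show ?case .
    qed
    have xpw: "x (i, k) = pw n (fst y) k i" if "i \<in> idx n" "2 \<le> k" "k \<le> n" for i k
      using that pw[of k] Bx1_cols(2)[OF n, of k x] by simp
    have "rs I (\<lambda>(i, k). pw n (fst y) k i) = x"
      using xpw x by (auto simp: rs_def I_def fun_eq_iff)
    moreover have "Bx1 n x = B1 n y"
      by (rule BxB1[OF xpw])
    moreover have "y \<in> ?X"
      unfolding y_def by (rule orbitI[OF BG])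
    ultimately show "?\<Theta> x \<in> ?X \<and> ?D (?\<Theta> x) \<noteq> 0 \<and> ?\<psi> (?\<Theta> x) = x"
      using \<Delta>x unfolding rx y_def[symmetric] by simp
  next
    fix y assume y: "y \<in> ?X" and Dy: "?D y \<noteq> 0"
    obtain g h where gh: "invpair n g h" "y = act n g h (CH n)"
      using y unfolding orbit_def by blast
    have nf: "act n (minv n (B1 n y)) (B1 n y) y = CH n"
    proof (rule CH_normal_form[OF n _ _ _ Dy])
      show "poisson n y" "nilp n n y"
        unfolding gh(2) by (rule poisson_act[OF CH_poisson gh(1)] nilp_act[OF CH_nilp gh(1)])+
      show "bil n (snd y) u v = 0" for u v
        unfolding gh(2) by (simp add: bil_act CH_bracket mv_zero)
    qed
    let ?x = "rs I (\<lambda>(i, k). pw n (fst y) k i)"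
    have "Bx1 n ?x = B1 n y"
      by (rule BxB1) (simp add: rs_def I_def)
    moreover have "rs I ?x = ?x"
      by (auto simp: rs_def)
    moreover have "act n (B1 n y) (minv n (B1 n y)) (CH n) = y"
      unfolding nf[symmetric]
      by (rule act_inverse[OF invpair_minv[OF _ Dy]]) (simp_all add: B1_def gh(2))
    ultimately show "?\<Theta> (?\<psi> y) = y \<and> ?\<Delta> (?\<psi> y) \<noteq> 0"
      using Dy by simp
  next
    define x :: "nat \<times> nat \<Rightarrow> complex" where "x = rs I (\<lambda>(i, k). if i = k then 1 else 0)"
    have "Bx1 n x = idm n"
    proof (rule mat_eqI[of n])
      fix k assume k: "k \<in> idx n"
      then have "k = 1 \<or> 2 \<le> k \<and> k \<le> n"
        by (auto simp: idx_def)
      then show "mv n (Bx1 n x) (ev k) = mv n (idm n) (ev k)"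
        unfolding mv_idm[OF ev_vec[OF k]]
      proof
        assume k2: "2 \<le> k \<and> k \<le> n"
        then show "mv n (Bx1 n x) (ev k) = ev k"
          using Bx1_cols(2)[OF n, of k x] k by (auto simp: x_def rs_def I_def ev_def fun_eq_iff)
      qed (simp add: Bx1_cols[OF n])
    qed (simp_all add: Bx1_def)
    then have "mdet n (Bx1 n x) \<noteq> 0"
      using invpair_mdet[OF invpair_idm] by simp
    moreover have "rs I x = x"
      by (auto simp: x_def rs_def)
    ultimately show "\<exists>x. (\<forall>i. i \<notin> I \<longrightarrow> x i = 0) \<and> ?\<Delta> x \<noteq> 0"
      by (intro exI[of _ x]) (simp add: x_def rs_def)
  qed
qed

lemma tame_CH:
  assumes "n > 3"
  shows "tame n (orbit n (CH n)) (n\<^sup>2 - n)"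
proof -
  have "card (idx n \<times> {2..n}) = n * (n - 1)"
    by (simp add: card_cartesian_product idx_def)
  also have "\<dots> = n\<^sup>2 - n"
    by (simp add: power2_eq_square algebra_simps)
  finally show ?thesis
    using chart.tame[OF chart_CH[OF assms]] by simp
qed

subsection \<open>Dimensions of the orbits\<close>

lemma complex_root_exists:
  assumes "c \<noteq> (0::complex)" "m > 0"
  obtains a where "a ^ m = c" "a \<noteq> 0"
proof -
  have "card {z. z ^ m = c} = m"
    by (rule card_nth_roots[OF assms])
  then obtain a where "a ^ m = c"
    using assms(2) by (metis (mono_tags, lifting) card.empty empty_Collect_eq less_irrefl)
  moreover from this have "a \<noteq> 0"
    using assms by (auto simp: power_0_left)
  ultimately show ?thesis
    by (rule that)
qed

lemma NF_orbit_invariants: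
  assumes n: "n > 3" and "b * d = 0" "b0 * d0 = 0" "NF n b c d \<in> orbit n (NF n b0 c0 d0)"
  shows "b = 0 \<longleftrightarrow> b0 = 0" "d = 0 \<longleftrightarrow> d0 = 0" "c = 0 \<and> d = 0 \<longleftrightarrow> c0 = 0 \<and> d0 = 0"
proof -
  obtain g h where "invpair n g h" "act n g h (NF n b0 c0 d0) = NF n b c d"
    using assms(4) unfolding orbit_def by auto
  from NF_iso_invariants[OF n assms(3,2) this]
  show "b = 0 \<longleftrightarrow> b0 = 0" "d = 0 \<longleftrightarrow> d0 = 0" "c = 0 \<and> d = 0 \<longleftrightarrow> c0 = 0 \<and> d0 = 0"
    by auto
qed

lemmas chart_simps = extraI_def cf_def

abbreviation nf_chart :: "nat \<Rightarrow> pstruct \<Rightarrow> (nat \<times> nat) set \<Rightarrow> (nat \<times> nat) set \<Rightarrow> bool" where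
  "nf_chart n p X Q \<equiv> chart n (orbit n p) (\<lambda>y. mdet n (B0 n y)) (baseI n \<union> X)
    (\<lambda>x. mdet n (Bx n (rs (baseI n \<union> X) x)) * (\<Prod>j\<in>Q. rs (baseI n \<union> X) x j))
    (\<lambda>x. Th n (rs (baseI n \<union> X) x)) (\<lambda>y. rs (baseI n \<union> X) (coords n y))"

lemma chart_P12:
  assumes n: "n > 3"
  shows "nf_chart n (NF n 0 0 1) {(0, 1), (0, 2)} {(0, 2)}"
proof (rule chart_NF[OF n])
  fix b c d
  assume "\<And>j. j \<in> extraI - {(0, 1), (0, 2)} \<Longrightarrow> cf b c d j = 0" "\<And>j. j \<in> {(0, 2)} \<Longrightarrow> cf b c d j \<noteq> 0"
  from this(1)[of "(0, 0)"] this(2)[of "(0, 2)"] have "b = 0" "d \<noteq> 0"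
    by (auto simp: chart_simps)
  \<comment> \<open>Starting from d = 1, rescaling by a = d and the shift r = -c d^(n-2) produce
    every c; this is why c is a free coordinate on this orbit.\<close>
  then show "NF n b c d \<in> orbit n (NF n 0 0 1)"
    using NF_scale[OF n, of 0 1 d 1 0 "- c * d ^ (n - 2)"] by simp
next
  fix b c d assume "b * d = 0" "NF n b c d \<in> orbit n (NF n 0 0 1)"
  with NF_orbit_invariants[OF n this(1) _ this(2)]
  show "(\<forall>j\<in>extraI - {(0, 1), (0, 2)}. cf b c d j = 0) \<and> (\<forall>j\<in>{(0, 2)}. cf b c d j \<noteq> 0)"
    by (auto simp: chart_simps)
qed (auto simp: chart_simps)

lemma chart_P15:
  assumes n: "n > 3"
  shows "nf_chart n (NF n 1 1 0) {(0, 0), (0, 1)} {(0, 0), (0, 1)}"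
proof (rule chart_NF[OF n])
  fix b c d
  assume "\<And>j. j \<in> extraI - {(0, 0), (0, 1)} \<Longrightarrow> cf b c d j = 0" "\<And>j. j \<in> {(0, 0), (0, 1)} \<Longrightarrow> cf b c d j \<noteq> 0"
  from this(1)[of "(0, 2)"] this(2)[of "(0, 0)"] this(2)[of "(0, 1)"] have bcd: "d = 0" "b \<noteq> 0" "c \<noteq> 0"
    by (auto simp: chart_simps)
  \<comment> \<open>The choice t = c a^(n-2) yields the required c, and then the square coefficient
    is c^2 a^(n-3). Solving for a needs a positive exponent, hence n > 3.\<close>
  obtain a where a: "a ^ (n - 3) = b / c\<^sup>2" "a \<noteq> 0"
    using complex_root_exists[of "b / c\<^sup>2" "n - 3"] bcd n by auto
  have "(n - 2) * 2 = (n - 3) + (n - 1)"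
    using n by simp
  then have "a ^ (n - 2) * a ^ (n - 2) = a ^ (n - 3) * a ^ (n - 1)"
    by (metis mult_2_right power_add)
  then have "(c * a ^ (n - 2))\<^sup>2 * 1 / a ^ (n - 1) = b"
    using a bcd by (simp add: power2_eq_square field_simps)
  then show "NF n b c d \<in> orbit n (NF n 1 1 0)"
    using NF_scale[OF n, of 1 0 a "c * a ^ (n - 2)" 1 0] a bcd by simp
next
  fix b c d assume "b * d = 0" "NF n b c d \<in> orbit n (NF n 1 1 0)"
  with NF_orbit_invariants[OF n this(1) _ this(2)]
  show "(\<forall>j\<in>extraI - {(0, 0), (0, 1)}. cf b c d j = 0) \<and> (\<forall>j\<in>{(0, 0), (0, 1)}. cf b c d j \<noteq> 0)"
    by (auto simp: chart_simps)
qed (auto simp: chart_simps)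

lemma chart_P13:
  assumes n: "n > 3"
  shows "nf_chart n (NF n 0 1 0) {(0, 1)} {(0, 1)}"
proof (rule chart_NF[OF n])
  fix b c d
  assume "\<And>j. j \<in> extraI - {(0, 1)} \<Longrightarrow> cf b c d j = 0" "\<And>j. j \<in> {(0, 1)} \<Longrightarrow> cf b c d j \<noteq> 0"
  from this(1)[of "(0, 0)"] this(1)[of "(0, 2)"] this(2)[of "(0, 1)"] have "b = 0" "d = 0" "c \<noteq> 0"
    by (auto simp: chart_simps)
  then show "NF n b c d \<in> orbit n (NF n 0 1 0)"
    using NF_scale[OF n, of 0 0 1 c 1 0] by simp
next
  fix b c d assume "b * d = 0" "NF n b c d \<in> orbit n (NF n 0 1 0)"
  with NF_orbit_invariants[OF n this(1) _ this(2)]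
  show "(\<forall>j\<in>extraI - {(0, 1)}. cf b c d j = 0) \<and> (\<forall>j\<in>{(0, 1)}. cf b c d j \<noteq> 0)"
    by (auto simp: chart_simps)
qed (auto simp: chart_simps)

lemma chart_P14:
  assumes n: "n > 3"
  shows "nf_chart n (NF n 1 0 0) {(0, 0)} {(0, 0)}"
proof (rule chart_NF[OF n])
  fix b c d
  assume "\<And>j. j \<in> extraI - {(0, 0)} \<Longrightarrow> cf b c d j = 0" "\<And>j. j \<in> {(0, 0)} \<Longrightarrow> cf b c d j \<noteq> 0"
  from this(1)[of "(0, 1)"] this(1)[of "(0, 2)"] this(2)[of "(0, 0)"] have "c = 0" "d = 0" "b \<noteq> 0"
    by (auto simp: chart_simps)
  then show "NF n b c d \<in> orbit n (NF n 1 0 0)"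
    using NF_scale[OF n, of 1 0 1 "csqrt b" 0 0] by simp
next
  fix b c d assume "b * d = 0" "NF n b c d \<in> orbit n (NF n 1 0 0)"
  with NF_orbit_invariants[OF n this(1) _ this(2)]
  show "(\<forall>j\<in>extraI - {(0, 0)}. cf b c d j = 0) \<and> (\<forall>j\<in>{(0, 0)}. cf b c d j \<noteq> 0)"
    by (auto simp: chart_simps)
qed (auto simp: chart_simps)

lemma chart_P11:
  assumes n: "n > 3"
  shows "nf_chart n (NF n 0 0 0) {} {}"
proof (rule chart_NF[OF n])
  fix b c d
  assume "\<And>j. j \<in> extraI - {} \<Longrightarrow> cf b c d j = 0"
  from this[of "(0, 0)"] this[of "(0, 1)"] this[of "(0, 2)"] have "b = 0" "c = 0" "d = 0"
    by (auto simp: chart_simps)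
  then show "NF n b c d \<in> orbit n (NF n 0 0 0)"
    using orbit_refl[OF NF_space[OF n]] by simp
next
  fix b c d assume "b * d = 0" "NF n b c d \<in> orbit n (NF n 0 0 0)"
  with NF_orbit_invariants[OF n this(1) _ this(2)]
  show "(\<forall>j\<in>extraI - {}. cf b c d j = 0) \<and> (\<forall>j\<in>{}. cf b c d j \<noteq> 0)"
    by (auto simp: chart_simps)
qed (auto simp: chart_simps)

lemma card_chart:
  assumes n: "n > 3" and X: "X \<subseteq> extraI"
  shows "card (baseI n \<union> X) = n\<^sup>2 - n - 2 + card X"
proof -
  have "finite X"
    using X by (rule finite_subset) (simp add: extraI_def)
  moreover have "baseI n \<inter> X = {}"
    using X baseI_extraI[of n] by blast
  ultimately show ?thesis
    by (simp add: card_Un_disjoint card_baseI[OF n])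
qed

lemma square_minus_ge: "n > 3 \<Longrightarrow> n\<^sup>2 - n \<ge> (2::nat)"
proof -
  assume n: "n > 3"
  have "4 * n \<le> n * n"
    using n by (intro mult_le_mono1) simp
  then show ?thesis
    unfolding power2_eq_square using n by linarith
qed

lemma tame_NF:
  assumes n: "n > 3"
  shows "tame n (orbit n (NF n 0 0 1)) (n\<^sup>2 - n)" "tame n (orbit n (NF n 1 1 0)) (n\<^sup>2 - n)"
    "tame n (orbit n (NF n 0 1 0)) (n\<^sup>2 - n - 1)" "tame n (orbit n (NF n 1 0 0)) (n\<^sup>2 - n - 1)"
    "tame n (orbit n (NF n 0 0 0)) (n\<^sup>2 - n - 2)"
proof -
  have eq: "n\<^sup>2 - n - 2 + 2 = n\<^sup>2 - n" "n\<^sup>2 - n - 2 + 1 = n\<^sup>2 - n - 1"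
    using square_minus_ge[OF n] by auto
  have card: "card (baseI n \<union> {(0, 1), (0, 2)}) = n\<^sup>2 - n" "card (baseI n \<union> {(0, 0), (0, 1)}) = n\<^sup>2 - n"
    "card (baseI n \<union> {(0, 1)}) = n\<^sup>2 - n - 1" "card (baseI n \<union> {(0, 0)}) = n\<^sup>2 - n - 1"
    by (subst card_chart[OF n]; use eq in \<open>simp add: extraI_def\<close>)+
  show "tame n (orbit n (NF n 0 0 1)) (n\<^sup>2 - n)"
    using chart.tame[OF chart_P12[OF n]] unfolding card(1) .
  show "tame n (orbit n (NF n 1 1 0)) (n\<^sup>2 - n)"
    using chart.tame[OF chart_P15[OF n]] unfolding card(2) .
  show "tame n (orbit n (NF n 0 1 0)) (n\<^sup>2 - n - 1)"
    using chart.tame[OF chart_P13[OF n]] unfolding card(3) .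
  show "tame n (orbit n (NF n 1 0 0)) (n\<^sup>2 - n - 1)"
    using chart.tame[OF chart_P14[OF n]] unfolding card(4) .
  show "tame n (orbit n (NF n 0 0 0)) (n\<^sup>2 - n - 2)"
    using chart.tame[OF chart_P11[OF n]] by (simp add: card_baseI[OF n])
qed

section \<open>Degenerations\<close>

lemma degen_vanish:
  assumes "degen n p q" "q \<in> space n" "f \<in> polyfun n" "\<And>y. y \<in> orbit n p \<Longrightarrow> f y = 0"
  shows "f q = 0"
  using assms degen_iff[OF assms(2)] in_zclosure_iff[OF orbit_space[of n p], of q] by auto

text \<open>Every normal form lies in the domain of the rational coordinates and has its own b, c, d
  as their values, so these can be evaluated at the target of a degeneration.\<close>

lemma NF_coords:
  assumes n: "n > 3"
  shows "mdet n (B0 n (NF n b c d)) \<noteq> 0" and "st n (NF n b c d) = NF n b c d"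
proof -
  let ?y = "NF n b c d"
  have idx: "1 \<in> idx n" "n \<in> idx n"
    using n by (auto simp: idx_def)
  have pw: "pw n (fst ?y) k = ev k" if "1 \<le> k" "k < n" for k
    using that
  proof (induction k rule: dec_induct)
    case (step k)
    then have k: "k \<in> idx n"
      by (simp add: idx_def)
    have "pw n (fst ?y) (Suc k) = bil n (fst ?y) (ev 1) (ev k)"
      using step by (simp add: pw_Suc)
    also have "\<dots> = ev (Suc k)"
      unfolding NF_mult[OF n idx(1) k] using step by (simp add: Ev_def Suc_eq_plus1_left)
    finally show ?case .
  qed simp
  have B: "B0 n ?y = idm n"
  proof (rule mat_eqI[of n])
    fix k assume k: "k \<in> idx n"
    then show "mv n (B0 n ?y) (ev k) = mv n (idm n) (ev k)"
      using B0_cols(1)[OF n, of k ?y] B0_cols(2)[OF n, of ?y] pw[of k]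
      by (cases "k = n") (auto simp: mv_idm ev_vec idx_def)
  qed (simp_all add: B0_def)
  then show D: "mdet n (B0 n ?y) \<noteq> 0"
    using invpair_mdet[OF invpair_idm] by simp
  have minv: "minv n (idm n) = idm n"
    using invpair_unique[OF invpair_minv invpair_idm] invpair_mdet[OF invpair_idm] by simp
  have al: "alpha n ?y k = 0" for k
    unfolding alpha_def NF_mult[OF n idx] using n by (simp add: mv_zero)
  have T: "Tm n a = idm n" if "\<And>k. a k = 0" for a
    by (rule mat_eqI[of n]) (auto simp: Tm_mv[OF n] ev_vec mv_idm that fun_eq_iff)
  show "st n ?y = ?y"
    unfolding st_def B minv using T[of "alpha n ?y"] T[of "\<lambda>k. - alpha n ?y k"] al
    by (simp add: mm_idm act_idm NF_space[OF n])
qed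

text \<open>The isomorphism invariants make the coordinate zero on the part of the source orbit
  where it is defined; density passes this on to every normal form in the closure.\<close>

lemma NF_closure_vanish:
  assumes n: "n > 3" and bd0: "b0 * d0 = 0"
    and ch: "chart n (orbit n (NF n b0 c0 d0)) (\<lambda>y. mdet n (B0 n y)) I \<Delta> \<Theta> \<psi>"
    and j: "j \<in> extraI"
    and H2: "\<And>b c d. b * d = 0 \<Longrightarrow> b = 0 \<longleftrightarrow> b0 = 0 \<Longrightarrow> d = 0 \<longleftrightarrow> d0 = 0 \<Longrightarrow>
      c = 0 \<and> d = 0 \<longleftrightarrow> c0 = 0 \<and> d0 = 0 \<Longrightarrow> cf b c d j = 0"
    and deg: "degen n (NF n b0 c0 d0) (NF n b c d)"
  shows "cf b c d j = 0"
proof -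
  let ?p = "NF n b0 c0 d0"
  have val: "coords n y j = cf b c d j" if "st n y = NF n b c d" for y b c d
  proof -
    have "n - 1 \<noteq> n"
      using n by simp
    then show ?thesis
      using j n that by (auto simp: extraI_def coords_def cf_def idx_def NF_def chainm_def sqn_def br1n_def)
  qed
  have "coords n (NF n b c d) j = 0"
  proof (rule chart.reg_vanish_on_open[OF ch])
    show "(\<lambda>y. coords n y j) \<in> reg (polyfun n) (\<lambda>y. mdet n (B0 n y))"
      by (rule coords_reg[OF n]) (use j in auto)
    show "NF n b c d \<in> zclosure n (orbit n ?p)"
      using deg degen_iff[OF NF_space[OF n]] by simp
    show "mdet n (B0 n (NF n b c d)) \<noteq> 0"
      by (rule NF_coords(1)[OF n])
  next
    fix y assume y: "y \<in> orbit n ?p" "mdet n (B0 n y) \<noteq> 0"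
    obtain g h where gh: "invpair n g h" "y = act n g h ?p"
      using y(1) unfolding orbit_def by blast
    obtain b c d where bcd: "b * d = 0" "st n y = NF n b c d"
      using st_NF[OF n _ _ y(2)] poisson_act[OF NF_poisson[OF n bd0] gh(1)] nilp_act[OF NF_nilp[OF n] gh(1)] unfolding gh(2) by blast
    have "invpair n (mm n (Tm n (\<lambda>k. - alpha n y k)) (minv n (B0 n y))) (mm n (B0 n y) (Tm n (alpha n y)))"
      by (rule invpair_mm[OF Tm_invpair[OF n] invpair_sym[OF invpair_minv[OF _ y(2)]]]) (simp add: B0_def)
    from orbit_trans[OF y(1) orbitI[OF this]] have "NF n b c d \<in> orbit n ?p"
      unfolding bcd(2)[symmetric] st_def .
    from NF_orbit_invariants[OF n bcd(1) bd0 this] show "coords n y j = 0"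
      using val[OF bcd(2)] H2[OF bcd(1)] by simp
  qed
  then show ?thesis
    using val[OF NF_coords(2)[OF n]] by simp
qed

lemma NF_degen_vanish:
  assumes n: "n > 3"
  shows "degen n (NF n 0 0 1) (NF n b c d) \<Longrightarrow> b = 0"
    and "degen n (NF n 1 1 0) (NF n b c d) \<Longrightarrow> d = 0"
    and "degen n (NF n 0 1 0) (NF n b c d) \<Longrightarrow> b = 0 \<and> d = 0"
    and "degen n (NF n 1 0 0) (NF n b c d) \<Longrightarrow> c = 0 \<and> d = 0"
    and "degen n (NF n 0 0 0) (NF n b c d) \<Longrightarrow> b = 0 \<and> c = 0 \<and> d = 0"
proof -
  have e: "(0, 0) \<in> extraI" "(0, 1) \<in> extraI" "(0, 2) \<in> extraI"
    by (auto simp: extraI_def)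
  have cfs: "cf b c d (0, 0) = b" "cf b c d (0, 1) = c" "cf b c d (0, 2) = d" for b c d
    by (auto simp: cf_def)
  note Vb = NF_closure_vanish[OF n _ _ e(1), unfolded cfs]
    and Vc = NF_closure_vanish[OF n _ _ e(2), unfolded cfs]
    and Vd = NF_closure_vanish[OF n _ _ e(3), unfolded cfs]
  show "b = 0" if "degen n (NF n 0 0 1) (NF n b c d)"
    using Vb[OF _ chart_P12[OF n] _ that] by simp
  show "d = 0" if "degen n (NF n 1 1 0) (NF n b c d)"
    using Vd[OF _ chart_P15[OF n] _ that] by simp
  show "b = 0 \<and> d = 0" if "degen n (NF n 0 1 0) (NF n b c d)"
    using Vb[OF _ chart_P13[OF n] _ that] Vd[OF _ chart_P13[OF n] _ that] by simp
  show "c = 0 \<and> d = 0" if "degen n (NF n 1 0 0) (NF n b c d)"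
    using Vc[OF _ chart_P14[OF n] _ that] Vd[OF _ chart_P14[OF n] _ that] by simp
  show "b = 0 \<and> c = 0 \<and> d = 0" if "degen n (NF n 0 0 0) (NF n b c d)"
    using Vb[OF _ chart_P11[OF n] _ that] Vc[OF _ chart_P11[OF n] _ that] Vd[OF _ chart_P11[OF n] _ that] by simp
qed

text \<open>The vanishing of the e_n coordinate of the n-th power of e_1 is a closed condition that
  nilpotency forces on the source, while the target has the value 1.\<close>

lemma NF_not_degen_CH:
  assumes n: "n > 3"
  shows "\<not> degen n (NF n b c d) (CH n)"
proof
  assume deg: "degen n (NF n b c d) (CH n)"
  have idx: "1 \<in> idx n" "n \<in> idx n"
    using n by (auto simp: idx_def)
  have "pw n (fst (CH n)) n n = 0"
  proof (rule degen_vanish[OF deg CH_space pw_polyfun[OF idx(2)]])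
    fix y assume "y \<in> orbit n (NF n b c d)"
    then obtain g h where "invpair n g h" "y = act n g h (NF n b c d)"
      unfolding orbit_def by blast
    then have "nilp n (n - 1) y"
      using nilp_act[OF NF_nilp[OF n]] by simp
    then show "pw n (fst y) n n = 0"
      using ev_vec[OF idx(1)] by (simp add: nilp_def pw_def)
  qed
  moreover have "pw n (fst (CH n)) k = Ev n k" if "1 \<le> k" for k
    using that
  proof (induction k rule: dec_induct)
    case base
    show ?case using n by (simp add: Ev_def)
  next
    case (step k)
    have "pw n (fst (CH n)) (Suc k) = bil n (fst (CH n)) (Ev n 1) (Ev n k)"
      using step n by (simp add: pw_Suc Ev_def[of n 1])
    also have "\<dots> = Ev n (Suc k)"
      using CH_mult_Ev[of 1 k n] step by (simp add: Suc_eq_plus1_left)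
    finally show ?case .
  qed
  ultimately show False
    using n by (simp add: Ev_def ev_def)
qed

text \<open>Having zero bracket is a closed condition.\<close>

lemma CH_degen_NF:
  assumes n: "n > 3" and deg: "degen n (CH n) (NF n b c d)"
  shows "c = 0 \<and> d = 0"
proof -
  have idx: "1 \<in> idx n" "n \<in> idx n" "n - 1 \<in> idx n" "n - 1 \<noteq> n"
    using n by (auto simp: idx_def)
  have "snd (NF n b c d) 1 n k = 0" if "k \<in> idx n" for k
  proof (rule degen_vanish[OF deg NF_space[OF n]])
    show "(\<lambda>y. snd y 1 n k) \<in> polyfun n"
      by (rule polyfun.pcoord2[OF idx(1,2) that])
    show "snd y 1 n k = 0" if "y \<in> orbit n (CH n)" for y
      using that by (auto simp: orbit_def act_def act1_def CH_def)
  qed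
  from this[OF idx(2)] this[OF idx(3)] show ?thesis
    using idx by (simp add: NF_def br1n_def)
qed

section \<open>Degenerations by explicit limits\<close>

definition ep :: "nat \<Rightarrow> complex" where
  "ep m = complex_of_real (inverse (real (Suc m)))"

lemma ep_nz: "ep m \<noteq> 0"
  unfolding ep_def of_real_eq_0_iff by simp

lemma ep_lim: "ep \<longlonglongrightarrow> 0"
proof -
  have "(\<lambda>m. complex_of_real (inverse (real (Suc m)))) \<longlonglongrightarrow> complex_of_real 0"
    by (intro tendsto_of_real LIMSEQ_inverse_real_of_nat)
  then show ?thesis
    by (simp add: ep_def[abs_def])
qed

lemma ep_power_lim: "k > 0 \<Longrightarrow> (\<lambda>m. ep m ^ k) \<longlonglongrightarrow> 0"
  using tendsto_power[OF ep_lim, of k] by (simp add: power_0_left)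

lemma degen_NF_limit:
  assumes n: "n > 3" and P: "\<And>m. NF n (b m) (c m) (d m) \<in> orbit n p"
    and lim: "b \<longlonglongrightarrow> b'" "c \<longlonglongrightarrow> c'" "d \<longlonglongrightarrow> d'"
  shows "degen n p (NF n b' c' d')"
  by (rule degen_limit[OF NF_space[OF n] P])
     (auto simp: NF_def intro!: tendsto_intros lim)

lemma NF_degenerations:
  assumes n: "n > 3"
  shows "degen n (NF n 0 0 1) (NF n 0 1 0)" "degen n (NF n 1 1 0) (NF n 0 1 0)"
    "degen n (NF n 1 1 0) (NF n 1 0 0)" "degen n (NF n 0 1 0) (NF n 0 0 0)" "degen n (NF n 1 0 0) (NF n 0 0 0)"
proof -
  note nz = ep_nz
  have e1: "n - 2 = Suc (n - 3)" "n - 1 = Suc (Suc (n - 3))"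
    using n by auto
  \<comment> \<open>The shift r keeps c at 1 while d tends to 0.\<close>
  have "NF n 0 1 (ep m) \<in> orbit n (NF n 0 0 1)" for m
    using NF_scale[OF n, of 0 1 "ep m" 1 0 "- (ep m ^ (n - 2))"] nz by simp
  from degen_NF_limit[OF n this tendsto_const tendsto_const ep_lim]
  show "degen n (NF n 0 0 1) (NF n 0 1 0)" .
  \<comment> \<open>Choosing t = a^(n-2) keeps c at 1, and b becomes a^(n-3), which tends to 0 with
    a.\<close>
  have "NF n (ep m ^ (n - 3)) 1 0 \<in> orbit n (NF n 1 1 0)" for m
  proof -
    have "(ep m ^ (n - 2))\<^sup>2 * 1 / ep m ^ (n - 1) = ep m ^ (n - 3)"
      unfolding e1 using nz[of m] by (simp add: power2_eq_square)
    then show ?thesis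
      using NF_scale[OF n, of 1 0 "ep m" "ep m ^ (n - 2)" 1 0] nz[of m] by simp
  qed
  from degen_NF_limit[OF n this ep_power_lim tendsto_const tendsto_const]
  show "degen n (NF n 1 1 0) (NF n 0 1 0)"
    using n by simp
  have "NF n 1 (ep m ^ (n - 3)) 0 \<in> orbit n (NF n 1 1 0)" for m
  proof -
    \<comment> \<open>Here t^2 = a^(n-1) keeps b at 1; the even exponent in a makes t a power of
      \<open>ep m\<close>, and c = t / a^(n-2) becomes the (n-3)-rd power of
      \<open>ep m\<close>.\<close>
    let ?a = "1 / (ep m)\<^sup>2" and ?t = "1 / ep m ^ (n - 1)"
    have "?t\<^sup>2 * 1 / ?a ^ (n - 1) = 1"
      using nz[of m] by (simp add: power_divide power_mult[symmetric] mult.commute)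
    moreover have "(?t * 1 - 0 * 0) / ?a ^ (n - 2) = ep m ^ (n - 3)"
      unfolding e1 using nz[of m] by (simp add: power_divide power_mult[symmetric] power2_eq_square power_mult_distrib)
    ultimately show ?thesis
      using NF_scale[OF n, of 1 0 ?a ?t 1 0] nz[of m] by simp
  qed
  from degen_NF_limit[OF n this tendsto_const ep_power_lim tendsto_const]
  show "degen n (NF n 1 1 0) (NF n 1 0 0)"
    using n by simp
  have "NF n 0 (ep m) 0 \<in> orbit n (NF n 0 1 0)" for m
    using NF_scale[OF n, of 0 0 1 "ep m" 1 0] nz by simp
  from degen_NF_limit[OF n this tendsto_const ep_lim tendsto_const]
  show "degen n (NF n 0 1 0) (NF n 0 0 0)" .
  have "NF n ((ep m)\<^sup>2) 0 0 \<in> orbit n (NF n 1 0 0)" for m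
    using NF_scale[OF n, of 1 0 1 "ep m" 0 0] nz by simp
  from degen_NF_limit[OF n this ep_power_lim tendsto_const tendsto_const]
  show "degen n (NF n 1 0 0) (NF n 0 0 0)"
    by simp
qed

lemma CH_mult_shift:
  assumes i: "i \<in> idx n" and x: "x \<in> Defs.vec n"
  shows "bil n (fst (CH n)) (ev i) x = (\<lambda>l. if i < l \<and> l \<le> n then x (l - i) else 0)"
proof
  fix l
  have "bil n (fst (CH n)) (ev i) x l = (\<Sum>j\<in>idx n. x j * bil n (fst (CH n)) (ev i) (ev j) l)"
    by (rule bil_expand_right[OF x])
  also have "\<dots> = (\<Sum>j\<in>idx n. if j = l - i then if i < l \<and> l \<le> n then x (l - i) else 0 else 0)"
    by (intro sum.cong refl, subst CH_mult[OF i], assumption) (auto simp: Ev_def ev_def idx_def)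
  also have "\<dots> = (if i < l \<and> l \<le> n then x (l - i) else 0)"
    by (auto simp: idx_def)
  finally show "bil n (fst (CH n)) (ev i) x l = (if i < l \<and> l \<le> n then x (l - i) else 0)" .
qed

text \<open>In terms of e_k = x^k, the degenerating basis is x, ..., x^(n-1) together with a multiple of the geometric
  sum S = sum (k = 1..n) s^(2(n-k)) x^k, which satisfies x S = s^2 S - s^(2n) x. The factor is normalised
  so that the coefficient of x^(n-1) in the square of the last basis vector is 1.\<close>
lemma CH_degen_P14:
  assumes n: "n > 3"
  shows "degen n (CH n) (NF n 1 0 0)"
proof -
  \<comment> \<open>The x^(n-1) coefficient of the square is \<theta>^2 ((n - 2) - (n - 1)) s^(2 (n
    + 1)), and this value of \<theta> makes it 1. Weights s^2 instead of s keep the square root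
    rational in s.\<close>
  define \<theta> where "\<theta> s = \<i> / s ^ (n + 1)" for s :: complex
  define v where "v s k = (if k < n then ev k else (\<lambda>i. if i \<in> idx n then \<theta> s * s ^ (2 * (n - i)) else 0))" for s k
  define u where "u s k = (if k < n then ev k
     else (\<lambda>i. if i \<in> idx n then (if i = n then 1 / \<theta> s else - (s ^ (2 * (n - i)))) else 0))" for s k
  have nidx: "n \<in> idx n"
    using n by (simp add: idx_def)
  have vv: "v s k \<in> Defs.vec n" and uv: "u s k \<in> Defs.vec n" if "k \<in> idx n" for s k
    using that by (auto simp: v_def u_def Defs.vec_def ev_def)
  have mvc: "mv n (colmat n (\<lambda>k. if k < n then ev k else w)) x = (\<lambda>l. if l \<in> idx n then (if l < n then x l else 0) + x n * w l else 0)"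
    for w x
  proof
    fix l
    show "mv n (colmat n (\<lambda>k. if k < n then ev k else w)) x l = (if l \<in> idx n then (if l < n then x l else 0) + x n * w l else 0)"
    proof (cases "l \<in> idx n")
      case True
      have "mv n (colmat n (\<lambda>k. if k < n then ev k else w)) x l = (\<Sum>j\<in>idx n. (if j < n then ev j else w) l * x j)"
        using True by (simp add: mv_def colmat_def cong: sum.cong)
      also have "\<dots> =
          (\<Sum>j\<in>idx n. (if j = l then if l < n then x l else 0 else 0) + (if j = n then x n * w l else 0))"
        using True by (intro sum.cong refl) (auto simp: ev_def idx_def)
      also have "\<dots> = (if l < n then x l else 0) + x n * w l"
        using True nidx by (simp add: sum.distrib)
      finally show ?thesis
        using True by simp
    qed (simp add: mv_def)
  qed
  have uc: "colmat n (u s) = colmat n (\<lambda>k. if k < n then ev k else u s n)"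
    and vc: "colmat n (v s) = colmat n (\<lambda>k. if k < n then ev k else v s n)" for s
    by (auto simp: colmat_def u_def v_def fun_eq_iff idx_def)
  have gx: "mv n (colmat n (u s)) x = (\<lambda>l. if l \<in> idx n then if l = n then x n / \<theta> s else x l - x n * s ^ (2 * (n - l)) else 0)" for s x
    unfolding uc mvc by (auto simp: u_def fun_eq_iff idx_def)
  have hx: "mv n (colmat n (v s)) x = (\<lambda>l. if l \<in> idx n then (if l < n then x l else 0) + x n * (\<theta> s * s ^ (2 * (n - l))) else 0)" for s x
    unfolding vc mvc by (auto simp: v_def fun_eq_iff idx_def)
  have \<theta>nz: "\<theta> s \<noteq> 0" if "s \<noteq> 0" for s
    using that by (simp add: \<theta>_def)
  have gh: "invpair n (colmat n (u s)) (colmat n (v s))" if s: "s \<noteq> 0" for s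
  proof (rule invpairI)
    fix k assume k: "k \<in> idx n"
    show "mv n (colmat n (u s)) (mv n (colmat n (v s)) (ev k)) = ev k"
      "mv n (colmat n (v s)) (mv n (colmat n (u s)) (ev k)) = ev k"
      unfolding gx hx using \<theta>nz[OF s] k by (auto simp: fun_eq_iff ev_def idx_def)
  qed simp_all
  \<comment> \<open>Closed form of the structure constants in the new basis. No negative power of s
    is left, and for l <= k the subtraction of n + 1 in the exponent is exact, so the limit is the
    value at s = 0.\<close>
  define C where "C s i j l = (if i < n \<and> j < n then
      (if i + j < n then (if l = i + j then 1 else 0)
       else if i + j = n then (if l = n then - \<i> * s ^ (n + 1) else - (s ^ (2 * (n - l)))) else 0)
    else if i < n \<or> j < n then
      (let k = min i j in if l = n then s ^ (2 * k) else if l \<le> k then - \<i> * s ^ (2 * (n - l + k) - (n + 1)) else 0)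
    else if l = n then \<i> * of_nat (n - 1) * s ^ (n - 1) else of_nat (n - l) * s ^ (2 * (n - 1 - l)))"
    for s :: complex and i j l :: nat
  define q where "q m = act n (colmat n (u (ep m))) (colmat n (v (ep m))) (CH n)" for m
  have comm: "bil n (fst (CH n)) x y = bil n (fst (CH n)) y x" if "x \<in> Defs.vec n" "y \<in> Defs.vec n" for x y
    using CH_poisson[of n] that unfolding poisson_iff by blast
  have val: "fst (q m) i j l = C (ep m) i j l" if ij: "i \<in> idx n" "j \<in> idx n" and l: "l \<in> idx n" for m i j l
  proof -
    define s where "s = ep m"
    have s: "s \<noteq> 0"
      by (simp add: s_def ep_nz)
    let ?g = "mv n (colmat n (u s))" and ?M = "bil n (fst (CH n))"
    have hv: "mv n (colmat n (v s)) (ev k) = v s k" if "k \<in> idx n" for k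
      by (rule mv_colmat[of k n "v s", OF that vv[OF that]])
    have "fst (q m) i j = bil n (fst (q m)) (ev i) (ev j)"
      by (rule bil_ev[OF ij, symmetric]) (simp add: q_def act_def)
    also have "\<dots> = ?g (?M (v s i) (v s j))"
      by (simp add: q_def bil_act s_def[symmetric] hv ij)
    finally have q: "fst (q m) i j = ?g (?M (v s i) (v s j))" .
    \<comment> \<open>Above index k, multiplication by x^k turns the geometric sum into a multiple
      of itself, so expressing x^n through the last basis vector cancels these entries; only the
      entries up to k and the last one survive.\<close>
    have mixed: "?g (?M (ev k) (v s n)) l = (if l = n then s ^ (2 * k) else if l \<le> k then - \<i> * s ^ (2 * (n - l + k) - (n + 1)) else 0)"
      if k: "k \<in> idx n" "k < n" for k
    proof -
      have M: "?M (ev k) (v s n) = (\<lambda>l. if k < l \<and> l \<le> n then \<theta> s * s ^ (2 * (n - (l - k))) else 0)"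
        unfolding CH_mult_shift[OF k(1) vv[OF nidx]] by (auto simp: v_def idx_def fun_eq_iff)
      show ?thesis
      proof (cases "l = n")
        case True
        then show ?thesis
          unfolding gx M using k nidx \<theta>nz[OF s] by simp
      next
        case False
        have "2 * (n - (n - k)) + 2 * (n - l) = 2 * (n - l + k)"
          using k by simp
        then have t: "\<theta> s * s ^ (2 * (n - (n - k))) * s ^ (2 * (n - l)) = \<theta> s * s ^ (2 * (n - l + k))"
          by (metis mult.assoc power_add)
        show ?thesis
        proof (cases "l \<le> k")
          case True
          have "2 * (n - l + k) = (n + 1) + (2 * (n - l + k) - (n + 1))"
            using True k n by simp
          then have "s ^ (2 * (n - l + k)) = s ^ (n + 1) * s ^ (2 * (n - l + k) - (n + 1))"
            by (metis power_add)
          then have "\<theta> s * s ^ (2 * (n - l + k)) = \<i> * s ^ (2 * (n - l + k) - (n + 1))"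
            using s by (simp add: \<theta>_def)
          then show ?thesis
            unfolding gx M using False True l k t by simp
        next
          case F2: False
          have "2 * (n - (l - k)) = 2 * (n - l + k)"
            using F2 l by (auto simp: idx_def)
          then show ?thesis
            unfolding gx M using False F2 l k t by (auto simp: idx_def)
        qed
      qed
    qed
    consider "i < n" "j < n" | "i < n" "j = n" | "i = n" "j < n" | "i = n" "j = n"
      using ij by (fastforce simp: idx_def)
    then have "?g (?M (v s i) (v s j)) l = C s i j l"
    proof cases
      case 1
      have "?M (v s i) (v s j) = Ev n (i + j)"
        using 1 CH_mult[OF ij] by (simp add: v_def)
      then show ?thesis
        unfolding gx using 1 ij l s by (auto simp: C_def Ev_def ev_def idx_def \<theta>_def)
    next
      case 2
      then show ?thesis
        using mixed[OF ij(1)] by (simp add: v_def[of s i] C_def Let_def min_def)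
    next
      case 3
      have "?M (v s i) (v s j) = ?M (v s j) (v s i)"
        by (rule comm[OF vv[OF ij(1)] vv[OF ij(2)]])
      then show ?thesis
        using 3 mixed[OF ij(2)] by (simp add: v_def[of s j] C_def Let_def min_def)
    next
      case 4
      \<comment> \<open>The coefficient of x^k in the square collects k - 1 pairs of exponents, all
        of the same weight.\<close>
      have M: "?M (v s n) (v s n) k = (\<theta> s)\<^sup>2 * (of_nat (k - 1) * s ^ (2 * (2 * n - k)))" if k: "k \<in> idx n" for k
      proof -
        have "?M (v s n) (v s n) k = (\<Sum>j\<in>idx n. v s n j * ?M (v s n) (ev j) k)"
          by (rule bil_expand_right[OF vv[OF nidx]])
        also have "\<dots> = (\<Sum>j\<in>idx n. if j < k then (\<theta> s)\<^sup>2 * s ^ (2 * (2 * n - k)) else 0)"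
        proof (rule sum.cong)
          fix j assume j: "j \<in> idx n"
          have "?M (v s n) (ev j) k = (if j < k \<and> k \<le> n then v s n (k - j) else 0)"
            unfolding comm[OF vv[OF nidx] ev_vec[OF j]] CH_mult_shift[OF j vv[OF nidx]] by simp
          moreover have "2 * (n - j) + 2 * (n - (k - j)) = 2 * (2 * n - k)" if "j < k"
            using that j k by (auto simp: idx_def)
          then have "s ^ (2 * (n - j)) * s ^ (2 * (n - (k - j))) = s ^ (2 * (2 * n - k))" if "j < k"
            using that by (metis power_add)
          ultimately show "v s n j * ?M (v s n) (ev j) k = (if j < k then (\<theta> s)\<^sup>2 * s ^ (2 * (2 * n - k)) else 0)"
            using j k by (auto simp: v_def idx_def power2_eq_square algebra_simps)
        qed simp
        also have "\<dots> = (\<Sum>j\<in>{1..<k}. (\<theta> s)\<^sup>2 * s ^ (2 * (2 * n - k)))"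
          using k by (intro sum.mono_neutral_cong_right) (auto simp: idx_def)
        also have "\<dots> = (\<theta> s)\<^sup>2 * (of_nat (k - 1) * s ^ (2 * (2 * n - k)))"
          by simp
        finally show ?thesis .
      qed
      show ?thesis
      proof (cases "l = n")
        case True
        have "2 * (2 * n - n) = (n + 1) + (n - 1)"
          using n by simp
        then have "s ^ (2 * (2 * n - n)) = s ^ (n + 1) * s ^ (n - 1)"
          by (metis power_add)
        then show ?thesis
          unfolding gx using 4 True nidx M[OF nidx] \<theta>nz[OF s] s n
          by (simp add: C_def power2_eq_square \<theta>_def)
      next
        case False
        then have ln: "1 \<le> l" "l < n"
          using l by (auto simp: idx_def)
        have "2 * (2 * n - n) + 2 * (n - l) = 2 * (2 * n - l)"
          using ln by simp
        then have p1: "s ^ (2 * (2 * n - n)) * s ^ (2 * (n - l)) = s ^ (2 * (2 * n - l))"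
          by (metis power_add)
        have "2 * (2 * n - l) = 2 * (n + 1) + 2 * (n - 1 - l)"
          using ln by simp
        then have p2: "s ^ (2 * (2 * n - l)) = (s ^ (n + 1))\<^sup>2 * s ^ (2 * (n - 1 - l))"
          by (metis power_add power_mult mult.commute)
        have f1: "(of_nat (n - l) :: complex) = of_nat (n - 1) - of_nat (l - 1)"
          using ln by (simp add: of_nat_diff)
        have f2: "?g (?M (v s i) (v s j)) l = (\<theta> s)\<^sup>2 * s ^ (2 * (2 * n - l)) * (of_nat (l - 1) - of_nat (n - 1))"
          unfolding gx using 4 False l M[OF l] M[OF nidx] p1
          by (simp add: algebra_simps)
        have f3: "(\<theta> s)\<^sup>2 * s ^ (2 * (2 * n - l)) = - (s ^ (2 * (n - 1 - l)))"
          unfolding p2 using s by (simp add: \<theta>_def power_divide)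
        have "- x * (a - b) = (b - a) * x" for x a b :: complex
          by (simp add: algebra_simps)
        then have "?g (?M (v s i) (v s j)) l = of_nat (n - l) * s ^ (2 * (n - 1 - l))"
          unfolding f1 f2 f3 .
        then show ?thesis
          using 4 False by (simp add: C_def)
      qed
    qed
    then show ?thesis
      unfolding q s_def .
  qed
  have lim: "(\<lambda>m. C (ep m) i j l) \<longlonglongrightarrow> fst (NF n 1 0 0) i j l"
    if ij: "i \<in> idx n" "j \<in> idx n" "l \<in> idx n" for i j l
  proof -
    have "(\<lambda>m. C (ep m) i j l) \<longlonglongrightarrow> C 0 i j l"
      unfolding C_def Let_def by (auto intro!: tendsto_intros ep_lim)
    \<comment> \<open>At s = 0 the square of the last vector keeps only l = n - 1, where the
      exponent is 0 and the factor n - l is 1; all mixed products vanish.\<close>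
    moreover have "C 0 i j l = fst (NF n 1 0 0) i j l"
      using ij n by (auto simp: C_def NF_def chainm_def sqn_def idx_def power_0_left Let_def min_def)
    ultimately show ?thesis
      by simp
  qed
  show ?thesis
  proof (rule degen_limit[OF NF_space[OF n], where P = q])
    show "q m \<in> orbit n (CH n)" for m
      unfolding q_def by (rule orbitI[OF gh[OF ep_nz]])
    fix i j k assume ijk: "i \<in> idx n" "j \<in> idx n" "k \<in> idx n"
    have "snd (q m) i j k = 0" for m
      by (simp add: q_def act_def act1_def CH_def)
    moreover have "snd (NF n 1 0 0) i j k = 0"
      by (simp add: NF_def)
    ultimately show "(\<lambda>m. fst (q m) i j k) \<longlonglongrightarrow> fst (NF n 1 0 0) i j k \<and> (\<lambda>m. snd (q m) i j k) \<longlonglongrightarrow> snd (NF n 1 0 0) i j k"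
      using lim[OF ijk] by (simp add: val[OF ijk])
  qed
qed

section \<open>The degeneration graph\<close>

lemma prim_list_trancl: "prim_list\<^sup>+ = prim_list \<union> {(P12, P11), (P15, P11), (P0, P11)}"
proof (intro equalityI subrelI)
  fix A B assume "(A, B) \<in> prim_list\<^sup>+"
  then show "(A, B) \<in> prim_list \<union> {(P12, P11), (P15, P11), (P0, P11)}"
    by induction (auto simp: prim_list_def)
next
  fix A B assume "(A, B) \<in> prim_list \<union> {(P12, P11), (P15, P11), (P0, P11)}"
  moreover have "(P12, P13) \<in> prim_list" "(P13, P11) \<in> prim_list" "(P15, P13) \<in> prim_list"
    "(P0, P14) \<in> prim_list" "(P14, P11) \<in> prim_list"
    by (auto simp: prim_list_def)
  ultimately show "(A, B) \<in> prim_list\<^sup>+"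
    by (auto intro: r_into_trancl trancl_into_trancl)
qed

lemma alg_space: "n > 3 \<Longrightarrow> alg_struct n A \<in> space n"
  by (cases A) (simp_all only: alg_struct_NF alg_struct_CH NF_space CH_space)

text \<open>Every pair outside the transitive closure is excluded by a closed condition: a
  coordinate b, c or d that vanishes on the source, the zero bracket of P0, or the nilpotency that
  P0 violates.\<close>

lemma degen_alg_iff:
  assumes n: "n > 3" and AB: "A \<noteq> B"
  shows "degen n (alg_struct n A) (alg_struct n B) \<longleftrightarrow> (A, B) \<in> prim_list\<^sup>+"
proof
  assume "(A, B) \<in> prim_list\<^sup>+"
  then show "degen n (alg_struct n A) (alg_struct n B)"
  proof induction
    case (base B)
    then show ?case
      using NF_degenerations[OF n] CH_degen_P14[OF n]
      by (auto simp only: prim_list_def alg_struct_NF alg_struct_CH insert_iff empty_iff prod.inject)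
  next
    case (step B C)
    have "degen n (alg_struct n B) (alg_struct n C)"
      using step(2) NF_degenerations[OF n] CH_degen_P14[OF n]
      by (auto simp only: prim_list_def alg_struct_NF alg_struct_CH insert_iff empty_iff prod.inject)
    then show ?case
      using step(3) degen_trans[OF alg_space[OF n] alg_space[OF n]] by blast
  qed
next
  assume deg: "degen n (alg_struct n A) (alg_struct n B)"
  show "(A, B) \<in> prim_list\<^sup>+"
    unfolding prim_list_trancl
    using deg AB
    by (cases A; cases B; simp only: alg_struct_NF alg_struct_CH)
       (auto simp: prim_list_def NF_not_degen_CH[OF n] dest: NF_degen_vanish[OF n] CH_degen_NF[OF n])
qed

text \<open>An isomorphism would give degenerations in both directions, but the graph has no
  cycles.\<close>

lemma not_iso_alg:
  assumes n: "n > 3" and AB: "A \<noteq> B"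
  shows "\<not> iso n (alg_struct n A) (alg_struct n B)"
proof
  assume iso: "iso n (alg_struct n A) (alg_struct n B)"
  have "(A, B) \<in> prim_list\<^sup>+"
    using iso_degen[OF alg_space[OF n] iso] degen_alg_iff[OF n AB] by simp
  moreover have "(B, A) \<in> prim_list\<^sup>+"
    using iso_degen[OF alg_space[OF n] iso_sym[OF alg_space[OF n] iso]] degen_alg_iff[OF n AB[symmetric]] by simp
  ultimately show False
    unfolding prim_list_trancl by (auto simp: prim_list_def)
qed

lemma poisson_alg: "n > 3 \<Longrightarrow> poisson n (alg_struct n A)"
  by (cases A) (simp_all only: alg_struct_NF alg_struct_CH NF_poisson CH_poisson mult_zero_left mult_zero_right)

fun alg_codim :: "alg \<Rightarrow> nat" where
  "alg_codim P0 = 0" | "alg_codim P12 = 0" | "alg_codim P15 = 0"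
| "alg_codim P13 = 1" | "alg_codim P14 = 1" | "alg_codim P11 = 2"

lemma tame_alg: "n > 3 \<Longrightarrow> tame n (orbit n (alg_struct n A)) (n\<^sup>2 - n - alg_codim A)"
  using tame_NF[of n] tame_CH[of n]
  by (cases A) (simp_all only: alg_struct_NF alg_struct_CH alg_codim.simps minus_nat.diff_0)

text \<open>Listed pairs lower the dimension by exactly one. The three remaining degenerations end
  in P11 and factor through P13 or P14.\<close>

lemma primary_alg_iff:
  assumes n: "n > 3"
  shows "primary n (alg_struct n A) (alg_struct n B) \<longleftrightarrow> (A, B) \<in> prim_list"
proof
  assume AB: "(A, B) \<in> prim_list"
  have ne: "A \<noteq> B" and cod: "alg_codim B = Suc (alg_codim A)" "alg_codim B \<le> 2"
    using AB by (auto simp: prim_list_def)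
  \<comment> \<open>The subtraction is exact, since n^2 - n is at least 2 and the codimensions are
    at most 2.\<close>
  have "n\<^sup>2 - n - alg_codim A = Suc (n\<^sup>2 - n - alg_codim B)"
    using cod square_minus_ge[OF n] by simp
  then have "tame n (orbit n (alg_struct n A)) (Suc (n\<^sup>2 - n - alg_codim B))"
    using tame_alg[OF n, of A] by simp
  moreover have "degen n (alg_struct n A) (alg_struct n B)"
    using degen_alg_iff[OF n ne] AB by auto
  ultimately show "primary n (alg_struct n A) (alg_struct n B)"
    using primary_of_tame[OF alg_space[OF n] _ alg_space[OF n] tame_alg[OF n]] not_iso_alg[OF n ne] by blast
next
  assume pr: "primary n (alg_struct n A) (alg_struct n B)"
  show "(A, B) \<in> prim_list"
  proof (rule ccontr)
    assume AB: "(A, B) \<notin> prim_list"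
    have "A \<noteq> B"
      using pr orbit_refl[OF alg_space[OF n]] unfolding primary_def iso_def by auto
    moreover have "degen n (alg_struct n A) (alg_struct n B)"
      using pr unfolding primary_def by simp
    ultimately have "(A, B) \<in> {(P12, P11), (P15, P11), (P0, P11)}"
      using degen_alg_iff[OF n] AB unfolding prim_list_trancl by auto
    then obtain C where C: "(A, C) \<in> prim_list" "(C, B) \<in> prim_list" "A \<noteq> C" "C \<noteq> B"
      by (auto simp: prim_list_def)
    then have "degen n (alg_struct n A) (alg_struct n C)" "degen n (alg_struct n C) (alg_struct n B)"
      using degen_alg_iff[OF n] by auto
    then show False
      using pr poisson_alg[OF n, of C] not_iso_alg[OF n C(3)] not_iso_alg[OF n C(4)] unfolding primary_def by blast
  qed
qed

theorem theorem5p3: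
  fixes n :: nat
  assumes "n > 3"
  shows "(\<forall>A. poisson n (alg_struct n A)) \<and>
    zdim n (orbit n (alg_struct n P0)) (n^2 - n) \<and>
    zdim n (orbit n (alg_struct n P12)) (n^2 - n) \<and>
    zdim n (orbit n (alg_struct n P15)) (n^2 - n) \<and>
    zdim n (orbit n (alg_struct n P13)) (n^2 - n - 1) \<and>
    zdim n (orbit n (alg_struct n P14)) (n^2 - n - 1) \<and>
    zdim n (orbit n (alg_struct n P11)) (n^2 - n - 2) \<and>
    (\<forall>A B. primary n (alg_struct n A) (alg_struct n B) \<longleftrightarrow> (A, B) \<in> prim_list) \<and>
    \<not> degen n (alg_struct n P0) (alg_struct n P13) \<and>
    \<not> degen n (alg_struct n P12) (alg_struct n P14) \<and>
    (\<forall>A B. A \<noteq> B \<longrightarrow>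
       (degen n (alg_struct n A) (alg_struct n B) \<longleftrightarrow> (A, B) \<in> prim_list\<^sup>+))"
proof -
  have zd: "zdim n (orbit n (alg_struct n A)) (n\<^sup>2 - n - alg_codim A)" for A
    by (rule tame_zdim[OF orbit_space tame_alg[OF assms]])
  have "(P0, P13) \<notin> prim_list\<^sup>+" "(P12, P14) \<notin> prim_list\<^sup>+"
    unfolding prim_list_trancl by (auto simp: prim_list_def)
  then have "\<not> degen n (alg_struct n P0) (alg_struct n P13)" "\<not> degen n (alg_struct n P12) (alg_struct n P14)"
    using degen_alg_iff[OF assms, of P0 P13] degen_alg_iff[OF assms, of P12 P14] by auto
  then show ?thesis
    using poisson_alg[OF assms] primary_alg_iff[OF assms] degen_alg_iff[OF assms]
      zd[of P0] zd[of P12] zd[of P15] zd[of P13] zd[of P14] zd[of P11]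
    by (simp only: alg_codim.simps minus_nat.diff_0) blast
qed

end
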